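(* Let $\nu_n$ be a sequence of positive integers with $\nu_n\to\infty$ as $n\to\infty$, and let $\rho_n=1/\log\nu_n$. Let $\mathcal M^*=\{k_1,\ldots,k_{M_n}\}$ be the candidate model set with $$k_m=\begin{cases}\nu_n, & m=1,\\ k_{m-1}+\lfloor\nu_n\rho_n(1+\rho_n)^{m-1}\rfloor, & m=2,\ldots,M_n-1,\\ p_n, & m=M_n,\end{cases}$$ where $M_n$ is the largest $m\in\mathbb N$ such that $\nu_n+\sum_{j=2}^{m}\lfloor\nu_n\rho_n(1+\rho_n)^{j-1}\rfloor\le p_n$. Suppose that the penalty factors are $$\varphi_m=\frac{1}{(k_m-k_{m-1})^{\tau}},\qquad m=1,\ldots,M_n,$$ for a fixed $\tau$ with $0<\tau<1/2$, and that $$\nu_n=o\left[R_n(\mathbf w^*|\mathcal M_a,\boldsymbol\mu)\right]\quad\text{as }n\to\infty.$$ Then the Stein-type model averaging estimator $\hat{\boldsymbol\mu}_{\hat{\mathbf w}|\mathcal M^*}=\sum_{m=1}^{M_n}\hat\gamma_m\mathbf y_{m|\mathcal M^*}$, with $\hat\gamma_m=\left(1-\frac{\sigma^2_{m|\mathcal M^*}(1+\varphi_m)}{\|\mathbf y_{m|\mathcal M^*}\|^2}\right)_+$, is fully asymptotically optimal, i.e. $$\mathbb E\|\hat{\boldsymbol\mu}_{\hat{\mathbf w}|\mathcal M^*}-\boldsymbol\mu\|^2\le[1+o(1)]\,R_n(\mathbf w^*|\mathcal M_a,\boldsymbol\mu)\quad\text{as }n\to\infty.$$ Here $\mathcal M_a=\{1,2,\ldots,p_n\}$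 and $R_n(\mathbf w^*|\mathcal M_a,\boldsymbol\mu)=\min_{\mathbf w\in\mathcal W_{p_n}}R_n(\mathbf w|\mathcal M_a,\boldsymbol\mu)$.
   Context: Setting. For each $n$, $\mathbf y=\boldsymbol\mu+\boldsymbol\varepsilon=\mathbf X\boldsymbol\beta+\boldsymbol\varepsilon\in\mathbb R^n$, where $\mathbf X=[\mathbf x_1,\ldots,\mathbf x_{p_n}]$ is a non-random $n\times p_n$ matrix of full column rank, $p_n\le n$, and $\boldsymbol\varepsilon$ has i.i.d. $N(0,\sigma^2)$ entries with fixed known $\sigma^2>0$. ($\mathbf X$, $\boldsymbol\beta$, $\boldsymbol\mu$ may depend on $n$.) Candidate models. A candidate model set is $\mathcal M=\{k_1<k_2<\cdots<k_{M}\}$, a set of integers in $\{1,\ldots,p_n\}$, with $k_0=0$. $\mathbf P_k$ is the orthogonal projection onto the span of $\mathbf x_1,\ldots,\mathbf x_k$, and $\mathbf P_0=\mathbf 0$. The least-squares estimators are $\hat{\boldsymbol\mu}_{k_m}=\mathbf P_{k_m}\mathbf y$. Block notation. $\mathbf y_{m|\mathcal M}=(\mathbf P_{k_m}-\mathbf P_{k_{m-1}})\mathbf y$; $\sigma^2_{m|\mathcal M}=(k_m-k_{m-1})\sigma^2$; $x_+=\max(x,0)$; $\|\cdot\|$ is the Euclidean norm. Averaging and risk. For $\mathbf w\in\mathbb R^{|\mathcal M|}$, $\hat{\boldsymbol\mu}_{\mathbf w|\mathcal M}=\sum_m w_m\hat{\boldsymbol\mu}_{k_m}$ and, for non-random $\mathbf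 w$, $R_n(\mathbf w|\mathcal M,\boldsymbol\mu)=\mathbb E\|\hat{\boldsymbol\mu}_{\mathbf w|\mathcal M}-\boldsymbol\mu\|^2$. The unit simplex is $\mathcal W_M=\{\mathbf w\in[0,1]^M:\sum_{m=1}^Mw_m=1\}$. The estimator $\sum_m\hat\gamma_m\mathbf y_{m|\mathcal M}$ equals $\hat{\boldsymbol\mu}_{\hat{\mathbf w}|\mathcal M}$ with random weights $\hat w_m=\hat\gamma_m-\hat\gamma_{m+1}$, where $\hat\gamma_{|\mathcal M|+1}=0$. *)

theory Defs
  imports
    "HOL-Probability.Probability"
    "HOL-Library.Landau_Symbols"
    "Jordan_Normal_Form.DL_Rank"
begin

(* Vectors of R^n and design matrices use the carrier-based types of Jordan_Normal_Form,
   since the dimension n is the running index of the asymptotics. *)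

definition enorm :: "real Matrix.vec \<Rightarrow> real" where
  "enorm v = L2_set (vec_index v) {..<dim_vec v}"

definition orth_proj :: "real Matrix.vec set \<Rightarrow> real Matrix.vec \<Rightarrow> real Matrix.vec" where
  "orth_proj S y = (THE v. v \<in> S \<and> (\<forall>u\<in>S. Matrix.scalar_prod (y - v) u = 0))"

definition col_proj :: "nat \<Rightarrow> real mat \<Rightarrow> nat \<Rightarrow> real Matrix.vec \<Rightarrow> real Matrix.vec" where
  "col_proj n X k =
     orth_proj (LinearCombinations.module.span class_ring (module_vec TYPE(real) n)
                  (set (take k (cols X))))"

(* A candidate model set {k_1 < ... < k_M} is given by its size M and its enumeration k,
   a function with k 0 = 0 that is only evaluated on {0..M}. *)

definition averaging_estimator ::
  "nat \<Rightarrow> real mat \<Rightarrow> (nat \<Rightarrow> nat) \<Rightarrow> nat \<Rightarrow> (nat \<Rightarrow> real) \<Rightarrow> real Matrix.vec \<Rightarrow> real Matrix.vec" where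
  "averaging_estimator n X k M w y =
     finsum_vec TYPE(real) n (\<lambda>m. w m \<cdot>\<^sub>v col_proj n X (k m) y) {1..M}"

definition unit_simplex :: "nat \<Rightarrow> (nat \<Rightarrow> real) set" where
  "unit_simplex M = {w \<in> {1..M} \<rightarrow>\<^sub>E {0..1}. (\<Sum>m=1..M. w m) = 1}"

definition mean_sq_error ::
  "'a measure \<Rightarrow> ('a \<Rightarrow> real Matrix.vec) \<Rightarrow> real Matrix.vec \<Rightarrow> real" where
  "mean_sq_error \<Omega> est \<mu> = (\<integral>\<omega>. (enorm (est \<omega> - \<mu>))\<^sup>2 \<partial>\<Omega>)"

definition averaging_risk ::
  "'a measure \<Rightarrow> nat \<Rightarrow> real mat \<Rightarrow> ('a \<Rightarrow> real Matrix.vec) \<Rightarrow> (nat \<Rightarrow> nat) \<Rightarrow> nat \<Rightarrow>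
   (nat \<Rightarrow> real) \<Rightarrow> real Matrix.vec \<Rightarrow> real" where
  "averaging_risk \<Omega> n X y k M w \<mu> =
     mean_sq_error \<Omega> (\<lambda>\<omega>. averaging_estimator n X k M w (y \<omega>)) \<mu>"

(* The model set {1, ..., p} of all nested models is enumerated by the identity. *)

definition optimal_weights ::
  "'a measure \<Rightarrow> nat \<Rightarrow> real mat \<Rightarrow> ('a \<Rightarrow> real Matrix.vec) \<Rightarrow> nat \<Rightarrow> real Matrix.vec \<Rightarrow>
   (nat \<Rightarrow> real)" where
  "optimal_weights \<Omega> n X y p \<mu> =
     arg_min (\<lambda>w. averaging_risk \<Omega> n X y (\<lambda>m. m) p w \<mu>) (\<lambda>w. w \<in> unit_simplex p)"

definition optimal_risk ::
  "'a measure \<Rightarrow> nat \<Rightarrow> real mat \<Rightarrow> ('a \<Rightarrow> real Matrix.vec) \<Rightarrow> nat \<Rightarrow> real Matrix.vec \<Rightarrow> real" where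
  "optimal_risk \<Omega> n X y p \<mu> =
     averaging_risk \<Omega> n X y (\<lambda>m. m) p (optimal_weights \<Omega> n X y p \<mu>) \<mu>"

definition block_size :: "(nat \<Rightarrow> nat) \<Rightarrow> nat \<Rightarrow> real" where
  "block_size k m = real (k m) - real (k (m - 1))"

definition block_vec ::
  "nat \<Rightarrow> real mat \<Rightarrow> (nat \<Rightarrow> nat) \<Rightarrow> nat \<Rightarrow> real Matrix.vec \<Rightarrow> real Matrix.vec" where
  "block_vec n X k m y = col_proj n X (k m) y - col_proj n X (k (m - 1)) y"

definition stein_factor ::
  "nat \<Rightarrow> real mat \<Rightarrow> real \<Rightarrow> (nat \<Rightarrow> nat) \<Rightarrow> (nat \<Rightarrow> real) \<Rightarrow> nat \<Rightarrow> real Matrix.vec \<Rightarrow> real" where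
  "stein_factor n X \<sigma> k \<phi> m y =
     max 0 (1 - block_size k m * \<sigma>\<^sup>2 * (1 + \<phi> m) / (enorm (block_vec n X k m y))\<^sup>2)"

(* By summation by parts this is averaging_estimator at the data-dependent weights
   w m = stein_factor m - stein_factor (m + 1), with stein_factor (M + 1) read as 0.
   If a block of y vanishes (an event of probability zero), division by zero makes the factor 1,
   but the factor then multiplies the zero vector. *)

definition stein_estimator ::
  "nat \<Rightarrow> real mat \<Rightarrow> real \<Rightarrow> (nat \<Rightarrow> nat) \<Rightarrow> nat \<Rightarrow> (nat \<Rightarrow> real) \<Rightarrow>
   real Matrix.vec \<Rightarrow> real Matrix.vec" where
  "stein_estimator n X \<sigma> k M \<phi> y =
     finsum_vec TYPE(real) n (\<lambda>m. stein_factor n X \<sigma> k \<phi> m y \<cdot>\<^sub>v block_vec n X k m y) {1..M}"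

definition rho :: "nat \<Rightarrow> real" where
  "rho \<nu> = 1 / ln (real \<nu>)"

definition block_increment :: "nat \<Rightarrow> nat \<Rightarrow> nat" where
  "block_increment \<nu> m = nat \<lfloor>real \<nu> * rho \<nu> * (1 + rho \<nu>) ^ (m - 1)\<rfloor>"

(* For 2 <= nu <= p the set of admissible m is finite and contains 1, so GREATEST is the
   intended maximum; the remaining cases carry no meaning. *)

definition num_blocks :: "nat \<Rightarrow> nat \<Rightarrow> nat" where
  "num_blocks \<nu> p = (GREATEST m. \<nu> + (\<Sum>j=2..m. block_increment \<nu> j) \<le> p)"

primrec star_models :: "nat \<Rightarrow> nat \<Rightarrow> nat \<Rightarrow> nat" where
  "star_models \<nu> p 0 = 0"
| "star_models \<nu> p (Suc m) =
     (if Suc m = 1 then \<nu>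
      else if Suc m = num_blocks \<nu> p then p
      else star_models \<nu> p m + block_increment \<nu> (Suc m))"

definition power_penalty :: "real \<Rightarrow> (nat \<Rightarrow> nat) \<Rightarrow> nat \<Rightarrow> real" where
  "power_penalty \<tau> k m = 1 / block_size k m powr \<tau>"

end

theory Submission
  imports Defs "HOL-Real_Asymp.Real_Asymp"
begin

text \<open>In an orthonormal basis adapted to the nested column spaces, averaging over all nested models is
  coordinatewise shrinkage by a nonincreasing sequence \<open>\<gamma>\<close> with values in \<open>[0,1]\<close>, and the Stein
  estimator shrinks each block of coordinates by a common random factor.

  Within a block of size \<open>d\<close>, the Stein loss is bounded pathwise by a second-order expansion around its
  mean; fourth moments of the noise and an exponential bound for the upper tail of its squared norm give
  a risk of at most \<open>1 + O(\<phi>)\<close> times the risk of the best constant factor, up to \<open>O(\<sigma>\<^sup>2 / d)\<close>.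
  The remainders \<open>1 / d\<close> are summable because the blocks grow geometrically. Finally, replacing
  \<open>\<gamma>\<close> by its value at the start of each block does not increase the bias, and it costs a
  factor \<open>1 + o(1)\<close> in the variance, except for the first block, which contributes \<open>\<nu> \<sigma>\<^sup>2 = o(R)\<close>.\<close>

text \<open>The obstacle is the quotient 1/S in the Stein loss, where S is the squared norm of a
  data block: direct integration would need inverse moments of a noncentral chi-square variable.
  Expanding around the mean N of S leaves terms of mean zero and remainders in x, a bound for the
  fluctuation relative to N. The event S < N/2, where the expansion fails, needs no probability
  estimate: there x >= 1/2, so everything is below a multiple of N x^4. The penalty has two opposite
  duties. It must vanish for the factor 1 + O(\<phi>), whence \<tau> > 0; but noise must rarely
  exceed the threshold, so d \<phi>^2 = d^(1 - 2 \<tau>) must grow, whence \<tau> < 1/2. Blocks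
  whose signal is below \<phi> times the noise level are left to the threshold, the others to the
  expansion. The block bound holds against every constant factor g, so g can be read off the
  monotone oracle. All remainders together are of order \<sigma>^2 log(\<nu>)^2 / \<nu>, negligible
  against \<nu>.\<close>

unbundle no vec_syntax

section \<open>Nested orthonormal bases\<close>

text \<open>Induction on the number of processed columns. The span equality is kept for every prefix
  \<open>l\<close>, so that one basis serves all nested models.\<close>

lemma real_Gram_Schmidt:
  fixes x :: "nat \<Rightarrow> nat \<Rightarrow> real"
  assumes indep: "\<And>a. (\<forall>i<n. (\<Sum>j<p. a j * x j i) = 0) \<Longrightarrow> \<forall>j<p. a j = 0"
    and "k \<le> p"
  shows "\<exists>u. (\<forall>j<k. \<forall>l<k. (\<Sum>i<n. u j i * u l i) = (if j = l then 1 else 0)) \<and>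
    (\<forall>l\<le>k. \<forall>f. (\<exists>a. \<forall>i<n. f i = (\<Sum>j<l. a j * x j i)) \<longleftrightarrow> (\<exists>a. \<forall>i<n. f i = (\<Sum>j<l. a j * u j i)))"
  using \<open>k \<le> p\<close>
proof (induction k)
  case 0
  show ?case by auto
next
  case (Suc k)
  obtain u where u: "\<forall>j<k. \<forall>l<k. (\<Sum>i<n. u j i * u l i) = (if j = l then 1 else 0 :: real)"
    "\<forall>l\<le>k. \<forall>f. (\<exists>a. \<forall>i<n. f i = (\<Sum>j<l. a j * x j i)) \<longleftrightarrow> (\<exists>a. \<forall>i<n. f i = (\<Sum>j<l. a j * u j i))"
    using Suc.IH Suc_leD[OF Suc.prems] by blast
  have orth: "\<And>j l. j < k \<Longrightarrow> l < k \<Longrightarrow> (\<Sum>i<n. u j i * u l i) = (if j = l then 1 else 0)"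
    using u(1) by blast
  have sp: "\<And>l f. l \<le> k \<Longrightarrow> (\<exists>a. \<forall>i<n. f i = (\<Sum>j<l. a j * x j i)) \<longleftrightarrow> (\<exists>a. \<forall>i<n. f i = (\<Sum>j<l. a j * u j i))"
    using u(2) by blast
  define c where "c j = (\<Sum>i<n. u j i * x k i)" for j
  define e where "e i = x k i - (\<Sum>j<k. c j * u j i)" for i
  define s where "s = (\<Sum>i<n. (e i)\<^sup>2)"
  have e_orth: "(\<Sum>i<n. u l i * e i) = 0" if "l < k" for l
  proof -
    have "(\<Sum>i<n. u l i * e i) = c l - (\<Sum>i<n. \<Sum>j<k. c j * (u l i * u j i))"
      by (simp add: e_def c_def right_diff_distrib sum_subtractf sum_distrib_left mult_ac)
    also have "(\<Sum>i<n. \<Sum>j<k. c j * (u l i * u j i)) = (\<Sum>j<k. c j * (\<Sum>i<n. u l i * u j i))"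
      by (subst sum.swap) (simp add: sum_distrib_left)
    also have "\<dots> = (\<Sum>j<k. if l = j then c j else 0)"
      by (intro sum.cong) (auto simp: orth that)
    also have "\<dots> = c l" using that by simp
    finally show ?thesis by simp
  qed
  have s_pos: "s > 0"
  proof (rule ccontr)
    assume "\<not> s > 0"
    moreover have "s \<ge> 0" by (simp add: s_def sum_nonneg)
    ultimately have "s = 0" by simp
    hence e0: "e i = 0" if "i < n" for i
      using that by (auto simp: s_def sum_nonneg_eq_0_iff)
    hence "\<exists>a. \<forall>i<n. x k i = (\<Sum>j<k. a j * u j i)"
      by (intro exI[of _ c]) (auto simp: e_def)
    then obtain a where a: "\<And>i. i < n \<Longrightarrow> x k i = (\<Sum>j<k. a j * x j i)"
      using sp[of k "x k"] by auto
    \<comment> \<open>The dependence of column \<open>k\<close> on the earlier ones as a vanishing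
      combination of all \<open>p\<close> columns; its coefficient -1 at \<open>k\<close>
      contradicts independence.\<close>
    define b where "b j = (if j < k then a j else if j = k then - 1 else 0)" for j
    have "(\<Sum>j<p. b j * x j i) = 0" if "i < n" for i
    proof -
      have "(\<Sum>j<p. b j * x j i) = (\<Sum>j<Suc k. b j * x j i)"
        using Suc.prems by (intro sum.mono_neutral_right) (auto simp: b_def)
      also have "\<dots> = (\<Sum>j<k. a j * x j i) - x k i" by (simp add: b_def)
      finally show ?thesis using a[OF that] by simp
    qed
    hence "\<forall>j<p. b j = 0" by (intro indep) blast
    hence "b k = 0" using Suc.prems by simp
    thus False by (simp add: b_def)
  qed
  define v where "v = u(k := (\<lambda>i. e i / sqrt s))"
  have vj: "v j = u j" if "j < k" for j using that by (simp add: v_def)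
  have vk: "v k i = e i / sqrt s" for i by (simp add: v_def)
  have xk: "x k i = (\<Sum>j<k. c j * u j i) + sqrt s * v k i" for i
    using s_pos by (simp add: vk e_def)
  have vk': "v k i = (x k i - (\<Sum>j<k. c j * u j i)) / sqrt s" for i
    by (simp add: vk e_def)
  have orth': "(\<Sum>i<n. v j i * v l i) = (if j = l then 1 else 0)" if jl: "j < Suc k" "l < Suc k" for j l
  proof -
    consider "j < k" "l < k" | "j = k" "l < k" | "j < k" "l = k" | "j = k" "l = k" using jl by (metis less_SucE)
    thus ?thesis
    proof cases
      case 1 thus ?thesis by (simp add: vj orth)
    next
      case 2
      hence "(\<Sum>i<n. v j i * v l i) = (\<Sum>i<n. u l i * e i) / sqrt s"
        by (simp add: vj vk sum_divide_distrib mult_ac)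
      thus ?thesis using e_orth 2 by simp
    next
      case 3
      hence "(\<Sum>i<n. v j i * v l i) = (\<Sum>i<n. u j i * e i) / sqrt s"
        by (simp add: vj vk sum_divide_distrib mult_ac)
      thus ?thesis using e_orth 3 by simp
    next
      case 4
      hence "(\<Sum>i<n. v j i * v l i) = (\<Sum>i<n. (e i)\<^sup>2) / (sqrt s)\<^sup>2"
        by (simp add: vk sum_divide_distrib power2_eq_square)
      thus ?thesis using 4 s_pos by (simp add: s_def)
    qed
  qed
  have sp': "(\<exists>a. \<forall>i<n. f i = (\<Sum>j<l. a j * x j i)) \<longleftrightarrow> (\<exists>a. \<forall>i<n. f i = (\<Sum>j<l. a j * v j i))"
    if "l \<le> Suc k" for l f
  proof (cases "l \<le> k")
    case True
    hence "(\<Sum>j<l. a j * v j i) = (\<Sum>j<l. a j * u j i)" for a i by (intro sum.cong) (auto simp: vj)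
    thus ?thesis using sp[OF True] by simp
  next
    case False
    hence l: "l = Suc k" using that by simp
    have vsum: "(\<Sum>j<k. a j * v j i) = (\<Sum>j<k. a j * u j i)" for a i by (intro sum.cong) (auto simp: vj)
    show ?thesis
    proof
      assume "\<exists>a. \<forall>i<n. f i = (\<Sum>j<l. a j * x j i)"
      then obtain a where a: "\<And>i. i < n \<Longrightarrow> f i = (\<Sum>j<k. a j * x j i) + a k * x k i" by (auto simp: l)
      obtain b where b: "\<And>i. i < n \<Longrightarrow> (\<Sum>j<k. a j * x j i) = (\<Sum>j<k. b j * u j i)"
        using sp[of k "\<lambda>i. \<Sum>j<k. a j * x j i"] by auto
      \<comment> \<open>By \<open>xk\<close>, column \<open>k\<close> contributes
        \<open>a k * c j\<close> to the old coefficients and \<open>a k * sqrt s\<close> to the new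
        one.\<close>
      show "\<exists>a. \<forall>i<n. f i = (\<Sum>j<l. a j * v j i)"
        by (rule exI[of _ "\<lambda>j. if j < k then b j + a k * c j else a k * sqrt s"])
          (simp add: l vj a b xk algebra_simps sum.distrib sum_distrib_left cong: sum.cong_simp)
    next
      assume "\<exists>a. \<forall>i<n. f i = (\<Sum>j<l. a j * v j i)"
      then obtain a where a: "\<And>i. i < n \<Longrightarrow> f i = (\<Sum>j<k. a j * u j i) + a k * v k i"
        by (auto simp: l vsum)
      obtain b where b: "\<And>i. i < n \<Longrightarrow> (\<Sum>j<k. (a j - a k / sqrt s * c j) * u j i) = (\<Sum>j<k. b j * x j i)"
        using sp[of k "\<lambda>i. \<Sum>j<k. (a j - a k / sqrt s * c j) * u j i"] by auto
      have "f i = (\<Sum>j<k. b j * x j i) + a k / sqrt s * x k i" if "i < n" for i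
        using b[OF that] by (simp add: a[OF that] vk' diff_divide_distrib algebra_simps sum_subtractf sum_distrib_left
            sum_divide_distrib)
      thus "\<exists>a. \<forall>i<n. f i = (\<Sum>j<l. a j * x j i)"
        by (intro exI[of _ "\<lambda>j. if j < k then b j else a k / sqrt s"]) (simp add: l cong: sum.cong_simp)
    qed
  qed
  show ?case using orth' sp' by blast
qed

text \<open>\<open>lin_indpt\<close> concerns the set of columns and does not see repetitions.
  Distinctness comes by counting: the rank \<open>p\<close> is at most the number of distinct
  columns.\<close>

lemma full_rank_cols_independent:
  fixes X :: "real mat"
  assumes X: "X \<in> carrier_mat n p" and r: "vec_space.rank n X = p"
    and z: "\<forall>i<n. (\<Sum>j<p. a j * X $$ (i, j)) = 0"
  shows "\<forall>j<p. a j = 0"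
proof -
  interpret vec_space "TYPE(real)" n .
  have dist: "distinct (cols X)"
  proof -
    obtain S where S: "maximal S (\<lambda>T. T \<subseteq> set (cols X) \<and> lin_indpt T)"
      using maximal_exists[of "(\<lambda>T. T \<subseteq> set (cols X) \<and> lin_indpt T)" "card (set (cols X))" "{}"]
      by (meson List.finite_set card_mono empty_iff empty_subsetI finite_lin_indpt2 rev_finite_subset)
    have "card S \<le> card (set (cols X))" using S by (simp add: card_mono maximal_def)
    hence "p \<le> card (set (cols X))" using rank_card_indpt[OF X S] r by simp
    moreover have "card (set (cols X)) \<le> length (cols X)" by (rule card_length)
    moreover have "length (cols X) = p" using X by simp
    ultimately show ?thesis by (intro card_distinct) simp
  qed
  have "X *\<^sub>v Matrix.vec p a = 0\<^sub>v n"
    using X z by (intro eq_vecI) (auto simp: scalar_prod_def mult_ac atLeast0LessThan)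
  hence "Matrix.vec p a = 0\<^sub>v p"
    using lin_depI[OF X _ _ _ dist, of "Matrix.vec p a"] full_rank_lin_indpt[OF X r dist] by auto
  thus ?thesis by (metis index_vec index_zero_vec(1))
qed

lemma span_take_cols:
  fixes X :: "real mat"
  assumes X: "X \<in> carrier_mat n p" and k: "k \<le> p"
  shows "LinearCombinations.module.span class_ring (module_vec TYPE(real) n) (set (take k (cols X))) =
    {v \<in> carrier_vec n. \<exists>a. \<forall>i<n. v $ i = (\<Sum>j<k. a j * X $$ (i, j))}" (is "?L = ?R")
proof -
  interpret vec_space "TYPE(real)" n .
  define Y where "Y = mat_of_cols n (take k (cols X))"
  have c: "set (take k (cols X)) \<subseteq> carrier_vec n"
    using set_take_subset[of k "cols X"] cols_dim[of X] unfolding carrier_matD(1)[OF X] by (rule subset_trans)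
  have Y: "Y \<in> carrier_mat n k" unfolding Y_def using X k by (intro carrier_matI) auto
  have "?L = col_space Y" unfolding col_space_def Y_def using c by (simp add: cols_mat_of_cols)
  also have "\<dots> = {y\<in>carrier_vec n. \<exists>x\<in>carrier_vec k. Y *\<^sub>v x = y}"
    using col_space_eq[OF Y] Y by auto
  also have "\<dots> = ?R"
  proof (intro Collect_cong conj_cong refl)
    fix v :: "real vec" assume v: "v \<in> carrier_vec n"
    have Yx: "(Y *\<^sub>v x) $ i = (\<Sum>j<k. x $ j * X $$ (i, j))" if "x \<in> carrier_vec k" "i < n" for x i
      using that Y X k by (auto simp: scalar_prod_def Y_def mat_of_cols_def atLeast0LessThan mult_ac intro!: sum.cong)
    show "(\<exists>x\<in>carrier_vec k. Y *\<^sub>v x = v) \<longleftrightarrow> (\<exists>a. \<forall>i<n. v $ i = (\<Sum>j<k. a j * X $$ (i, j)))"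
    proof
      assume "\<exists>x\<in>carrier_vec k. Y *\<^sub>v x = v"
      then obtain x where "x \<in> carrier_vec k" "Y *\<^sub>v x = v" by auto
      thus "\<exists>a. \<forall>i<n. v $ i = (\<Sum>j<k. a j * X $$ (i, j))" using Yx by (intro exI[of _ "vec_index x"]) auto
    next
      assume "\<exists>a. \<forall>i<n. v $ i = (\<Sum>j<k. a j * X $$ (i, j))"
      then obtain a where a: "\<And>i. i < n \<Longrightarrow> v $ i = (\<Sum>j<k. a j * X $$ (i, j))" by auto
      have "Y *\<^sub>v Matrix.vec k a = v"
        using v Y by (intro eq_vecI) (auto simp: Yx a simp del: index_mult_mat_vec)
      thus "\<exists>x\<in>carrier_vec k. Y *\<^sub>v x = v" by (intro bexI[of _ "Matrix.vec k a"]) auto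
    qed
  qed
  finally show ?thesis .
qed

text \<open>\<open>orth_proj\<close> is a definite description, so existence and uniqueness are both
  due. A residual orthogonal to \<open>S\<close> means matching the \<open>k\<close> inner products
  with the basis (\<open>iff\<close>); these read off the coefficients (\<open>inner\<close>), so
  exactly one element of \<open>S\<close> qualifies.\<close>

lemma orth_proj_orthonormal:
  fixes u :: "nat \<Rightarrow> nat \<Rightarrow> real"
  assumes orth: "\<And>j l. j < k \<Longrightarrow> l < k \<Longrightarrow> (\<Sum>i<n. u j i * u l i) = (if j = l then 1 else 0)"
    and S: "S = {v \<in> carrier_vec n. \<exists>a. \<forall>i<n. v $ i = (\<Sum>j<k. a j * u j i)}"
    and y: "y \<in> carrier_vec n"
  shows "orth_proj S y = Matrix.vec n (\<lambda>i. \<Sum>j<k. (\<Sum>i'<n. u j i' * y $ i') * u j i)"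
  unfolding orth_proj_def
proof (rule the_equality)
  define c where "c j = (\<Sum>i'<n. u j i' * y $ i')" for j
  have inner: "(\<Sum>i<n. (\<Sum>j<k. a j * u j i) * u l i) = a l" if "l < k" for a l
  proof -
    have "(\<Sum>i<n. (\<Sum>j<k. a j * u j i) * u l i) = (\<Sum>j<k. a j * (\<Sum>i<n. u j i * u l i))"
      unfolding sum_distrib_right sum_distrib_left by (subst sum.swap) (simp add: mult_ac)
    also have "\<dots> = (\<Sum>j<k. if j = l then a j else 0)" by (intro sum.cong) (auto simp: orth that)
    finally show ?thesis using that by simp
  qed
  have iff: "(\<forall>w\<in>S. (y - v) \<bullet> w = 0) \<longleftrightarrow> (\<forall>l<k. (\<Sum>i<n. v $ i * u l i) = c l)"
    if v: "v \<in> carrier_vec n" for v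
  proof
    assume *: "\<forall>w\<in>S. (y - v) \<bullet> w = 0"
    show "\<forall>l<k. (\<Sum>i<n. v $ i * u l i) = c l"
    proof (intro allI impI)
      fix l assume l: "l < k"
      have "Matrix.vec n (u l) \<in> S"
        unfolding S using l by (auto intro!: exI[of _ "\<lambda>j. if j = l then 1 else 0"] simp: if_distrib[of "\<lambda>x. x * _"] cong: if_cong)
      hence "(y - v) \<bullet> Matrix.vec n (u l) = 0" using * by blast
      hence "(\<Sum>i<n. (y $ i - v $ i) * u l i) = 0"
        using v y by (simp add: scalar_prod_def atLeast0LessThan)
      thus "(\<Sum>i<n. v $ i * u l i) = c l"
        by (simp add: c_def right_diff_distrib sum_subtractf mult.commute[of _ "u l _"])
    qed
  next
    assume *: "\<forall>l<k. (\<Sum>i<n. v $ i * u l i) = c l"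
    show "\<forall>w\<in>S. (y - v) \<bullet> w = 0"
    proof
      fix w assume "w \<in> S"
      then obtain a where w: "w \<in> carrier_vec n" "\<And>i. i < n \<Longrightarrow> w $ i = (\<Sum>j<k. a j * u j i)" by (auto simp: S)
      have "(y - v) \<bullet> w = (\<Sum>i<n. \<Sum>j<k. a j * (u j i * y $ i - v $ i * u j i))"
        using v y w by (simp add: scalar_prod_def atLeast0LessThan sum_distrib_left algebra_simps sum_subtractf)
      also have "\<dots> = (\<Sum>j<k. a j * (c j - (\<Sum>i<n. v $ i * u j i)))"
        by (subst sum.swap) (simp add: sum_distrib_left c_def right_diff_distrib sum_subtractf)
      finally show "(y - v) \<bullet> w = 0" using * by simp
    qed
  qed
  define v where "v = Matrix.vec n (\<lambda>i. \<Sum>j<k. c j * u j i)"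
  have vS: "v \<in> S" by (auto simp: S v_def)
  show "Matrix.vec n (\<lambda>i. \<Sum>j<k. (\<Sum>i'<n. u j i' * y $ i') * u j i) \<in> S \<and>
    (\<forall>w\<in>S. (y - Matrix.vec n (\<lambda>i. \<Sum>j<k. (\<Sum>i'<n. u j i' * y $ i') * u j i)) \<bullet> w = 0)"
    unfolding c_def[symmetric] v_def[symmetric]
    using vS by (subst iff) (auto simp: v_def inner)
  fix v' assume v': "v' \<in> S \<and> (\<forall>w\<in>S. (y - v') \<bullet> w = 0)"
  then obtain a where a: "v' \<in> carrier_vec n" "\<And>i. i < n \<Longrightarrow> v' $ i = (\<Sum>j<k. a j * u j i)" by (auto simp: S)
  have "a l = c l" if "l < k" for l
    using iff[OF a(1)] v' that inner[OF that, of a] by (simp add: a(2))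
  thus "v' = Matrix.vec n (\<lambda>i. \<Sum>j<k. (\<Sum>i'<n. u j i' * y $ i') * u j i)"
    unfolding c_def[symmetric] using a by (intro eq_vecI) auto
qed

text \<open>The last conclusion puts the mean \<open>X *\<^sub>v \<beta>\<close> into the span of
  the basis, so the loss has no component outside these \<open>p\<close> coordinates.\<close>

lemma nested_orthonormal_basis:
  fixes X :: "real mat"
  assumes X: "X \<in> carrier_mat n p" and r: "vec_space.rank n X = p"
  obtains u :: "nat \<Rightarrow> nat \<Rightarrow> real" where
    "\<And>j l. j < p \<Longrightarrow> l < p \<Longrightarrow> (\<Sum>i<n. u j i * u l i) = (if j = l then 1 else 0)"
    "\<And>k (y :: real vec). k \<le> p \<Longrightarrow> y \<in> carrier_vec n \<Longrightarrow>
      col_proj n X k y = Matrix.vec n (\<lambda>i. \<Sum>j<k. (\<Sum>i'<n. u j i' * y $ i') * u j i)"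
    "\<And>b. b \<in> carrier_vec p \<Longrightarrow> \<exists>a. \<forall>i<n. (X *\<^sub>v b) $ i = (\<Sum>j<p. a j * u j i)"
proof -
  obtain u :: "nat \<Rightarrow> nat \<Rightarrow> real" where
    orth: "\<forall>j<p. \<forall>l<p. (\<Sum>i<n. u j i * u l i) = (if j = l then 1 else 0)"
    and sp: "\<forall>l\<le>p. \<forall>f. (\<exists>a. \<forall>i<n. f i = (\<Sum>j<l. a j * X $$ (i, j))) \<longleftrightarrow> (\<exists>a. \<forall>i<n. f i = (\<Sum>j<l. a j * u j i))"
    using real_Gram_Schmidt[where n = n and p = p and k = p and x = "\<lambda>j i. X $$ (i, j)"] full_rank_cols_independent[OF X r] by auto
  show thesis
  proof (rule that[of u])
    fix k and y :: "real vec" assume k: "k \<le> p" and y: "y \<in> carrier_vec n"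
    show "col_proj n X k y = Matrix.vec n (\<lambda>i. \<Sum>j<k. (\<Sum>i'<n. u j i' * y $ i') * u j i)"
      unfolding col_proj_def
    proof (rule orth_proj_orthonormal)
      show "LinearCombinations.module.span class_ring (module_vec TYPE(real) n) (set (take k (cols X))) =
        {v \<in> carrier_vec n. \<exists>a. \<forall>i<n. v $ i = (\<Sum>j<k. a j * u j i)}"
        unfolding span_take_cols[OF X k] using sp k by (intro Collect_cong conj_cong refl) auto
    qed (use orth k y in auto)
  next
    fix b :: "real vec" assume b: "b \<in> carrier_vec p"
    hence "\<forall>i<n. (X *\<^sub>v b) $ i = (\<Sum>j<p. b $ j * X $$ (i, j))"
      using X by (auto simp: scalar_prod_def atLeast0LessThan mult_ac)
    hence "\<exists>a. \<forall>i<n. (X *\<^sub>v b) $ i = (\<Sum>j<p. a j * X $$ (i, j))" by blast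
    thus "\<exists>a. \<forall>i<n. (X *\<^sub>v b) $ i = (\<Sum>j<p. a j * u j i)" using sp by blast
  qed (use orth in auto)
qed

section \<open>Linear and quadratic forms in Gaussian noise\<close>

text \<open>Completing the square turns the density times \<open>exp (t * x)\<close> into a constant
  times the density with mean \<open>t * \<sigma>\<^sup>2\<close>. The nonnegative integral spares a
  proof of integrability.\<close>

lemma (in prob_space) normal_mgf:
  assumes Z: "distributed M lborel Z (normal_density 0 \<sigma>)" and \<sigma>: "\<sigma> > 0"
  shows "(\<integral>\<^sup>+\<omega>. ennreal (exp (t * Z \<omega>)) \<partial>M) = ennreal (exp (t\<^sup>2 * \<sigma>\<^sup>2 / 2))"
proof -
  have "(\<integral>\<^sup>+\<omega>. ennreal (exp (t * Z \<omega>)) \<partial>M) = (\<integral>\<^sup>+x. ennreal (normal_density 0 \<sigma> x) * ennreal (exp (t * x)) \<partial>lborel)"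
    by (rule distributed_nn_integral[symmetric, OF Z]) simp
  also have "\<dots> = (\<integral>\<^sup>+x. ennreal (exp (t\<^sup>2 * \<sigma>\<^sup>2 / 2)) * ennreal (normal_density (t * \<sigma>\<^sup>2) \<sigma> x) \<partial>lborel)"
  proof (intro nn_integral_cong)
    fix x :: real
    have "- (x\<^sup>2 / (2 * \<sigma>\<^sup>2)) + t * x = t\<^sup>2 * \<sigma>\<^sup>2 / 2 + - ((x - t * \<sigma>\<^sup>2)\<^sup>2 / (2 * \<sigma>\<^sup>2))"
      using \<sigma> by (simp add: field_simps power2_eq_square)
    hence "normal_density 0 \<sigma> x * exp (t * x) = exp (t\<^sup>2 * \<sigma>\<^sup>2 / 2) * normal_density (t * \<sigma>\<^sup>2) \<sigma> x"
      by (simp add: normal_density_def exp_add[symmetric])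
    thus "ennreal (normal_density 0 \<sigma> x) * ennreal (exp (t * x)) =
      ennreal (exp (t\<^sup>2 * \<sigma>\<^sup>2 / 2)) * ennreal (normal_density (t * \<sigma>\<^sup>2) \<sigma> x)"
      by (simp add: ennreal_mult[symmetric])
  qed
  also have "\<dots> = ennreal (exp (t\<^sup>2 * \<sigma>\<^sup>2 / 2)) * (\<integral>\<^sup>+x. ennreal (normal_density (t * \<sigma>\<^sup>2) \<sigma> x) \<partial>lborel)"
    by (intro nn_integral_cmult) simp
  also have "(\<integral>\<^sup>+x. ennreal (normal_density (t * \<sigma>\<^sup>2) \<sigma> x) \<partial>lborel) = 1"
    using \<sigma> by (subst nn_integral_eq_integral) auto
  finally show ?thesis by simp
qed

lemma (in prob_space) normal_char:
  assumes Z: "distributed M lborel Z (normal_density 0 \<sigma>)" and \<sigma>: "\<sigma> > 0"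
  shows "(\<integral>\<omega>. iexp (t * Z \<omega>) \<partial>M) = complex_of_real (exp (- (t\<^sup>2 * \<sigma>\<^sup>2) / 2))"
proof -
  have "distributed M lborel (\<lambda>\<omega>. Z \<omega> / \<sigma>) std_normal_density"
    using normal_standard_normal_convert[OF \<sigma>, of Z 0] Z by simp
  hence d: "distr M borel (\<lambda>\<omega>. Z \<omega> / \<sigma>) = std_normal_distribution"
    by (simp add: distributed_def cong: distr_cong)
  have [measurable]: "Z \<in> borel_measurable M" using distributed_measurable[OF Z] by simp
  have "(\<integral>\<omega>. iexp (t * Z \<omega>) \<partial>M) = (\<integral>\<omega>. iexp (t * \<sigma> * (Z \<omega> / \<sigma>)) \<partial>M)" using \<sigma> by simp
  also have "\<dots> = char (distr M borel (\<lambda>\<omega>. Z \<omega> / \<sigma>)) (t * \<sigma>)"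
    unfolding char_def by (subst integral_distr) auto
  finally show ?thesis by (simp add: d char_std_normal_distribution power_mult_distrib)
qed

text \<open>Summands with coefficient 0 have no density, so the sum is first restricted to the set
  \<open>K\<close> of nonzero coefficients, which \<open>c\<close> makes nonempty.\<close>

lemma (in prob_space) linear_combination_normal:
  assumes ind: "indep_vars (\<lambda>_. borel) \<epsilon> I" and fin: "finite I"
    and nrm: "\<And>i. i \<in> I \<Longrightarrow> distributed M lborel (\<epsilon> i) (normal_density 0 \<sigma>)" and \<sigma>: "\<sigma> > 0"
    and c: "(\<Sum>i\<in>I. (c i)\<^sup>2) > 0"
  shows "distributed M lborel (\<lambda>\<omega>. \<Sum>i\<in>I. c i * \<epsilon> i \<omega>) (normal_density 0 (\<sigma> * sqrt (\<Sum>i\<in>I. (c i)\<^sup>2)))"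
proof -
  define K where "K = {i \<in> I. c i \<noteq> 0}"
  have K: "finite K" "K \<subseteq> I" using fin by (auto simp: K_def)
  have ne: "K \<noteq> {}"
  proof
    assume "K = {}"
    hence "(\<Sum>i\<in>I. (c i)\<^sup>2) = 0" by (intro sum.neutral) (auto simp: K_def)
    with c show False by simp
  qed
  have "distributed M lborel (\<lambda>\<omega>. \<Sum>i\<in>K. c i * \<epsilon> i \<omega>) (normal_density (\<Sum>i\<in>K. 0) (sqrt (\<Sum>i\<in>K. (\<bar>c i\<bar> * \<sigma>)\<^sup>2)))"
  proof (rule sum_indep_normal[OF K(1) ne])
    show "indep_vars (\<lambda>_. borel) (\<lambda>i \<omega>. c i * \<epsilon> i \<omega>) K"
      by (rule indep_vars_compose2[OF indep_vars_subset[OF ind K(2)], of "\<lambda>i x. c i * x"]) auto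
    fix i assume i: "i \<in> K"
    show "0 < \<bar>c i\<bar> * \<sigma>" using i \<sigma> by (simp add: K_def)
    have "distributed M lborel (\<lambda>x. 0 + c i * \<epsilon> i x) (normal_density (0 + c i * 0) (\<bar>c i\<bar> * \<sigma>))"
      using i K by (intro normal_density_affine nrm \<sigma>) (auto simp: K_def)
    thus "distributed M lborel (\<lambda>\<omega>. c i * \<epsilon> i \<omega>) (normal_density 0 (\<bar>c i\<bar> * \<sigma>))" by simp
  qed
  also have "(\<lambda>\<omega>. \<Sum>i\<in>K. c i * \<epsilon> i \<omega>) = (\<lambda>\<omega>. \<Sum>i\<in>I. c i * \<epsilon> i \<omega>)"
    using fin by (intro ext sum.mono_neutral_left) (auto simp: K_def)
  also have "(\<Sum>i\<in>K. (\<bar>c i\<bar> * \<sigma>)\<^sup>2) = (\<Sum>i\<in>I. (\<bar>c i\<bar> * \<sigma>)\<^sup>2)"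
    using fin by (intro sum.mono_neutral_left) (auto simp: K_def)
  also have "sqrt \<dots> = \<sigma> * sqrt (\<Sum>i\<in>I. (c i)\<^sup>2)"
    using \<sigma> by (simp add: power_mult_distrib sum_distrib_right[symmetric] real_sqrt_mult)
  finally show ?thesis by simp
qed

section \<open>Exponential moments of the standard normal law\<close>

lemma prob_space_std_normal: "prob_space (density lborel std_normal_density)"
  by (rule prob_space_normal_density) simp

lemma std_normal_distributed: "distributed (density lborel std_normal_density) lborel (\<lambda>x. x) (normal_density 0 1)"
proof -
  have "distr (density lborel std_normal_density) lborel (\<lambda>x. x) = density lborel std_normal_density"
    by (intro distr_id2) simp
  thus ?thesis by (auto simp: distributed_def)
qed

lemma std_normal_mgf: "(\<integral>\<^sup>+x. ennreal (exp (t * x)) \<partial>density lborel std_normal_density) = ennreal (exp (t\<^sup>2 / 2))"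
  using prob_space.normal_mgf[OF prob_space_std_normal std_normal_distributed, of t] by simp

text \<open>The standard density times \<open>exp (a * x\<^sup>2)\<close> is \<open>s\<close> times
  the centred normal density of standard deviation \<open>s = 1 / sqrt (1 - 2 * a)\<close>.\<close>

lemma std_normal_mgf_square:
  assumes "a < 1 / 2"
  shows "(\<integral>\<^sup>+x. ennreal (exp (a * x\<^sup>2)) \<partial>density lborel std_normal_density) = ennreal (1 / sqrt (1 - 2 * a))"
proof -
  define s where "s = 1 / sqrt (1 - 2 * a)"
  have s: "s > 0" "s\<^sup>2 = 1 / (1 - 2 * a)" using assms by (auto simp: s_def power_divide)
  have "(\<integral>\<^sup>+x. ennreal (exp (a * x\<^sup>2)) \<partial>density lborel std_normal_density) =
    (\<integral>\<^sup>+x. ennreal (std_normal_density x) * ennreal (exp (a * x\<^sup>2)) \<partial>lborel)"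
    by (intro nn_integral_density) auto
  also have "\<dots> = (\<integral>\<^sup>+x. ennreal s * ennreal (normal_density 0 s x) \<partial>lborel)"
  proof (intro nn_integral_cong)
    fix x :: real
    have e: "exp (- x\<^sup>2 / 2) * exp (a * x\<^sup>2) = exp (- (x\<^sup>2 / (2 * s\<^sup>2)))"
      unfolding exp_add[symmetric] using assms by (simp add: s(2) field_simps)
    have q: "sqrt (2 * pi * s\<^sup>2) = sqrt (2 * pi) * s" 
      using s(1) by (simp add: real_sqrt_mult)
    have "std_normal_density x * exp (a * x\<^sup>2) = 1 / sqrt (2 * pi) * (exp (- x\<^sup>2 / 2) * exp (a * x\<^sup>2))"
      by (simp add: std_normal_density_def)
    also have "\<dots> = s * normal_density 0 s x"
      unfolding e normal_density_def q using s(1) by simp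
    finally have "std_normal_density x * exp (a * x\<^sup>2) = s * normal_density 0 s x" .
    thus "ennreal (std_normal_density x) * ennreal (exp (a * x\<^sup>2)) = ennreal s * ennreal (normal_density 0 s x)"
      using s(1) by (simp add: ennreal_mult[symmetric])
  qed
  also have "\<dots> = ennreal s * (\<integral>\<^sup>+x. ennreal (normal_density 0 s x) \<partial>lborel)"
    by (intro nn_integral_cmult) simp
  also have "(\<integral>\<^sup>+x. ennreal (normal_density 0 s x) \<partial>lborel) = 1"
    using s by (subst nn_integral_eq_integral) auto
  finally show ?thesis by (simp add: s_def)
qed

text \<open>For x >= 0 the single term x^4 / 4! of the exponential series suffices, and evenness
  covers the other sign. This converts two-sided exponential moments into a fourth moment.\<close>

lemma power4_le_exp: "x ^ 4 \<le> 24 * (exp x + exp (- x))" for x :: real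
proof -
  have *: "x ^ 4 \<le> 24 * exp x" if "x \<ge> 0" for x :: real
  proof -
    have "(\<Sum>k\<in>{4}. x ^ k /\<^sub>R fact k) \<le> (\<Sum>k. x ^ k /\<^sub>R fact k)"
      using that by (intro sum_le_suminf summable_exp_generic) auto
    thus ?thesis by (simp add: exp_def fact_numeral field_simps)
  qed
  show ?thesis
  proof (cases "x \<ge> 0")
    case True
    thus ?thesis using *[of x] exp_gt_zero[of "- x"] by (smt (verit))
  next
    case False
    thus ?thesis using *[of "- x"] exp_gt_zero[of x] by (smt (verit) power_minus_even even_numeral)
  qed
qed

locale gaussian_noise = prob_space M for M :: "'a measure" +
  fixes \<epsilon> :: "nat \<Rightarrow> 'a \<Rightarrow> real" and n :: nat and \<sigma> :: real
  assumes indep: "indep_vars (\<lambda>_. borel) \<epsilon> {..<n}"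
    and normal: "\<And>i. i < n \<Longrightarrow> distributed M lborel (\<epsilon> i) (normal_density 0 \<sigma>)"
    and sigma_pos: "\<sigma> > 0"
begin

definition proj :: "(nat \<Rightarrow> real) \<Rightarrow> 'a \<Rightarrow> real" where
  "proj c \<omega> = (\<Sum>i<n. c i * \<epsilon> i \<omega>)"

lemma noise_measurable: "i < n \<Longrightarrow> \<epsilon> i \<in> borel_measurable M"
  using distributed_measurable[OF normal] by simp

lemma proj_measurable [measurable]: "proj c \<in> borel_measurable M"
  unfolding proj_def[abs_def] by (intro borel_measurable_sum borel_measurable_times noise_measurable) auto

text \<open>A zero direction gives the constant 0, which has no Lebesgue density; the moment
  formulas below split on this case.\<close>

lemma proj_zero:
  assumes "\<not> (\<Sum>i<n. (c i)\<^sup>2) > 0"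
  shows "proj c \<omega> = 0" "(\<Sum>i<n. (c i)\<^sup>2) = 0"
proof -
  show "(\<Sum>i<n. (c i)\<^sup>2) = 0" using assms sum_nonneg[of "{..<n}" "\<lambda>i. (c i)\<^sup>2"] by force
  hence "\<forall>i<n. c i = 0" by (simp add: sum_nonneg_eq_0_iff)
  thus "proj c \<omega> = 0" by (simp add: proj_def)
qed

lemma proj_distributed:
  assumes "(\<Sum>i<n. (c i)\<^sup>2) > 0"
  shows "distributed M lborel (proj c) (normal_density 0 (\<sigma> * sqrt (\<Sum>i<n. (c i)\<^sup>2)))"
  unfolding proj_def[abs_def] by (rule linear_combination_normal) (use assms indep normal sigma_pos in auto)

lemma proj_mgf: "(\<integral>\<^sup>+\<omega>. ennreal (exp (t * proj c \<omega>)) \<partial>M) = ennreal (exp (t\<^sup>2 * \<sigma>\<^sup>2 * (\<Sum>i<n. (c i)\<^sup>2) / 2))"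
proof (cases "(\<Sum>i<n. (c i)\<^sup>2) > 0")
  case True
  thus ?thesis using sigma_pos
    by (subst normal_mgf[OF proj_distributed[OF True]]) (auto simp: power_mult_distrib mult_ac)
next
  case False
  show ?thesis by (simp add: proj_zero[OF False] emeasure_space_1)
qed

lemma proj_char: "(\<integral>\<omega>. iexp (t * proj c \<omega>) \<partial>M) = complex_of_real (exp (- (t\<^sup>2 * \<sigma>\<^sup>2 * (\<Sum>i<n. (c i)\<^sup>2)) / 2))"
proof (cases "(\<Sum>i<n. (c i)\<^sup>2) > 0")
  case True
  thus ?thesis using sigma_pos
    by (subst normal_char[OF proj_distributed[OF True]]) (auto simp: power_mult_distrib mult_ac)
next
  case False
  show ?thesis by (simp add: proj_zero[OF False] prob_space)
qed

lemma proj_integrable_power: "integrable M (\<lambda>\<omega>. proj c \<omega> ^ k)"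
proof (cases "(\<Sum>i<n. (c i)\<^sup>2) > 0")
  case True
  have "integrable lborel (\<lambda>x. normal_density 0 (\<sigma> * sqrt (\<Sum>i<n. (c i)\<^sup>2)) x * (x - 0) ^ k)"
    by (rule integrable_normal_moment) (use True sigma_pos in auto)
  thus ?thesis by (subst distributed_integrable[symmetric, OF proj_distributed[OF True]]) auto
next
  case False
  show ?thesis by (simp add: proj_zero[OF False])
qed

lemma proj_integrable: "integrable M (proj c)"
  using proj_integrable_power[of c 1] by simp

lemma proj_expectation_even:
  assumes "k > 0"
  shows "(\<integral>\<omega>. proj c \<omega> ^ (2 * k) \<partial>M) = fact (2 * k) / (2 ^ k * fact k) * (\<sigma>\<^sup>2 * (\<Sum>i<n. (c i)\<^sup>2)) ^ k"
proof (cases "(\<Sum>i<n. (c i)\<^sup>2) > 0")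
  case True
  define s where "s = \<sigma> * sqrt (\<Sum>i<n. (c i)\<^sup>2)"
  have s: "s > 0" "s\<^sup>2 = \<sigma>\<^sup>2 * (\<Sum>i<n. (c i)\<^sup>2)" using True sigma_pos by (auto simp: s_def power_mult_distrib)
  have "(\<integral>\<omega>. proj c \<omega> ^ (2 * k) \<partial>M) = (\<integral>x. normal_density 0 s x * x ^ (2 * k) \<partial>lborel)"
    using proj_distributed[OF True] by (intro distributed_integral[symmetric]) (auto simp: s_def)
  also have "\<dots> = fact (2 * k) / ((2 / s\<^sup>2) ^ k * fact k)"
    using integral_normal_moment_even[OF s(1), of 0 k] by simp
  finally show ?thesis using s by (simp add: power_divide)
next
  case False
  show ?thesis using assms by (simp add: proj_zero[OF False] zero_power)
qed

lemma proj_expectation: "(\<integral>\<omega>. proj c \<omega> \<partial>M) = 0"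
proof (cases "(\<Sum>i<n. (c i)\<^sup>2) > 0")
  case True
  have "\<sigma> * sqrt (\<Sum>i<n. (c i)\<^sup>2) > 0" using True sigma_pos by simp
  thus ?thesis using normal_distributed_expectation[OF _ proj_distributed[OF True]] by simp
next
  case False
  show ?thesis by (simp add: proj_zero[OF False])
qed

lemma proj_sum: "(\<Sum>j\<in>J. g j * proj (u j) \<omega>) = proj (\<lambda>i. \<Sum>j\<in>J. g j * u j i) \<omega>"
  unfolding proj_def sum_distrib_left sum_distrib_right by (subst sum.swap) (simp add: mult_ac)

text \<open>Parseval's identity, applied later to auxiliary Gaussian coefficients, to the signal and
  to the estimation error.\<close>

lemma orthonormal_norm:
  assumes fin: "finite J" and orth: "\<And>j l. j \<in> J \<Longrightarrow> l \<in> J \<Longrightarrow> (\<Sum>i<n. u j i * u l i) = (if j = l then 1 else 0 :: real)"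
  shows "(\<Sum>i<n. (\<Sum>j\<in>J. g j * u j i)\<^sup>2) = (\<Sum>j\<in>J. (g j)\<^sup>2)"
proof -
  have "(\<Sum>i<n. (\<Sum>j\<in>J. g j * u j i)\<^sup>2) = (\<Sum>i<n. \<Sum>j\<in>J. \<Sum>l\<in>J. g j * g l * (u j i * u l i))"
    by (simp add: power2_eq_square sum_product mult_ac)
  also have "\<dots> = (\<Sum>j\<in>J. \<Sum>l\<in>J. g j * g l * (\<Sum>i<n. u j i * u l i))"
    by (subst sum.swap, rule sum.cong[OF refl], subst sum.swap) (simp add: sum_distrib_left)
  also have "\<dots> = (\<Sum>j\<in>J. \<Sum>l\<in>J. if j = l then (g j)\<^sup>2 else 0)"
    by (intro sum.cong) (auto simp: orth power2_eq_square)
  finally show ?thesis using fin by simp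
qed

text \<open>Writing \<open>exp (t z\<^sup>2)\<close> as the expectation of \<open>exp (sqrt (2 t) g z)\<close> over an independent standard
  normal \<open>g\<close> linearises the quadratic form, so that no rotation invariance of the noise is needed.\<close>

lemma chi_square_mgf:
  assumes fin: "finite J" and orth: "\<And>j l. j \<in> J \<Longrightarrow> l \<in> J \<Longrightarrow> (\<Sum>i<n. u j i * u l i) = (if j = l then 1 else 0)"
    and t: "0 \<le> t" "2 * t * \<sigma>\<^sup>2 < 1"
  shows "(\<integral>\<^sup>+\<omega>. ennreal (exp (t * (\<Sum>j\<in>J. (proj (u j) \<omega>)\<^sup>2))) \<partial>M) = ennreal ((1 / sqrt (1 - 2 * t * \<sigma>\<^sup>2)) ^ card J)"
proof -
  let ?N = "density lborel std_normal_density"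
  define r where "r = sqrt (2 * t)"
  have r: "r\<^sup>2 = 2 * t" using t by (simp add: r_def)
  interpret N: prob_space ?N by (rule prob_space_std_normal)
  interpret P: finite_product_prob_space "\<lambda>_. ?N" J by unfold_locales (use fin in auto)
  interpret PM: pair_sigma_finite "PiM J (\<lambda>_. ?N)" M ..
  have "ennreal (exp (t * (\<Sum>j\<in>J. (proj (u j) \<omega>)\<^sup>2))) =
      (\<integral>\<^sup>+g. ennreal (exp (r * (\<Sum>j\<in>J. g j * proj (u j) \<omega>))) \<partial>PiM J (\<lambda>_. ?N))" for \<omega>
  proof -
    have "(\<integral>\<^sup>+g. ennreal (exp (r * (\<Sum>j\<in>J. g j * proj (u j) \<omega>))) \<partial>PiM J (\<lambda>_. ?N)) =
        (\<integral>\<^sup>+g. (\<Prod>j\<in>J. ennreal (exp (r * proj (u j) \<omega> * g j))) \<partial>PiM J (\<lambda>_. ?N))"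
      using fin by (simp add: prod_ennreal exp_sum[symmetric] sum_distrib_left mult_ac)
    also have "\<dots> = (\<Prod>j\<in>J. \<integral>\<^sup>+x. ennreal (exp (r * proj (u j) \<omega> * x)) \<partial>?N)"
      by (rule P.product_nn_integral_prod[OF fin]) auto
    also have "\<dots> = (\<Prod>j\<in>J. ennreal (exp (t * (proj (u j) \<omega>)\<^sup>2)))"
      by (simp add: std_normal_mgf power_mult_distrib r)
    also have "\<dots> = ennreal (exp (t * (\<Sum>j\<in>J. (proj (u j) \<omega>)\<^sup>2)))"
      using fin by (simp add: prod_ennreal exp_sum[symmetric] sum_distrib_left)
    finally show ?thesis by simp
  qed
  hence "(\<integral>\<^sup>+\<omega>. ennreal (exp (t * (\<Sum>j\<in>J. (proj (u j) \<omega>)\<^sup>2))) \<partial>M) =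
      (\<integral>\<^sup>+\<omega>. \<integral>\<^sup>+g. ennreal (exp (r * (\<Sum>j\<in>J. g j * proj (u j) \<omega>))) \<partial>PiM J (\<lambda>_. ?N) \<partial>M)"
    by simp
  also have "\<dots> = (\<integral>\<^sup>+g. \<integral>\<^sup>+\<omega>. ennreal (exp (r * (\<Sum>j\<in>J. g j * proj (u j) \<omega>))) \<partial>M \<partial>PiM J (\<lambda>_. ?N))"
    by (rule PM.Fubini') measurable
  \<comment> \<open>For fixed \<open>g\<close> the inner integral is the moment generating function
    of one linear form in the noise. Orthonormality makes its variance \<sigma>^2 times the squared
    norm of \<open>g\<close>, so it factorises over \<open>J\<close>.\<close>
  also have "\<dots> = (\<integral>\<^sup>+g. (\<Prod>j\<in>J. ennreal (exp (t * \<sigma>\<^sup>2 * (g j)\<^sup>2))) \<partial>PiM J (\<lambda>_. ?N))"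
  proof (intro nn_integral_cong)
    fix g
    have nrm: "(\<Sum>i<n. (\<Sum>j\<in>J. g j * u j i)\<^sup>2) = (\<Sum>j\<in>J. (g j)\<^sup>2)"
      by (rule orthonormal_norm[OF fin]) (rule orth)
    show "(\<integral>\<^sup>+\<omega>. ennreal (exp (r * (\<Sum>j\<in>J. g j * proj (u j) \<omega>))) \<partial>M) = (\<Prod>j\<in>J. ennreal (exp (t * \<sigma>\<^sup>2 * (g j)\<^sup>2)))"
      unfolding proj_sum proj_mgf nrm r
      using fin by (simp add: prod_ennreal exp_sum[symmetric] sum_distrib_left[symmetric])
  qed
  also have "\<dots> = (\<Prod>j\<in>J. \<integral>\<^sup>+x. ennreal (exp (t * \<sigma>\<^sup>2 * x\<^sup>2)) \<partial>?N)"
    by (rule P.product_nn_integral_prod[OF fin]) auto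
  also have "\<dots> = ennreal ((1 / sqrt (1 - 2 * t * \<sigma>\<^sup>2)) ^ card J)"
    using t by (subst std_normal_mgf_square) (auto simp: ennreal_power mult.assoc)
  finally show ?thesis .
qed

text \<open>The linearisation of \<open>chi_square_mgf\<close> with an imaginary exponent, as a
  negative coefficient requires. The integrand has modulus 1, which settles integrability for
  Fubini.\<close>

lemma chi_square_laplace:
  assumes fin: "finite J" and orth: "\<And>j l. j \<in> J \<Longrightarrow> l \<in> J \<Longrightarrow> (\<Sum>i<n. u j i * u l i) = (if j = l then 1 else 0)"
    and t: "0 \<le> t"
  shows "(\<integral>\<omega>. exp (- t * (\<Sum>j\<in>J. (proj (u j) \<omega>)\<^sup>2)) \<partial>M) = (1 / sqrt (1 + 2 * t * \<sigma>\<^sup>2)) ^ card J"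
proof -
  let ?N = "density lborel std_normal_density"
  define r where "r = sqrt (2 * t)"
  have r: "r\<^sup>2 = 2 * t" using t by (simp add: r_def)
  interpret N: prob_space ?N by (rule prob_space_std_normal)
  interpret P: finite_product_prob_space "\<lambda>_. ?N" J by unfold_locales (use fin in auto)
  interpret PM: pair_prob_space "PiM J (\<lambda>_. ?N)" M ..
  have chr: "(\<integral>x. iexp (s * x) \<partial>?N) = complex_of_real (exp (- s\<^sup>2 / 2))" for s
    using fun_cong[OF char_std_normal_distribution, of s] by (simp add: char_def)
  have "complex_of_real (exp (- t * (\<Sum>j\<in>J. (proj (u j) \<omega>)\<^sup>2))) =
      (\<integral>g. iexp (r * (\<Sum>j\<in>J. g j * proj (u j) \<omega>)) \<partial>PiM J (\<lambda>_. ?N))" for \<omega>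
  proof -
    have "(\<integral>g. iexp (r * (\<Sum>j\<in>J. g j * proj (u j) \<omega>)) \<partial>PiM J (\<lambda>_. ?N)) =
        (\<integral>g. (\<Prod>j\<in>J. iexp (r * proj (u j) \<omega> * g j)) \<partial>PiM J (\<lambda>_. ?N))"
      using fin by (simp add: exp_sum[symmetric] sum_distrib_left mult_ac)
    also have "\<dots> = (\<Prod>j\<in>J. \<integral>x. iexp (r * proj (u j) \<omega> * x) \<partial>?N)"
      by (rule P.product_integral_prod[OF fin]) (auto intro!: N.integrable_const_bound[where B = 1])
    also have "\<dots> = (\<Prod>j\<in>J. complex_of_real (exp (- t * (proj (u j) \<omega>)\<^sup>2)))"
      by (subst chr) (simp add: power_mult_distrib r)
    also have "\<dots> = complex_of_real (exp (- t * (\<Sum>j\<in>J. (proj (u j) \<omega>)\<^sup>2)))"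
      using fin by (simp add: exp_sum[symmetric] sum_distrib_left flip: of_real_prod)
    finally show ?thesis by simp
  qed
  hence "(\<integral>\<omega>. complex_of_real (exp (- t * (\<Sum>j\<in>J. (proj (u j) \<omega>)\<^sup>2))) \<partial>M) =
      (\<integral>\<omega>. \<integral>g. iexp (r * (\<Sum>j\<in>J. g j * proj (u j) \<omega>)) \<partial>PiM J (\<lambda>_. ?N) \<partial>M)"
    by simp
  also have "\<dots> = (\<integral>g. \<integral>\<omega>. iexp (r * (\<Sum>j\<in>J. g j * proj (u j) \<omega>)) \<partial>M \<partial>PiM J (\<lambda>_. ?N))"
    by (rule PM.Fubini_integral) (auto intro!: PM.integrable_const_bound[where B = 1])
  also have "\<dots> = (\<integral>g. (\<Prod>j\<in>J. complex_of_real (exp (- (t * \<sigma>\<^sup>2) * (g j)\<^sup>2))) \<partial>PiM J (\<lambda>_. ?N))"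
  proof (intro Bochner_Integration.integral_cong refl)
    fix g
    have nrm: "(\<Sum>i<n. (\<Sum>j\<in>J. g j * u j i)\<^sup>2) = (\<Sum>j\<in>J. (g j)\<^sup>2)"
      by (rule orthonormal_norm[OF fin]) (rule orth)
    show "(\<integral>\<omega>. iexp (r * (\<Sum>j\<in>J. g j * proj (u j) \<omega>)) \<partial>M) =
        (\<Prod>j\<in>J. complex_of_real (exp (- (t * \<sigma>\<^sup>2) * (g j)\<^sup>2)))"
      unfolding proj_sum proj_char nrm r
      using fin by (simp add: exp_sum[symmetric] sum_distrib_left[symmetric] sum_negf flip: of_real_prod)
  qed
  also have "\<dots> = (\<Prod>j\<in>J. \<integral>x. complex_of_real (exp (- (t * \<sigma>\<^sup>2) * x\<^sup>2)) \<partial>?N)"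
    using t by (intro P.product_integral_prod[OF fin]) (auto intro!: N.integrable_const_bound[where B = 1])
  also have "(\<integral>x. complex_of_real (exp (- (t * \<sigma>\<^sup>2) * x\<^sup>2)) \<partial>?N) = complex_of_real (1 / sqrt (1 + 2 * t * \<sigma>\<^sup>2))"
  proof -
    have "- (t * \<sigma>\<^sup>2) < 1 / 2" using t by (smt (verit) mult_nonneg_nonneg zero_le_power2 half_gt_zero_iff)
    hence "(\<integral>x. exp (- (t * \<sigma>\<^sup>2) * x\<^sup>2) \<partial>?N) = 1 / sqrt (1 + 2 * t * \<sigma>\<^sup>2)"
      using std_normal_mgf_square[of "- (t * \<sigma>\<^sup>2)"] t
      by (subst integral_eq_nn_integral) (auto simp: mult.assoc)
    thus ?thesis by simp
  qed
  finally have "complex_of_real (\<integral>\<omega>. exp (- t * (\<Sum>j\<in>J. (proj (u j) \<omega>)\<^sup>2)) \<partial>M) =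
    complex_of_real ((1 / sqrt (1 + 2 * t * \<sigma>\<^sup>2)) ^ card J)" by simp
  thus ?thesis by (simp only: of_real_eq_iff)
qed

section \<open>Moments and tails of the noise energy \<open>chi\<close>, a scaled chi-square
  variable for orthonormal directions\<close>

definition chi :: "('b \<Rightarrow> nat \<Rightarrow> real) \<Rightarrow> 'b set \<Rightarrow> 'a \<Rightarrow> real" where
  "chi u J \<omega> = (\<Sum>j\<in>J. (proj (u j) \<omega>)\<^sup>2)"

lemma chi_measurable [measurable]: "chi u J \<in> borel_measurable M"
  unfolding chi_def[abs_def] by measurable

lemma chi_nonneg: "chi u J \<omega> \<ge> 0"
  unfolding chi_def by (simp add: sum_nonneg)

lemma chi_integrable: "integrable M (chi u J)"
  unfolding chi_def[abs_def] by (intro Bochner_Integration.integrable_sum proj_integrable_power)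

lemma chi_expectation:
  assumes "\<And>j. j \<in> J \<Longrightarrow> (\<Sum>i<n. (u j i)\<^sup>2) = 1"
  shows "(\<integral>\<omega>. chi u J \<omega> \<partial>M) = real (card J) * \<sigma>\<^sup>2"
proof -
  have "(\<integral>\<omega>. chi u J \<omega> \<partial>M) = (\<Sum>j\<in>J. \<integral>\<omega>. (proj (u j) \<omega>)\<^sup>2 \<partial>M)"
    unfolding chi_def by (intro Bochner_Integration.integral_sum proj_integrable_power)
  also have "\<dots> = (\<Sum>j\<in>J. \<sigma>\<^sup>2)"
    using proj_expectation_even[of 1] assms by (intro sum.cong) auto
  finally show ?thesis by simp
qed

text \<open>With a = 2 t \<sigma>^2, each degree of freedom needs -ln(1 - a)/2 <= a/2 + a^2, which
  holds for a <= 1/2; the term a/2 cancels against the centring.\<close>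

lemma chi_upper_mgf_bound:
  assumes fin: "finite J" and orth: "\<And>j l. j \<in> J \<Longrightarrow> l \<in> J \<Longrightarrow> (\<Sum>i<n. u j i * u l i) = (if j = l then 1 else 0)"
    and t: "0 \<le> t" "2 * t * \<sigma>\<^sup>2 \<le> 1 / 2"
  shows "(\<integral>\<^sup>+\<omega>. ennreal (exp (t * (chi u J \<omega> - real (card J) * \<sigma>\<^sup>2))) \<partial>M)
    \<le> ennreal (exp (real (card J) * (2 * t * \<sigma>\<^sup>2)\<^sup>2))"
proof -
  define a where "a = 2 * t * \<sigma>\<^sup>2"
  have a: "0 \<le> a" "a \<le> 1 / 2" using t by (auto simp: a_def)
  have "(\<integral>\<^sup>+\<omega>. ennreal (exp (t * (chi u J \<omega> - real (card J) * \<sigma>\<^sup>2))) \<partial>M) =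
    (\<integral>\<^sup>+\<omega>. ennreal (exp (- (real (card J) * (a / 2)))) * ennreal (exp (t * chi u J \<omega>)) \<partial>M)"
    by (intro nn_integral_cong) (simp add: ennreal_mult[symmetric] exp_add[symmetric] a_def algebra_simps)
  also have "\<dots> = ennreal (exp (- (real (card J) * (a / 2)))) * ennreal ((1 / sqrt (1 - a)) ^ card J)"
    using chi_square_mgf[OF fin orth t(1)] a
    by (subst nn_integral_cmult) (auto simp: chi_def a_def)
  also have "exp (- (real (card J) * (a / 2))) = exp (- (a / 2)) ^ card J"
    by (simp add: exp_of_nat_mult[symmetric])
  also have "ennreal (exp (- (a / 2)) ^ card J) * ennreal ((1 / sqrt (1 - a)) ^ card J) =
    ennreal ((exp (- (a / 2)) * (1 / sqrt (1 - a))) ^ card J)"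
    using a unfolding power_mult_distrib by (intro ennreal_mult[symmetric]) auto
  also have "\<dots> \<le> ennreal ((exp (a\<^sup>2)) ^ card J)"
  proof (intro ennreal_leI power_mono)
    have "- a - 2 * a\<^sup>2 \<le> ln (1 - a)" using ln_one_minus_pos_lower_bound[of a] a by simp
    hence "ln (1 / sqrt (1 - a)) \<le> a / 2 + a\<^sup>2" using a by (simp add: ln_div ln_sqrt)
    hence "exp (ln (1 / sqrt (1 - a))) \<le> exp (a / 2 + a\<^sup>2)" by simp
    hence "1 / sqrt (1 - a) \<le> exp (a / 2 + a\<^sup>2)" using a by (subst (asm) exp_ln) auto
    hence "exp (- (a / 2)) * (1 / sqrt (1 - a)) \<le> exp (- (a / 2)) * exp (a / 2 + a\<^sup>2)"
      by (intro mult_left_mono) auto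
    thus "exp (- (a / 2)) * (1 / sqrt (1 - a)) \<le> exp (a\<^sup>2)" by (simp add: exp_add[symmetric])
  qed (use a in auto)
  finally show ?thesis by (simp add: exp_of_nat_mult a_def)
qed

text \<open>The same cancellation for downward deviations, from ln(1 + a) >= a - a^2.\<close>

lemma chi_lower_mgf_bound:
  assumes fin: "finite J" and orth: "\<And>j l. j \<in> J \<Longrightarrow> l \<in> J \<Longrightarrow> (\<Sum>i<n. u j i * u l i) = (if j = l then 1 else 0)"
    and t: "0 \<le> t" "2 * t * \<sigma>\<^sup>2 \<le> 1 / 2"
  shows "(\<integral>\<^sup>+\<omega>. ennreal (exp (- t * (chi u J \<omega> - real (card J) * \<sigma>\<^sup>2))) \<partial>M)
    \<le> ennreal (exp (real (card J) * (2 * t * \<sigma>\<^sup>2)\<^sup>2))"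
proof -
  define a where "a = 2 * t * \<sigma>\<^sup>2"
  have a: "0 \<le> a" "a \<le> 1 / 2" using t by (auto simp: a_def)
  have "(\<integral>\<^sup>+\<omega>. ennreal (exp (- t * chi u J \<omega>)) \<partial>M) = ennreal (\<integral>\<omega>. exp (- t * chi u J \<omega>) \<partial>M)"
    using t by (intro nn_integral_eq_integral integrable_const_bound[where B = 1])
      (auto intro!: mult_nonneg_nonneg chi_nonneg)
  hence lap: "(\<integral>\<^sup>+\<omega>. ennreal (exp (- t * chi u J \<omega>)) \<partial>M) = ennreal ((1 / sqrt (1 + a)) ^ card J)"
    using chi_square_laplace[OF fin orth t(1)] by (simp add: chi_def a_def)
  have "(\<integral>\<^sup>+\<omega>. ennreal (exp (- t * (chi u J \<omega> - real (card J) * \<sigma>\<^sup>2))) \<partial>M) =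
    (\<integral>\<^sup>+\<omega>. ennreal (exp (real (card J) * (a / 2))) * ennreal (exp (- t * chi u J \<omega>)) \<partial>M)"
    by (intro nn_integral_cong) (simp add: ennreal_mult[symmetric] exp_add[symmetric] a_def algebra_simps)
  also have "\<dots> = ennreal (exp (real (card J) * (a / 2))) * ennreal ((1 / sqrt (1 + a)) ^ card J)"
    by (subst nn_integral_cmult, measurable, simp only: lap)
  also have "exp (real (card J) * (a / 2)) = exp (a / 2) ^ card J"
    by (simp add: exp_of_nat_mult[symmetric])
  also have "ennreal (exp (a / 2) ^ card J) * ennreal ((1 / sqrt (1 + a)) ^ card J) =
    ennreal ((exp (a / 2) * (1 / sqrt (1 + a))) ^ card J)"
    using a unfolding power_mult_distrib by (intro ennreal_mult[symmetric]) auto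
  also have "\<dots> \<le> ennreal ((exp (a\<^sup>2)) ^ card J)"
  proof (intro ennreal_leI power_mono)
    have "a - a\<^sup>2 \<le> ln (1 + a)" using ln_one_plus_pos_lower_bound[of a] a by simp
    moreover have "ln (1 / sqrt (1 + a)) = - (ln (1 + a) / 2)" using a by (simp add: ln_div ln_sqrt)
    ultimately have "ln (1 / sqrt (1 + a)) \<le> - (a / 2) + a\<^sup>2" using zero_le_power2[of a] by linarith
    hence "exp (ln (1 / sqrt (1 + a))) \<le> exp (- (a / 2) + a\<^sup>2)" by simp
    hence "1 / sqrt (1 + a) \<le> exp (- (a / 2) + a\<^sup>2)" using a by (subst (asm) exp_ln) auto
    hence "exp (a / 2) * (1 / sqrt (1 + a)) \<le> exp (a / 2) * exp (- (a / 2) + a\<^sup>2)"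
      by (intro mult_left_mono) auto
    thus "exp (a / 2) * (1 / sqrt (1 + a)) \<le> exp (a\<^sup>2)" by (simp add: exp_add[symmetric])
  qed (use a in auto)
  finally show ?thesis by (simp add: exp_of_nat_mult a_def)
qed

text \<open>At the scale t = 1 / (4 \<sigma>^2 sqrt d) both exponential moments are at most exp(1/4)
  <= 2, so the fourth moment of t H is at most 24 * (2 + 2) = 96. Division by t^4 gives the constant
  96 * 256 = 24576.\<close>

lemma chi_fourth_moment:
  assumes fin: "finite J" and orth: "\<And>j l. j \<in> J \<Longrightarrow> l \<in> J \<Longrightarrow> (\<Sum>i<n. u j i * u l i) = (if j = l then 1 else 0)"
    and ne: "J \<noteq> {}"
  shows "integrable M (\<lambda>\<omega>. (chi u J \<omega> - real (card J) * \<sigma>\<^sup>2) ^ 4)"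
    and "(\<integral>\<omega>. (chi u J \<omega> - real (card J) * \<sigma>\<^sup>2) ^ 4 \<partial>M) \<le> 24576 * \<sigma> ^ 4 * (real (card J) * \<sigma>\<^sup>2)\<^sup>2"
proof -
  define d where "d = real (card J)"
  have d: "d \<ge> 1" using fin ne by (simp add: d_def Suc_le_eq card_gt_0_iff)
  define t where "t = 1 / (4 * \<sigma>\<^sup>2 * sqrt d)"
  have t: "t > 0" using d sigma_pos by (simp add: t_def)
  have a: "2 * t * \<sigma>\<^sup>2 = 1 / (2 * sqrt d)" using sigma_pos d by (simp add: t_def field_simps)
  have a': "2 * t * \<sigma>\<^sup>2 \<le> 1 / 2" unfolding a using d by (simp add: field_simps)
  have da: "d * (2 * t * \<sigma>\<^sup>2)\<^sup>2 = 1 / 4" unfolding a using d by (simp add: power_divide power_mult_distrib)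
  have e2: "exp (1 / 4 :: real) \<le> 2" using exp_bound_half[of "1 / 4 :: real"] by simp
  define H where "H \<omega> = chi u J \<omega> - d * \<sigma>\<^sup>2" for \<omega>
  have [measurable]: "H \<in> borel_measurable M" unfolding H_def by measurable
  have up: "(\<integral>\<^sup>+\<omega>. ennreal (exp (t * H \<omega>)) \<partial>M) \<le> 2"
    using chi_upper_mgf_bound[OF fin orth less_imp_le[OF t] a'] e2
    unfolding d_def[symmetric] da H_def by (metis ennreal_leI ennreal_numeral order_trans)
  have lo: "(\<integral>\<^sup>+\<omega>. ennreal (exp (- t * H \<omega>)) \<partial>M) \<le> 2"
    using chi_lower_mgf_bound[OF fin orth less_imp_le[OF t] a'] e2
    unfolding d_def[symmetric] da H_def by (metis ennreal_leI ennreal_numeral order_trans)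
  have "(\<integral>\<^sup>+\<omega>. ennreal ((t * H \<omega>) ^ 4) \<partial>M) \<le>
    (\<integral>\<^sup>+\<omega>. ennreal 24 * (ennreal (exp (t * H \<omega>)) + ennreal (exp (- t * H \<omega>))) \<partial>M)"
  proof (intro nn_integral_mono)
    fix \<omega>
    have "ennreal ((t * H \<omega>) ^ 4) \<le> ennreal (24 * (exp (t * H \<omega>) + exp (- t * H \<omega>)))"
      using power4_le_exp[of "t * H \<omega>"] by (intro ennreal_leI) simp
    also have "\<dots> = ennreal 24 * (ennreal (exp (t * H \<omega>)) + ennreal (exp (- t * H \<omega>)))"
      by (subst ennreal_mult) (simp_all only: ennreal_plus exp_ge_zero add_nonneg_nonneg zero_le_numeral)
    finally show "ennreal ((t * H \<omega>) ^ 4) \<le> ennreal 24 * (ennreal (exp (t * H \<omega>)) + ennreal (exp (- t * H \<omega>)))" .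
  qed
  also have "\<dots> = ennreal 24 * ((\<integral>\<^sup>+\<omega>. ennreal (exp (t * H \<omega>)) \<partial>M) + (\<integral>\<^sup>+\<omega>. ennreal (exp (- t * H \<omega>)) \<partial>M))"
    by (subst nn_integral_cmult, measurable, subst nn_integral_add, auto)
  also have "\<dots> \<le> ennreal 24 * (2 + 2)" by (intro mult_left_mono add_mono up lo) auto
  also have "\<dots> = ennreal 96" by (simp add: ennreal_mult[symmetric] flip: ennreal_numeral ennreal_plus)
  finally have b: "(\<integral>\<^sup>+\<omega>. ennreal ((t * H \<omega>) ^ 4) \<partial>M) \<le> ennreal 96" .
  have int: "integrable M (\<lambda>\<omega>. (t * H \<omega>) ^ 4)"
    by (rule integrableI_nonneg) (use b in \<open>auto simp: less_top[symmetric] top_unique\<close>)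
  have "integrable M (\<lambda>\<omega>. (1 / t ^ 4) * (t * H \<omega>) ^ 4)" using int by (rule integrable_mult_right)
  thus "integrable M (\<lambda>\<omega>. (chi u J \<omega> - real (card J) * \<sigma>\<^sup>2) ^ 4)"
    using t by (simp add: power_mult_distrib H_def d_def)
  have "ennreal (\<integral>\<omega>. (t * H \<omega>) ^ 4 \<partial>M) \<le> ennreal 96"
    using b by (subst nn_integral_eq_integral[OF int, symmetric]) auto
  hence "(\<integral>\<omega>. (t * H \<omega>) ^ 4 \<partial>M) \<le> 96" by (subst (asm) ennreal_le_iff) auto
  hence "t ^ 4 * (\<integral>\<omega>. H \<omega> ^ 4 \<partial>M) \<le> 96" by (simp add: power_mult_distrib)
  moreover have "t ^ 4 = 1 / (256 * (\<sigma>\<^sup>2) ^ 4 * d\<^sup>2)"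
  proof -
    have "sqrt d ^ 4 = ((sqrt d)\<^sup>2)\<^sup>2" by (simp flip: power_mult)
    thus ?thesis using d by (simp add: t_def power_divide power_mult_distrib)
  qed
  moreover define K where "K = 256 * (\<sigma>\<^sup>2) ^ 4 * d\<^sup>2"
  moreover have "K > 0" using d sigma_pos by (simp add: K_def)
  ultimately have "(\<integral>\<omega>. H \<omega> ^ 4 \<partial>M) \<le> 96 * K" by (simp add: pos_divide_le_eq)
  also have "\<dots> = 24576 * (\<sigma> ^ 4 * (\<sigma>\<^sup>2)\<^sup>2) * d\<^sup>2"
    unfolding K_def by (simp flip: power_mult power_add)
  also have "\<dots> = 24576 * \<sigma> ^ 4 * (d * \<sigma>\<^sup>2)\<^sup>2" by (simp add: power_mult_distrib)
  finally show "(\<integral>\<omega>. (chi u J \<omega> - real (card J) * \<sigma>\<^sup>2) ^ 4 \<partial>M) \<le> 24576 * \<sigma> ^ 4 * (real (card J) * \<sigma>\<^sup>2)\<^sup>2"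
    by (simp add: H_def d_def)
qed

text \<open>A Chernoff argument based on x <= exp(t x) / t. The choice t = \<phi> / (8 \<sigma>^2)
  minimises the exponent -t d \<sigma>^2 \<phi> + d (2 t \<sigma>^2)^2, with value -d \<phi>^2 /
  16.\<close>

lemma chi_excess:
  assumes fin: "finite J" and orth: "\<And>j l. j \<in> J \<Longrightarrow> l \<in> J \<Longrightarrow> (\<Sum>i<n. u j i * u l i) = (if j = l then 1 else 0)"
    and phi: "0 < \<phi>" "\<phi> \<le> 1"
  shows "(\<integral>\<omega>. max 0 (chi u J \<omega> - real (card J) * \<sigma>\<^sup>2 * (1 + \<phi>)) \<partial>M)
    \<le> 8 * \<sigma>\<^sup>2 / \<phi> * exp (- (real (card J) * \<phi>\<^sup>2 / 16))"
proof -
  define d where "d = real (card J)"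
  define t where "t = \<phi> / (8 * \<sigma>\<^sup>2)"
  have t: "t > 0" using phi sigma_pos by (simp add: t_def)
  have a: "2 * t * \<sigma>\<^sup>2 = \<phi> / 4" using sigma_pos by (simp add: t_def)
  have a': "2 * t * \<sigma>\<^sup>2 \<le> 1 / 2" unfolding a using phi by simp
  have int: "integrable M (\<lambda>\<omega>. max 0 (chi u J \<omega> - d * \<sigma>\<^sup>2 * (1 + \<phi>)))"
    by (intro integrable_max Bochner_Integration.integrable_diff chi_integrable) auto
  have pw: "max 0 (chi u J \<omega> - d * \<sigma>\<^sup>2 * (1 + \<phi>)) \<le> (1 / t * exp (- (d * \<phi>\<^sup>2 / 8))) * exp (t * (chi u J \<omega> - d * \<sigma>\<^sup>2))" for \<omega>
  proof -
    define x where "x = chi u J \<omega> - d * \<sigma>\<^sup>2 * (1 + \<phi>)"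
    have "t * x \<le> exp (t * x)" using exp_ge_add_one_self[of "t * x"] by linarith
    hence "x \<le> 1 / t * exp (t * x)" using t by (simp add: field_simps)
    moreover have "t * x = - (d * \<phi>\<^sup>2 / 8) + t * (chi u J \<omega> - d * \<sigma>\<^sup>2)"
      using sigma_pos by (simp add: x_def t_def field_simps power2_eq_square)
    ultimately have "x \<le> 1 / t * exp (- (d * \<phi>\<^sup>2 / 8)) * exp (t * (chi u J \<omega> - d * \<sigma>\<^sup>2))"
      by (simp add: mult.assoc exp_add[symmetric])
    thus ?thesis using t by (simp add: x_def)
  qed
  have "ennreal (\<integral>\<omega>. max 0 (chi u J \<omega> - d * \<sigma>\<^sup>2 * (1 + \<phi>)) \<partial>M) =
    (\<integral>\<^sup>+\<omega>. ennreal (max 0 (chi u J \<omega> - d * \<sigma>\<^sup>2 * (1 + \<phi>))) \<partial>M)"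
    using int by (intro nn_integral_eq_integral[symmetric]) auto
  also have "\<dots> \<le> (\<integral>\<^sup>+\<omega>. ennreal (1 / t * exp (- (d * \<phi>\<^sup>2 / 8))) * ennreal (exp (t * (chi u J \<omega> - d * \<sigma>\<^sup>2))) \<partial>M)"
    using t pw by (intro nn_integral_mono) (subst ennreal_mult[symmetric], simp, simp, rule ennreal_leI)
  also have "\<dots> = ennreal (1 / t * exp (- (d * \<phi>\<^sup>2 / 8))) * (\<integral>\<^sup>+\<omega>. ennreal (exp (t * (chi u J \<omega> - d * \<sigma>\<^sup>2))) \<partial>M)"
    by (intro nn_integral_cmult) measurable
  also have "\<dots> \<le> ennreal (1 / t * exp (- (d * \<phi>\<^sup>2 / 8))) * ennreal (exp (d * (\<phi> / 4)\<^sup>2))"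
    using chi_upper_mgf_bound[OF fin orth less_imp_le[OF t] a']
    unfolding a d_def by (intro mult_left_mono) auto
  also have "\<dots> = ennreal (1 / t * (exp (- (d * \<phi>\<^sup>2 / 8)) * exp (d * (\<phi> / 4)\<^sup>2)))"
    using t by (simp add: ennreal_mult[symmetric])
  also have "exp (- (d * \<phi>\<^sup>2 / 8)) * exp (d * (\<phi> / 4)\<^sup>2) = exp (- (d * \<phi>\<^sup>2 / 16))"
    by (simp add: exp_add[symmetric] power_divide)
  finally have "(\<integral>\<omega>. max 0 (chi u J \<omega> - d * \<sigma>\<^sup>2 * (1 + \<phi>)) \<partial>M) \<le> 1 / t * exp (- (d * \<phi>\<^sup>2 / 16))"
    using t by (subst (asm) ennreal_le_iff) auto
  thus ?thesis by (simp add: d_def t_def)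
qed

end

section \<open>Risk of a single Stein block\<close>

text \<open>\<open>T\<close>, \<open>Q\<close>, \<open>S\<close> stand for the squared norms of
  signal, noise and data in a block, \<open>L\<close> for the threshold. Twice the inner product of
  data and signal is S + T - Q, so the left-hand side is the squared error of the shrunken block;
  for S > L it equals T + (1 - L/S) (Q - L - T). At S = 0 division by zero makes the factor 1, and Q
  = T repairs this.\<close>

lemma shrinkage_loss_le:
  fixes T Q S L :: real
  assumes T: "T \<ge> 0" and S: "S \<ge> 0" "S = 0 \<Longrightarrow> Q = T" and L: "L > 0"
  defines "\<gamma> \<equiv> max 0 (1 - L / S)"
  shows "\<gamma>\<^sup>2 * S - \<gamma> * (S + T - Q) + T \<le> T + max 0 (Q - L)"
proof (cases "S = 0")
  case True
  thus ?thesis using S(2) by (simp add: \<gamma>_def)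
next
  case False
  hence Sp: "S > 0" using S by simp
  show ?thesis
  proof (cases "S \<le> L")
    case True
    hence "\<gamma> = 0" using Sp by (simp add: \<gamma>_def)
    thus ?thesis by simp
  next
    case False
    hence g: "\<gamma> = 1 - L / S" using Sp by (simp add: \<gamma>_def)
    have e: "\<gamma>\<^sup>2 * S - \<gamma> * (S + T - Q) + T = T + (1 - L / S) * (Q - L - T)"
      unfolding g using Sp by (simp add: field_simps power2_eq_square)
    have "(1 - L / S) * (Q - L - T) \<le> (1 - L / S) * max 0 (Q - L)"
      using False Sp T by (intro mult_left_mono) auto
    also have "\<dots> \<le> 1 * max 0 (Q - L)" using Sp L by (intro mult_right_mono) auto
    finally show ?thesis unfolding e by simp
  qed
qed

text \<open>\<open>G\<close> is the inner product of signal and noise, \<open>N\<close> the mean of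
  \<open>S\<close>, and \<open>x\<close> dominates |S - N| / N. Without truncation the loss is Q - L
  (a + U) / S, where a + U = 2 (Q + G) - L has mean \<open>a\<close>. The part kept is affine in
  \<open>H\<close> and \<open>G\<close>, both of mean zero.\<close>

lemma shrinkage_loss_expansion:
  fixes T Q G lam \<phi> :: real
  assumes T: "T \<ge> 0" and Q: "Q \<ge> 0" and lam: "lam > 0" and phi: "0 \<le> \<phi>" "\<phi> \<le> 1"
  defines "S \<equiv> T + Q + 2 * G" and "L \<equiv> lam * (1 + \<phi>)" and "N \<equiv> T + lam" and "a \<equiv> lam * (1 - \<phi>)"
  defines "\<gamma> \<equiv> max 0 (1 - L / S)" and "H \<equiv> Q - lam"
  defines "x \<equiv> (2 * \<bar>H\<bar> + 2 * \<bar>G\<bar>) / N"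
  assumes S: "S \<ge> 0" "S = 0 \<Longrightarrow> Q = T"
  shows "\<gamma>\<^sup>2 * S - \<gamma> * (S + T - Q) + T \<le>
    Q - L / N * (a + (2 * H + 2 * G) - a / N * (H + 2 * G)) + 4 * lam * x\<^sup>2 + 66 * N * x ^ 4 + 6 * max 0 (Q - L)"
proof -
  define D where "D = H + 2 * G"
  define U where "U = 2 * H + 2 * G"
  define W where "W = 2 * \<bar>H\<bar> + 2 * \<bar>G\<bar>"
  have N: "N > 0" "lam \<le> N" "T \<le> N" using T lam by (auto simp: N_def)
  have a: "0 \<le> a" "a \<le> lam" using phi lam by (auto simp: a_def mult_le_cancel_left1)
  have L: "L > 0" "L \<le> 2 * lam" using phi lam by (auto simp: L_def)
  have SD: "S = N + D" by (simp add: S_def N_def D_def H_def)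
  have DW: "\<bar>D\<bar> \<le> W" "\<bar>U\<bar> \<le> W" "W \<ge> 0" by (auto simp: D_def U_def W_def)
  have x: "x = W / N" "x \<ge> 0" using N DW(3) by (auto simp: x_def W_def)
  have Wx: "W = N * x" using N x by simp
  show ?thesis
  proof (cases "S \<ge> N / 2")
    case True
    hence Sp: "S > 0" using N by linarith
    have P: "(a + U) / S \<ge> 1 / N * (a + U - a / N * D) - (x\<^sup>2 + 2 * x ^ 3)"
    proof -
      \<comment> \<open>The expansion 1/S = 1/N - D/N^2 + D^2/(N^2 S) is exact. The product U D
        becomes an error term, and in the last term only \<open>U\<close> can be negative, since
        \<open>a\<close> is not.\<close>
      have id: "(a + U) / S = 1 / N * (a + U - a / N * D) - U * D / N\<^sup>2 + (a + U) * D\<^sup>2 / (N\<^sup>2 * S)"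
      proof -
        have D: "D = S - N" by (simp add: SD)
        have "1 / S = 1 / N - D / N\<^sup>2 + D\<^sup>2 / (N\<^sup>2 * S)"
          unfolding D using N Sp by (simp add: field_simps power2_eq_square)
        hence "(a + U) / S = (a + U) * (1 / N - D / N\<^sup>2 + D\<^sup>2 / (N\<^sup>2 * S))"
          by (metis times_divide_eq_right mult.right_neutral)
        thus ?thesis by (simp add: algebra_simps add_divide_distrib diff_divide_distrib power2_eq_square)
      qed
      have "U * D / N\<^sup>2 \<le> W * W / N\<^sup>2"
        using DW N by (intro divide_right_mono order_trans[OF abs_ge_self[of "U * D"]]) (auto simp: abs_mult intro!: mult_mono)
      also have "\<dots> = x\<^sup>2" using N by (simp add: x(1) power_divide power2_eq_square)
      finally have 1: "U * D / N\<^sup>2 \<le> x\<^sup>2" .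
      have "- ((a + U) * D\<^sup>2 / (N\<^sup>2 * S)) \<le> W * D\<^sup>2 / (N\<^sup>2 * S)"
        using DW a N Sp unfolding minus_divide_left mult_minus_left[symmetric]
        by (intro divide_right_mono mult_right_mono) auto
      also have "\<dots> \<le> W * W\<^sup>2 / (N\<^sup>2 * (N / 2))"
        using DW N Sp True by (intro frac_le mult_mono power2_le_iff_abs_le[THEN iffD2]) auto
      also have "\<dots> = 2 * x ^ 3" using N by (simp add: x(1) power_divide power2_eq_square power3_eq_cube)
      finally have 2: "- ((a + U) * D\<^sup>2 / (N\<^sup>2 * S)) \<le> 2 * x ^ 3" .
      show ?thesis unfolding id using 1 2 by linarith
    qed
    \<comment> \<open>The loss that the untruncated factor 1 - L/S would have.\<close>
    define F where "F = Q - L * ((a + U) / S)"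
    have F: "F = Q - L + L * (L + T - Q) / S"
    proof -
      have "L - 2 * (Q + G) = - (a + U)" by (simp add: a_def L_def U_def H_def algebra_simps)
      moreover have "L + T - Q = S + (L - 2 * (Q + G))" by (simp add: S_def)
      ultimately have e: "L + T - Q = S - (a + U)" by simp
      show ?thesis unfolding F_def e using Sp by (simp add: right_diff_distrib diff_divide_distrib)
    qed
    have "\<gamma>\<^sup>2 * S - \<gamma> * (S + T - Q) + T \<le> F + 5 * max 0 (Q - L)"
    proof (cases "S \<le> L")
      case False
      hence g: "\<gamma> = 1 - L / S" using Sp by (simp add: \<gamma>_def)
      have "\<gamma>\<^sup>2 * S - \<gamma> * (S + T - Q) + T = F"
        unfolding g F using Sp by (simp add: field_simps power2_eq_square)
      thus ?thesis by simp
    next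
      \<comment> \<open>Truncation leaves the loss T, which can exceed F only for Q > L + T. Then
        the excess of the noise pays: L <= 2N <= 4S gives F >= -3 (Q - L).\<close>
      case SL: True
      hence g: "\<gamma> = 0" using Sp by (simp add: \<gamma>_def)
      show ?thesis
      proof (cases "Q \<le> L + T")
        case True
        have "1 \<le> L / S" using SL Sp by simp
        hence "1 * (L + T - Q) \<le> L / S * (L + T - Q)" using True by (intro mult_right_mono) auto
        hence "T \<le> F" by (simp add: F)
        moreover have "0 \<le> 5 * max 0 (Q - L)" by simp
        ultimately have "T \<le> F + 5 * max 0 (Q - L)" by linarith
        thus ?thesis by (simp add: g)
      next
        case False
        have "L / S \<le> 4"
        proof -
          have "L \<le> 4 * S" using L N True by linarith
          thus ?thesis using Sp by (simp add: field_simps)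
        qed
        hence "L / S * (Q - L - T) \<le> 4 * (Q - L)"
          using False T L Sp by (intro mult_mono) auto
        moreover have "F = Q - L - L / S * (Q - L - T)"
          by (simp add: F algebra_simps diff_divide_distrib add_divide_distrib)
        ultimately have "F \<ge> Q - L - 4 * (Q - L)" by linarith
        thus ?thesis using False T by (simp add: g max_def)
      qed
    qed
    moreover have "F \<le> Q - L / N * (a + U - a / N * D) + (4 * lam * x\<^sup>2 + 66 * N * x ^ 4)"
    proof -
      \<comment> \<open>Only second and fourth moments of \<open>x\<close> will be estimated, so the
        cubic term is split between them.\<close>
      have "2 * x ^ 3 \<le> x\<^sup>2 + x ^ 4"
        using sum_squares_bound[of x "x\<^sup>2"] by (simp add: power2_eq_square power3_eq_cube power4_eq_xxxx algebra_simps)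
      hence "L * (x\<^sup>2 + 2 * x ^ 3) \<le> (2 * lam) * (2 * x\<^sup>2 + x ^ 4)"
        using L lam x by (intro mult_mono) auto
      also have "\<dots> = 4 * lam * x\<^sup>2 + 2 * (lam * x ^ 4)" by (simp add: algebra_simps)
      also have "\<dots> \<le> 4 * lam * x\<^sup>2 + 66 * (N * x ^ 4)"
      proof -
        have "lam * x ^ 4 \<le> N * x ^ 4" "0 \<le> N * x ^ 4" using N by (auto intro: mult_right_mono)
        thus ?thesis by linarith
      qed
      also have "\<dots> = 4 * lam * x\<^sup>2 + 66 * N * x ^ 4" by simp
      finally have 1: "L * (x\<^sup>2 + 2 * x ^ 3) \<le> 4 * lam * x\<^sup>2 + 66 * N * x ^ 4" .
      have "L * (1 / N * (a + U - a / N * D) - (x\<^sup>2 + 2 * x ^ 3)) \<le> L * ((a + U) / S)"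
        using P L by (intro mult_left_mono) auto
      hence "F \<le> Q - L / N * (a + U - a / N * D) + L * (x\<^sup>2 + 2 * x ^ 3)"
        by (simp add: F_def right_diff_distrib)
      with 1 show ?thesis by linarith
    qed
    moreover have "0 \<le> max 0 (Q - L)" by simp
    moreover have "A \<le> P + B + C + 6 * m" if "A \<le> F + 5 * m" "F \<le> P + (B + C)" "0 \<le> m" for A P B C m :: real
      using that by linarith
    ultimately show ?thesis unfolding U_def D_def by blast
  next
    case False
    \<comment> \<open>S < N/2 forces |D| > N/2. With x >= 1/2 both 1 and 2x are at most 16 x^4, and
      the failure of the expansion costs at most 64 N x^4.\<close>
    hence x1: "x \<ge> 1 / 2" using SD DW N by (simp add: x field_simps)
    have x3: "x ^ 3 \<ge> 1 / 8" using power_mono[OF x1, of 3] by (simp add: power_divide)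
    hence x4: "2 * x \<le> 16 * x ^ 4" using x(2) mult_left_mono[OF x3, of x] by (simp add: power4_eq_xxxx power3_eq_cube mult_ac)
    have "a + U - a / N * D \<le> N + W + 1 * W"
    proof -
      have "a / N * \<bar>D\<bar> \<le> 1 * W" using a N DW by (intro mult_mono) auto
      moreover have "- (a / N * D) \<le> \<bar>a / N * D\<bar>" by (rule abs_ge_minus_self)
      ultimately have "- (a / N * D) \<le> W" using a N by (simp add: abs_mult)
      moreover have "U \<le> W" "a \<le> N" using DW(2) a N by auto
      ultimately show ?thesis by simp
    qed
    also have "\<dots> = N * (1 + 2 * x)" by (simp add: Wx algebra_simps)
    finally have "L / N * (a + U - a / N * D) \<le> L / N * (N * (1 + 2 * x))"
      using L N by (intro mult_left_mono) auto
    also have "\<dots> = L * (1 + 2 * x)" using N by simp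
    finally have 1: "L / N * (a + U - a / N * D) \<le> L * (1 + 2 * x)" .
    have "T + L * (1 + 2 * x) \<le> T * (1 + 2 * x) + (2 * lam) * (1 + 2 * x)"
      using T x L by (intro add_mono mult_right_mono) (auto simp: mult_le_cancel_left1)
    also have "\<dots> \<le> 2 * N * (1 + 2 * x)"
      using mult_nonneg_nonneg[OF T, of "1 + 2 * x"] x(2) by (simp add: N_def algebra_simps)
    also have "\<dots> \<le> 2 * N * (32 * x ^ 4)" using x1 x4 N by (intro mult_left_mono) auto
    also have "\<dots> \<le> 66 * N * x ^ 4" using N by simp
    finally have 2: "T + L * (1 + 2 * x) \<le> 66 * N * x ^ 4" .
    have "\<gamma>\<^sup>2 * S - \<gamma> * (S + T - Q) + T \<le> T + max 0 (Q - L)"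
      unfolding \<gamma>_def using shrinkage_loss_le[OF T S L(1)] by simp
    moreover have "0 \<le> 4 * lam * x\<^sup>2" using lam by simp
    moreover have "0 \<le> max 0 (Q - L)" by simp
    moreover have "A \<le> Q - P + B + C + 6 * m"
      if "A \<le> T + m" "0 \<le> B" "0 \<le> m" "P \<le> K" "T + K \<le> C" for A P B C K m :: real
      using that Q by linarith
    ultimately show ?thesis using 1 2 unfolding U_def D_def by blast
  qed
qed

text \<open>The left-hand side is the minimum over g, attained at T / (T + lam): the gap times T +
  lam is the square of g (T + lam) - T.\<close>

lemma oracle_shrinkage_le:
  fixes T lam g :: real
  assumes "T \<ge> 0" "lam > 0"
  shows "lam * T / (T + lam) \<le> (1 - g)\<^sup>2 * T + g\<^sup>2 * lam"
proof -
  have "((1 - g)\<^sup>2 * T + g\<^sup>2 * lam) * (T + lam) - lam * T = (g * (T + lam) - T)\<^sup>2"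
    by (simp add: power2_eq_square algebra_simps)
  hence "lam * T \<le> ((1 - g)\<^sup>2 * T + g\<^sup>2 * lam) * (T + lam)" by (smt (verit) zero_le_power2)
  thus ?thesis using assms by (simp add: pos_divide_le_eq)
qed

text \<open>The exponent is d^(1 - 2 \<tau>) / 16, a positive power of d, so the exponential beats
  the factor d^(1 + \<tau>). A convergent sequence is bounded, which makes \<open>C\<close> uniform
  in \<open>d\<close>.\<close>

lemma excess_tail_bounded:
  assumes "0 < \<tau>" "\<tau> < (1 / 2 :: real)"
  obtains C where "C \<ge> 0" "\<And>d. d \<ge> 1 \<Longrightarrow> real d powr \<tau> * exp (- (real d * (real d powr - \<tau>)\<^sup>2 / 16)) \<le> C / real d"
proof -
  define b where "b = 1 - 2 * \<tau>"
  have b: "b > 0" using assms by (simp add: b_def)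
  have "(\<lambda>d. real d powr (1 + \<tau>) * exp (- (real d powr b / 16))) \<longlonglongrightarrow> 0"
    using b assms by real_asymp
  hence "Bseq (\<lambda>d. real d powr (1 + \<tau>) * exp (- (real d powr b / 16)))"
    by (rule convergent_imp_Bseq[OF convergentI])
  then obtain C where C: "\<And>d. norm (real d powr (1 + \<tau>) * exp (- (real d powr b / 16))) \<le> C" "C > 0"
    by (auto simp: Bseq_def)
  show thesis
  proof (rule that[of C])
    fix d :: nat assume d: "d \<ge> 1"
    have "real d * (real d powr - \<tau>)\<^sup>2 = real d powr 1 * (real d powr (- (2 * \<tau>)))"
      using d by (simp add: powr_power mult.commute)
    also have "\<dots> = real d powr b" unfolding b_def by (simp only: powr_add[symmetric]) simp
    finally have "real d powr \<tau> * exp (- (real d * (real d powr - \<tau>)\<^sup>2 / 16)) * real d =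
      real d powr (1 + \<tau>) * exp (- (real d powr b / 16))"
      using d by (simp add: powr_add)
    also have "\<dots> \<le> C" using C(1)[of d] by simp
    finally show "real d powr \<tau> * exp (- (real d * (real d powr - \<tau>)\<^sup>2 / 16)) \<le> C / real d"
      using d by (simp add: field_simps)
  qed (use C in simp)
qed

context gaussian_noise begin

text \<open>The numerical constants are crude; only their independence of \<open>n\<close> and of the block matters.\<close>

lemma stein_block_risk:
  fixes \<theta> :: "'b \<Rightarrow> real" and u :: "'b \<Rightarrow> nat \<Rightarrow> real" and g :: real
  assumes fin: "finite J" and orth: "\<And>j l. j \<in> J \<Longrightarrow> l \<in> J \<Longrightarrow> (\<Sum>i<n. u j i * u l i) = (if j = l then 1 else 0)"
    and ne: "J \<noteq> {}" and phi: "0 < \<phi>" "\<phi> \<le> 1" "1 \<le> real (card J) * \<phi>\<^sup>2"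
  defines "lam \<equiv> real (card J) * \<sigma>\<^sup>2"
  defines "\<gamma> \<equiv> \<lambda>\<omega>. max 0 (1 - lam * (1 + \<phi>) / (\<Sum>j\<in>J. (\<theta> j + proj (u j) \<omega>)\<^sup>2))"
  shows "integrable M (\<lambda>\<omega>. \<Sum>j\<in>J. (\<gamma> \<omega> * (\<theta> j + proj (u j) \<omega>) - \<theta> j)\<^sup>2)" (is ?int)
    and "(\<integral>\<omega>. (\<Sum>j\<in>J. (\<gamma> \<omega> * (\<theta> j + proj (u j) \<omega>) - \<theta> j)\<^sup>2) \<partial>M) \<le>
      (1 + 10000000 * \<phi>) * (\<Sum>j\<in>J. (1 - g)\<^sup>2 * (\<theta> j)\<^sup>2 + g\<^sup>2 * \<sigma>\<^sup>2) + 300000000 * \<sigma>\<^sup>2 / real (card J)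
      + 48 * \<sigma>\<^sup>2 / \<phi> * exp (- (real (card J) * \<phi>\<^sup>2 / 16))" (is ?bound)
proof -
  define d where "d = real (card J)"
  define T where "T = (\<Sum>j\<in>J. (\<theta> j)\<^sup>2)"
  define Q where "Q = chi u J"
  define G where "G = proj (\<lambda>i. \<Sum>j\<in>J. \<theta> j * u j i)"
  define S where "S \<omega> = T + Q \<omega> + 2 * G \<omega>" for \<omega>
  define loss where "loss \<omega> = (\<Sum>j\<in>J. (\<gamma> \<omega> * (\<theta> j + proj (u j) \<omega>) - \<theta> j)\<^sup>2)" for \<omega>
  define E where "E = (\<integral>\<omega>. max 0 (Q \<omega> - lam * (1 + \<phi>)) \<partial>M)"
  have d: "d \<ge> 1" using fin ne by (simp add: d_def Suc_le_eq card_gt_0_iff)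
  have lam: "lam > 0" "lam = d * \<sigma>\<^sup>2" using d sigma_pos by (auto simp: lam_def d_def[symmetric])
  have T: "T \<ge> 0" by (simp add: T_def sum_nonneg)
  have Gsum: "G \<omega> = (\<Sum>j\<in>J. \<theta> j * proj (u j) \<omega>)" for \<omega>
    by (simp add: G_def proj_sum)
  have S: "S \<omega> = (\<Sum>j\<in>J. (\<theta> j + proj (u j) \<omega>)\<^sup>2)" for \<omega>
    by (simp add: S_def T_def Q_def chi_def Gsum power2_sum sum.distrib sum_distrib_left mult_ac)
  have Sn: "S \<omega> \<ge> 0" for \<omega> unfolding S by (simp add: sum_nonneg)
  have S0: "Q \<omega> = T" if "S \<omega> = 0" for \<omega>
  proof -
    have "\<forall>j\<in>J. \<theta> j + proj (u j) \<omega> = 0"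
      using that fin unfolding S by (simp add: sum_nonneg_eq_0_iff)
    hence "\<forall>j\<in>J. proj (u j) \<omega> = - \<theta> j" by (simp add: eq_neg_iff_add_eq_0 add.commute)
    thus ?thesis by (simp add: Q_def chi_def T_def)
  qed
  have Qn: "Q \<omega> \<ge> 0" for \<omega> by (simp add: Q_def chi_nonneg)
  have \<gamma>: "\<gamma> \<omega> = max 0 (1 - lam * (1 + \<phi>) / S \<omega>)" for \<omega> by (simp add: \<gamma>_def S)
  have loss: "loss \<omega> = (\<gamma> \<omega>)\<^sup>2 * S \<omega> - \<gamma> \<omega> * (S \<omega> + T - Q \<omega>) + T" for \<omega>
  proof -
    have "loss \<omega> = (\<Sum>j\<in>J. (\<gamma> \<omega>)\<^sup>2 * (\<theta> j + proj (u j) \<omega>)\<^sup>2 - \<gamma> \<omega> * (2 * ((\<theta> j)\<^sup>2 + \<theta> j * proj (u j) \<omega>)) + (\<theta> j)\<^sup>2)"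
      unfolding loss_def by (intro sum.cong refl) (simp add: power2_eq_square algebra_simps)
    also have "\<dots> = (\<gamma> \<omega>)\<^sup>2 * S \<omega> - \<gamma> \<omega> * (2 * (T + G \<omega>)) + T"
    proof -
      have "(\<Sum>j\<in>J. \<gamma> \<omega> * (2 * ((\<theta> j)\<^sup>2 + \<theta> j * proj (u j) \<omega>))) = \<gamma> \<omega> * (2 * (T + G \<omega>))"
        unfolding T_def Gsum sum.distrib[symmetric] sum_distrib_left ..
      thus ?thesis by (simp add: sum.distrib sum_subtractf S T_def sum_distrib_left)
    qed
    finally show ?thesis by (simp add: S_def)
  qed
  have [measurable]: "Q \<in> borel_measurable M" "G \<in> borel_measurable M" by (auto simp: Q_def G_def)
  have Sm [measurable]: "S \<in> borel_measurable M" unfolding S_def[abs_def] by measurable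
  have gm [measurable]: "\<gamma> \<in> borel_measurable M" unfolding \<gamma>[abs_def] by measurable
  have lm [measurable]: "loss \<in> borel_measurable M" unfolding loss_def[abs_def] by measurable
  have intQ: "integrable M Q" unfolding Q_def by (rule chi_integrable)
  have intG: "integrable M G" unfolding G_def by (rule proj_integrable)
  have intE: "integrable M (\<lambda>\<omega>. max 0 (Q \<omega> - lam * (1 + \<phi>)))"
    by (intro integrable_max Bochner_Integration.integrable_diff intQ) auto
  have loss_nonneg: "loss \<omega> \<ge> 0" for \<omega> by (simp add: loss_def sum_nonneg)
  have loss1: "loss \<omega> \<le> T + max 0 (Q \<omega> - lam * (1 + \<phi>))" for \<omega>
    unfolding loss \<gamma> using lam phi by (intro shrinkage_loss_le T Sn S0) auto
  have int_loss: "integrable M loss"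
  proof (rule Bochner_Integration.integrable_bound)
    show "integrable M (\<lambda>\<omega>. T + max 0 (Q \<omega> - lam * (1 + \<phi>)))" using intE by simp
    show "AE \<omega> in M. norm (loss \<omega>) \<le> norm (T + max 0 (Q \<omega> - lam * (1 + \<phi>)))"
      using loss1 loss_nonneg T by (intro AE_I2) (smt (verit) real_norm_def)
  qed measurable
  thus ?int unfolding loss_def .
  have E: "E \<le> 8 * \<sigma>\<^sup>2 / \<phi> * exp (- (d * \<phi>\<^sup>2 / 16))" "E \<ge> 0"
    using chi_excess[OF fin orth phi(1,2)] by (auto simp: E_def Q_def d_def lam_def)
  \<comment> \<open>The least risk of a constant factor on this block; \<open>g\<close> enters only
    through the comparison with \<open>r\<close>.\<close>
  define r where "r = lam * T / (T + lam)"
  have r: "0 \<le> r" "r \<le> (1 - g)\<^sup>2 * T + g\<^sup>2 * lam"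
    using oracle_shrinkage_le[OF T lam(1), of g] T lam by (auto simp: r_def)
  have rhs: "(\<Sum>j\<in>J. (1 - g)\<^sup>2 * (\<theta> j)\<^sup>2 + g\<^sup>2 * \<sigma>\<^sup>2) = (1 - g)\<^sup>2 * T + g\<^sup>2 * lam"
    by (simp add: T_def lam_def sum.distrib sum_distrib_left)
  have main: "(\<integral>\<omega>. loss \<omega> \<partial>M) \<le> (1 + 10000000 * \<phi>) * r + 300000000 * \<sigma>\<^sup>2 / d + 6 * E"
  \<comment> \<open>For a weak signal the crude bound T plus excess suffices, since T <= (1 +
    \<phi>) r. Otherwise the signal is strong enough to keep the expansion errors at order \<phi> r
    + \<sigma>^2 / d.\<close>
  proof (cases "T \<le> lam * \<phi>")
    case True
    have "(\<integral>\<omega>. loss \<omega> \<partial>M) \<le> (\<integral>\<omega>. T + max 0 (Q \<omega> - lam * (1 + \<phi>)) \<partial>M)"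
      using intE by (intro integral_mono int_loss loss1) auto
    also have "\<dots> = T + E" using intE by (simp add: E_def prob_space)
    also have "T \<le> (1 + \<phi>) * r"
    proof -
      have "T * (T + lam) \<le> (1 + \<phi>) * (lam * T)"
        using mult_right_mono[OF True T] by (simp add: algebra_simps)
      thus ?thesis using T lam by (simp add: r_def pos_le_divide_eq)
    qed
    also have "\<dots> \<le> (1 + 10000000 * \<phi>) * r" using r phi by (intro mult_right_mono) auto
    finally have "(\<integral>\<omega>. loss \<omega> \<partial>M) \<le> (1 + 10000000 * \<phi>) * r + E" by simp
    moreover have "300000000 * \<sigma>\<^sup>2 / d \<ge> 0" using d by simp
    ultimately show ?thesis using E(2) by linarith
  next
    case False
    define N where "N = T + lam"
    define a where "a = lam * (1 - \<phi>)"
    define x where "x \<omega> = (2 * \<bar>Q \<omega> - lam\<bar> + 2 * \<bar>G \<omega>\<bar>) / N" for \<omega>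
    \<comment> \<open>The order of the mean of x^2: the variances of \<open>Q\<close> and
      \<open>G\<close> are of order \<sigma>^2 lam and \<sigma>^2 T, together \<sigma>^2 N, and
      \<open>x\<close> carries the divisor N.\<close>
    define s where "s = \<sigma>\<^sup>2 / N"
    have N: "N > 0" "lam \<le> N" "T \<le> N" using T lam by (auto simp: N_def)
    have s: "s > 0" using N sigma_pos by (simp add: s_def)
    have [measurable]: "x \<in> borel_measurable M" unfolding x_def[abs_def] by measurable
    have H4: "integrable M (\<lambda>\<omega>. (Q \<omega> - lam) ^ 4)" "(\<integral>\<omega>. (Q \<omega> - lam) ^ 4 \<partial>M) \<le> 24576 * \<sigma> ^ 4 * lam\<^sup>2"
      using chi_fourth_moment[OF fin orth ne] by (simp_all add: Q_def lam_def)
    have G4: "integrable M (\<lambda>\<omega>. G \<omega> ^ 4)" unfolding G_def by (rule proj_integrable_power)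
    have EG4: "(\<integral>\<omega>. G \<omega> ^ 4 \<partial>M) = 3 * \<sigma> ^ 4 * T\<^sup>2"
    proof -
      have nrm: "(\<Sum>i<n. (\<Sum>j\<in>J. \<theta> j * u j i)\<^sup>2) = T"
        unfolding T_def by (rule orthonormal_norm[OF fin]) (rule orth)
      have "(\<integral>\<omega>. G \<omega> ^ (2 * 2) \<partial>M) = fact (2 * 2) / (2 ^ 2 * fact 2) * (\<sigma>\<^sup>2 * T) ^ 2"
        unfolding G_def by (subst proj_expectation_even) (simp_all add: nrm)
      thus ?thesis by (simp add: fact_numeral power_mult_distrib flip: power_mult)
    qed
    have x4: "x \<omega> ^ 4 \<le> 128 / N ^ 4 * ((Q \<omega> - lam) ^ 4 + G \<omega> ^ 4)" for \<omega>
    proof -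
      have pw: "(p + q) ^ 4 \<le> 8 * (p ^ 4 + q ^ 4)" for p q :: real
      proof -
        have "(p + q)\<^sup>2 \<le> 2 * (p\<^sup>2 + q\<^sup>2)" using sum_squares_bound[of p q] by (simp add: power2_sum)
        hence "((p + q)\<^sup>2)\<^sup>2 \<le> (2 * (p\<^sup>2 + q\<^sup>2))\<^sup>2" by (intro power_mono) auto
        also have "\<dots> \<le> 8 * ((p\<^sup>2)\<^sup>2 + (q\<^sup>2)\<^sup>2)" using sum_squares_bound[of "p\<^sup>2" "q\<^sup>2"] by (simp add: power2_sum power_mult_distrib)
        finally show ?thesis by (simp flip: power_mult)
      qed
      have "x \<omega> ^ 4 = (2 * \<bar>Q \<omega> - lam\<bar> + 2 * \<bar>G \<omega>\<bar>) ^ 4 / N ^ 4" by (simp add: x_def power_divide)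
      also have "\<dots> \<le> 8 * ((2 * \<bar>Q \<omega> - lam\<bar>) ^ 4 + (2 * \<bar>G \<omega>\<bar>) ^ 4) / N ^ 4"
        using N by (intro divide_right_mono pw) auto
      finally show ?thesis by (simp add: power_mult_distrib power_even_abs algebra_simps add_divide_distrib)
    qed
    have int_x4: "integrable M (\<lambda>\<omega>. x \<omega> ^ 4)"
    proof (rule Bochner_Integration.integrable_bound)
      show "integrable M (\<lambda>\<omega>. 128 / N ^ 4 * ((Q \<omega> - lam) ^ 4 + G \<omega> ^ 4))" using H4(1) G4 by simp
      show "AE \<omega> in M. norm (x \<omega> ^ 4) \<le> norm (128 / N ^ 4 * ((Q \<omega> - lam) ^ 4 + G \<omega> ^ 4))"
        using x4 by (intro AE_I2) (smt (verit) real_norm_def zero_le_even_power even_numeral)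
    qed measurable
    \<comment> \<open>3145728 = 128 * 24576: the factor of \<open>x4\<close> times the constant of
      the fourth moment.\<close>
    have Ex4: "(\<integral>\<omega>. x \<omega> ^ 4 \<partial>M) \<le> 3145728 * s\<^sup>2"
    proof -
      have "(\<integral>\<omega>. x \<omega> ^ 4 \<partial>M) \<le> (\<integral>\<omega>. 128 / N ^ 4 * ((Q \<omega> - lam) ^ 4 + G \<omega> ^ 4) \<partial>M)"
        using H4(1) G4 by (intro integral_mono int_x4 x4) auto
      also have "\<dots> = 128 / N ^ 4 * ((\<integral>\<omega>. (Q \<omega> - lam) ^ 4 \<partial>M) + (\<integral>\<omega>. G \<omega> ^ 4 \<partial>M))"
        using H4(1) G4 by simp
      also have "\<dots> \<le> 128 / N ^ 4 * (24576 * \<sigma> ^ 4 * N\<^sup>2)"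
      proof (intro mult_left_mono)
        have "lam\<^sup>2 + T\<^sup>2 \<le> N\<^sup>2" using T lam by (simp add: N_def power2_sum)
        hence "\<sigma> ^ 4 * (lam\<^sup>2 + T\<^sup>2) \<le> \<sigma> ^ 4 * N\<^sup>2" by (intro mult_left_mono) auto
        moreover have "\<sigma> ^ 4 * T\<^sup>2 \<ge> 0" by simp
        ultimately show "(\<integral>\<omega>. (Q \<omega> - lam) ^ 4 \<partial>M) + (\<integral>\<omega>. G \<omega> ^ 4 \<partial>M) \<le> 24576 * \<sigma> ^ 4 * N\<^sup>2"
          using H4(2) unfolding EG4 distrib_left by linarith
      qed (use N in auto)
      also have "\<dots> = 3145728 * s\<^sup>2"
        using N by (simp add: s_def power_divide power2_eq_square power4_eq_xxxx)
      finally show ?thesis .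
    qed
    \<comment> \<open>The weight \<open>s\<close> balances the two terms, so the fourth moment
      yields a second moment of order \<open>s\<close>.\<close>
    have x2: "(x \<omega>)\<^sup>2 \<le> s / 2 + (1 / (2 * s)) * x \<omega> ^ 4" for \<omega>
    proof -
      have "2 * s * (x \<omega>)\<^sup>2 \<le> s\<^sup>2 + ((x \<omega>)\<^sup>2)\<^sup>2" by (rule sum_squares_bound)
      also have "((x \<omega>)\<^sup>2)\<^sup>2 = x \<omega> ^ 4" by (simp flip: power_mult)
      finally show ?thesis using s by (simp add: field_simps power2_eq_square)
    qed
    define P where "P \<omega> = Q \<omega> - lam * (1 + \<phi>) / N * (a + (2 * (Q \<omega> - lam) + 2 * G \<omega>) - a / N * ((Q \<omega> - lam) + 2 * G \<omega>))" for \<omega>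
    have loss2: "loss \<omega> \<le> P \<omega> + 4 * lam * (s / 2 + (1 / (2 * s)) * x \<omega> ^ 4) + 66 * N * x \<omega> ^ 4 + 6 * max 0 (Q \<omega> - lam * (1 + \<phi>))" for \<omega>
    proof -
      have "loss \<omega> \<le> P \<omega> + 4 * lam * (x \<omega>)\<^sup>2 + 66 * N * x \<omega> ^ 4 + 6 * max 0 (Q \<omega> - lam * (1 + \<phi>))"
        using shrinkage_loss_expansion[OF T Qn[of \<omega>] lam(1) less_imp_le[OF phi(1)] phi(2), of "G \<omega>"] Sn[of \<omega>] S0[of \<omega>]
        unfolding loss \<gamma> P_def x_def N_def a_def S_def by blast
      moreover have "4 * lam * (x \<omega>)\<^sup>2 \<le> 4 * lam * (s / 2 + (1 / (2 * s)) * x \<omega> ^ 4)"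
        using x2[of \<omega>] lam by (intro mult_left_mono) auto
      ultimately show ?thesis by linarith
    qed
    have intP: "integrable M P" unfolding P_def[abs_def]
      by (intro Bochner_Integration.integrable_diff Bochner_Integration.integrable_add integrable_mult_right intQ intG) auto
    have EQ: "(\<integral>\<omega>. Q \<omega> \<partial>M) = lam"
      unfolding Q_def lam_def using orth by (intro chi_expectation) (simp add: power2_eq_square)
    have EG: "(\<integral>\<omega>. G \<omega> \<partial>M) = 0" unfolding G_def by (rule proj_expectation)
    have EP: "(\<integral>\<omega>. P \<omega> \<partial>M) = lam - lam * (1 + \<phi>) / N * a"
      unfolding P_def using intQ intG by (simp add: EQ EG prob_space)
    have "(\<integral>\<omega>. loss \<omega> \<partial>M) \<le> (\<integral>\<omega>. P \<omega> + 4 * lam * (s / 2 + (1 / (2 * s)) * x \<omega> ^ 4) + 66 * N * x \<omega> ^ 4 + 6 * max 0 (Q \<omega> - lam * (1 + \<phi>)) \<partial>M)"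
      using intP intE int_x4 by (intro integral_mono int_loss loss2) auto
    also have "\<dots> = (\<integral>\<omega>. P \<omega> \<partial>M) + 4 * lam * (s / 2 + (1 / (2 * s)) * (\<integral>\<omega>. x \<omega> ^ 4 \<partial>M)) + 66 * N * (\<integral>\<omega>. x \<omega> ^ 4 \<partial>M) + 6 * E"
      using intP intE int_x4 by (simp add: E_def prob_space)
    also have "\<dots> \<le> (lam - lam * (1 + \<phi>) / N * a) + 4 * lam * (s / 2 + (1 / (2 * s)) * (3145728 * s\<^sup>2)) + 66 * N * (3145728 * s\<^sup>2) + 6 * E"
      unfolding EP using Ex4 lam s N by (intro add_mono mult_left_mono order_refl) auto
    also have "4 * lam * (s / 2 + (1 / (2 * s)) * (3145728 * s\<^sup>2)) = 6291458 * (lam * s)"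
      using s by (simp add: power2_eq_square field_simps)
    \<comment> \<open>The left-hand side is lam (T + lam \<phi>^2) / N, and its penalty part is at
      most \<phi> r because lam \<phi> < T in this case.\<close>
    also have "lam - lam * (1 + \<phi>) / N * a \<le> (1 + \<phi>) * r"
    proof -
      have "lam\<^sup>2 * \<phi>\<^sup>2 \<le> \<phi> * (lam * T)"
      proof -
        have "(lam * \<phi>) * (lam * \<phi>) \<le> (lam * \<phi>) * T" using False lam phi by (intro mult_left_mono) auto
        thus ?thesis by (simp add: power2_eq_square mult_ac)
      qed
      hence "(lam * N - lam * (1 + \<phi>) * a) / N \<le> (1 + \<phi>) * (lam * T) / N"
        using N by (intro divide_right_mono) (simp_all add: N_def a_def power2_eq_square algebra_simps)
      moreover have "lam - lam * (1 + \<phi>) / N * a = (lam * N - lam * (1 + \<phi>) * a) / N"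
        using N by (simp add: diff_divide_distrib)
      ultimately show ?thesis by (simp add: r_def N_def)
    qed
    \<comment> \<open>Here d \<phi>^2 >= 1 enters: it gives \<sigma>^2 <= \<phi> (lam \<phi>) <=
      \<phi> T.\<close>
    also have "lam * s \<le> \<phi> * r"
    proof -
      have "\<sigma>\<^sup>2 * 1 \<le> \<sigma>\<^sup>2 * (d * \<phi>\<^sup>2)" using phi(3) by (intro mult_left_mono) (auto simp: d_def)
      also have "\<dots> = \<phi> * (lam * \<phi>)" by (simp add: lam(2) power2_eq_square)
      also have "\<dots> \<le> \<phi> * T" using False phi by (intro mult_left_mono) auto
      finally have "lam * \<sigma>\<^sup>2 / N \<le> lam * (\<phi> * T) / N" using lam N by (intro divide_right_mono mult_left_mono) auto
      thus ?thesis by (simp add: s_def r_def N_def mult_ac)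
    qed
    also have "66 * N * (3145728 * s\<^sup>2) \<le> 207618048 * (\<sigma>\<^sup>2 / d)"
    proof -
      have "N * s\<^sup>2 = \<sigma>\<^sup>2 * (\<sigma>\<^sup>2 / N)" using N by (simp add: s_def power2_eq_square)
      also have "\<dots> \<le> \<sigma>\<^sup>2 * (\<sigma>\<^sup>2 / lam)" using N lam by (intro mult_left_mono divide_left_mono) auto
      also have "\<dots> = \<sigma>\<^sup>2 / d" using sigma_pos d by (simp add: lam(2))
      finally show ?thesis by simp
    qed
    finally have "(\<integral>\<omega>. loss \<omega> \<partial>M) \<le> (1 + \<phi>) * r + 6291458 * (\<phi> * r) + 207618048 * (\<sigma>\<^sup>2 / d) + 6 * E" by simp
    moreover have "(1 + \<phi>) * r + 6291458 * (\<phi> * r) \<le> (1 + 10000000 * \<phi>) * r"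
      using mult_nonneg_nonneg[OF less_imp_le[OF phi(1)] r(1)] by (simp add: algebra_simps)
    moreover have "207618048 * (\<sigma>\<^sup>2 / d) \<le> 300000000 * \<sigma>\<^sup>2 / d" using d by (simp add: field_simps)
    ultimately show ?thesis by linarith
  qed
  have "(1 + 10000000 * \<phi>) * r \<le> (1 + 10000000 * \<phi>) * ((1 - g)\<^sup>2 * T + g\<^sup>2 * lam)"
    using r phi by (intro mult_left_mono) auto
  with main E(1) show ?bound unfolding rhs loss_def d_def by simp
qed

end

section \<open>The weakly geometric block system\<close>

lemma sum_blocks:
  fixes k :: "nat \<Rightarrow> nat" and f :: "nat \<Rightarrow> 'a :: comm_monoid_add"
  assumes "k 0 = 0" and "\<And>m. m < M \<Longrightarrow> k m \<le> k (Suc m)"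
  shows "(\<Sum>m=1..M. \<Sum>j=k (m - 1)..<k m. f j) = (\<Sum>j<k M. f j)"
  using assms(2)
proof (induction M)
  case 0
  show ?case using assms(1) by simp
next
  case (Suc M)
  have "(\<Sum>m=1..Suc M. \<Sum>j=k (m - 1)..<k m. f j) = (\<Sum>j<k M. f j) + (\<Sum>j=k M..<k (Suc M). f j)"
    using Suc by simp
  also have "\<dots> = (\<Sum>j<k (Suc M). f j)"
    using Suc.prems[of M] by (simp add: lessThan_atLeast0 sum.atLeastLessThan_concat)
  finally show ?case .
qed

lemma block_mono_le:
  fixes k :: "nat \<Rightarrow> nat"
  assumes "\<And>m. m < M \<Longrightarrow> k m \<le> k (Suc m)" and "i \<le> j" "j \<le> M"
  shows "k i \<le> k j"
  using assms(2,3)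
proof (induction j)
  case (Suc j)
  thus ?case using assms(1)[of j] by (cases "i = Suc j") auto
qed simp

text \<open>The last block is treated separately: by the definition of \<open>M\<close> it can be twice as long as its
  predecessor, but it is still short relative to all preceding blocks together.\<close>

lemma blockwise_variance_le:
  fixes k :: "nat \<Rightarrow> nat" and \<gamma> :: "nat \<Rightarrow> real"
  assumes k0: "k 0 = 0" and kmono: "\<And>m. m < M \<Longrightarrow> k m \<le> k (Suc m)" and M: "M \<ge> 2"
    and eta: "\<eta> \<ge> 0" "\<eta>' \<ge> 0"
    and ratio: "\<And>m. 2 \<le> m \<Longrightarrow> m < M \<Longrightarrow> real (k m - k (m - 1)) \<le> (1 + \<eta>) * real (k (m - 1) - k (m - 2))"
    and last: "real (k M - k (M - 1)) \<le> \<eta>' * real (k (M - 1))"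
    and \<gamma>: "\<And>i j. i \<le> j \<Longrightarrow> \<gamma> j \<le> \<gamma> i" "\<And>j. 0 \<le> \<gamma> j" "\<And>j. \<gamma> j \<le> 1"
  shows "(\<Sum>m=1..M. real (k m - k (m - 1)) * (\<gamma> (k (m - 1)))\<^sup>2) \<le> real (k 1) + (1 + \<eta> + \<eta>') * (\<Sum>j<k M. (\<gamma> j)\<^sup>2)"
proof -
  define v where "v m = real (k m - k (m - 1)) * (\<gamma> (k (m - 1)))\<^sup>2" for m
  define s where "s m = (\<Sum>j=k (m - 1)..<k m. (\<gamma> j)\<^sup>2)" for m
  have s_lower: "real (k m - k (m - 1)) * (\<gamma> (k m))\<^sup>2 \<le> s m" for m
  proof -
    have "(\<Sum>j=k (m - 1)..<k m. (\<gamma> (k m))\<^sup>2) \<le> s m"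
      unfolding s_def using \<gamma> by (intro sum_mono power_mono) auto
    thus ?thesis by simp
  qed
  have s_nonneg: "s m \<ge> 0" for m by (simp add: s_def sum_nonneg)
  \<comment> \<open>Block \<open>m\<close> is charged to its predecessor, where \<gamma> is nowhere
    smaller than at the start of block \<open>m\<close>; the price is the ratio of lengths.\<close>
  have mid: "v m \<le> (1 + \<eta>) * s (m - 1)" if "2 \<le> m" "m < M" for m
  proof -
    have "v m \<le> (1 + \<eta>) * real (k (m - 1) - k (m - 2)) * (\<gamma> (k (m - 1)))\<^sup>2"
      unfolding v_def by (intro mult_right_mono ratio that) auto
    also have "\<dots> = (1 + \<eta>) * (real (k (m - 1) - k (m - 1 - 1)) * (\<gamma> (k (m - 1)))\<^sup>2)"
      using that by (simp add: numeral_2_eq_2)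
    also have "\<dots> \<le> (1 + \<eta>) * s (m - 1)"
      using eta by (intro mult_left_mono s_lower) auto
    finally show ?thesis .
  qed
  \<comment> \<open>The last block is charged to all earlier coordinates at once.\<close>
  have "v M \<le> \<eta>' * real (k (M - 1)) * (\<gamma> (k (M - 1)))\<^sup>2"
    unfolding v_def by (intro mult_right_mono last) auto
  also have "\<dots> = \<eta>' * (\<Sum>j<k (M - 1). (\<gamma> (k (M - 1)))\<^sup>2)" by simp
  also have "\<dots> \<le> \<eta>' * (\<Sum>j<k (M - 1). (\<gamma> j)\<^sup>2)"
    using eta \<gamma> by (intro mult_left_mono sum_mono power_mono) auto
  also have "\<dots> \<le> \<eta>' * (\<Sum>j<k M. (\<gamma> j)\<^sup>2)"
    using eta block_mono_le[where k = k and M = M and i = "M - 1" and j = M, OF kmono] by (intro mult_left_mono sum_mono2) auto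
  finally have vM: "v M \<le> \<eta>' * (\<Sum>j<k M. (\<gamma> j)\<^sup>2)" .
  \<comment> \<open>The first block has no predecessor to be charged to and is bounded by its
    length.\<close>
  have v1: "v 1 \<le> real (k 1)"
    unfolding v_def using \<gamma>(2,3)[of 0] by (simp add: k0 mult_left_le power_le_one)
  have "(\<Sum>m=1..M. v m) = v 1 + (\<Sum>m=2..<M. v m) + v M"
  proof -
    have "{1..M} = insert 1 (insert M {2..<M})" using M by auto
    thus ?thesis using M by simp
  qed
  also have "(\<Sum>m=2..<M. v m) \<le> (\<Sum>m=2..<M. (1 + \<eta>) * s (m - 1))"
    by (intro sum_mono mid) auto
  also have "\<dots> = (1 + \<eta>) * (\<Sum>m=1..<M - 1. s m)"
    unfolding sum_distrib_left using M
    by (intro sum.reindex_bij_witness[of _ Suc "\<lambda>m. m - 1"]) auto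
  also have "\<dots> \<le> (1 + \<eta>) * (\<Sum>m=1..M. s m)"
    using eta s_nonneg by (intro mult_left_mono sum_mono2) auto
  also have "(\<Sum>m=1..M. s m) = (\<Sum>j<k M. (\<gamma> j)\<^sup>2)"
    unfolding s_def by (rule sum_blocks[OF k0 kmono])
  finally show ?thesis using v1 vM unfolding v_def by (simp add: algebra_simps)
qed

lemma blockwise_oracle_le:
  fixes k :: "nat \<Rightarrow> nat" and \<gamma> \<theta> :: "nat \<Rightarrow> real"
  assumes k0: "k 0 = 0" and kmono: "\<And>m. m < M \<Longrightarrow> k m \<le> k (Suc m)" and M: "M \<ge> 2"
    and eta: "\<eta> \<ge> 0" "\<eta>' \<ge> 0"
    and ratio: "\<And>m. 2 \<le> m \<Longrightarrow> m < M \<Longrightarrow> real (k m - k (m - 1)) \<le> (1 + \<eta>) * real (k (m - 1) - k (m - 2))"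
    and last: "real (k M - k (M - 1)) \<le> \<eta>' * real (k (M - 1))"
    and \<gamma>: "\<And>i j. i \<le> j \<Longrightarrow> \<gamma> j \<le> \<gamma> i" "\<And>j. 0 \<le> \<gamma> j" "\<And>j. \<gamma> j \<le> 1"
  shows "(\<Sum>m=1..M. \<Sum>j=k (m - 1)..<k m. (1 - \<gamma> (k (m - 1)))\<^sup>2 * (\<theta> j)\<^sup>2 + (\<gamma> (k (m - 1)))\<^sup>2 * \<sigma>\<^sup>2)
    \<le> (1 + \<eta> + \<eta>') * (\<Sum>j<k M. (1 - \<gamma> j)\<^sup>2 * (\<theta> j)\<^sup>2 + (\<gamma> j)\<^sup>2 * \<sigma>\<^sup>2) + real (k 1) * \<sigma>\<^sup>2"
proof -
  let ?B = "\<Sum>j<k M. (1 - \<gamma> j)\<^sup>2 * (\<theta> j)\<^sup>2" and ?V = "\<Sum>j<k M. (\<gamma> j)\<^sup>2"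
  have "(\<Sum>m=1..M. \<Sum>j=k (m - 1)..<k m. (1 - \<gamma> (k (m - 1)))\<^sup>2 * (\<theta> j)\<^sup>2)
    \<le> (\<Sum>m=1..M. \<Sum>j=k (m - 1)..<k m. (1 - \<gamma> j)\<^sup>2 * (\<theta> j)\<^sup>2)"
    using \<gamma> by (intro sum_mono mult_right_mono power_mono) auto
  also have "\<dots> = ?B" by (rule sum_blocks[OF k0 kmono])
  finally have 1: "(\<Sum>m=1..M. \<Sum>j=k (m - 1)..<k m. (1 - \<gamma> (k (m - 1)))\<^sup>2 * (\<theta> j)\<^sup>2) \<le> ?B" .
  have 2: "(\<Sum>m=1..M. \<Sum>j=k (m - 1)..<k m. (\<gamma> (k (m - 1)))\<^sup>2 * \<sigma>\<^sup>2) =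
    (\<Sum>m=1..M. real (k m - k (m - 1)) * (\<gamma> (k (m - 1)))\<^sup>2) * \<sigma>\<^sup>2"
    unfolding sum_distrib_right by (simp add: mult.assoc)
  have 3: "\<dots> \<le> (real (k 1) + (1 + \<eta> + \<eta>') * ?V) * \<sigma>\<^sup>2"
    by (intro mult_right_mono blockwise_variance_le assms) auto
  have "?B \<ge> 0" by (intro sum_nonneg) auto
  \<comment> \<open>Bias and variance are to share one factor, so the bias is enlarged by this
    nonnegative amount.\<close>
  hence "(\<eta> + \<eta>') * ?B \<ge> 0" using eta by simp
  have R: "(\<Sum>j<k M. (1 - \<gamma> j)\<^sup>2 * (\<theta> j)\<^sup>2 + (\<gamma> j)\<^sup>2 * \<sigma>\<^sup>2) = ?B + ?V * \<sigma>\<^sup>2"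
    by (simp add: sum.distrib sum_distrib_right)
  have "x + y \<le> (1 + \<eta> + \<eta>') * (b + v * s) + k1 * s"
    if "x \<le> b" "y \<le> (k1 + (1 + \<eta> + \<eta>') * v) * s" "0 \<le> (\<eta> + \<eta>') * b" for x y b v s k1 :: real
    using that by (simp add: algebra_simps)
  from this[OF 1 3 \<open>(\<eta> + \<eta>') * ?B \<ge> 0\<close>] show ?thesis
    unfolding R unfolding sum.distrib 2 .
qed

text \<open>Conditions that hold for all large n. \<rho> (1 + \<rho>) <= 1 keeps the second block no
  longer than the first, \<nu> \<rho> >= 2 lets rounding lose at most half of an increment, and 2
  \<nu> <= p makes room for two blocks.\<close>

locale star_block_system =
  fixes \<nu> p :: nat and \<rho> :: real and k :: "nat \<Rightarrow> nat" and M :: nat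
  defines "\<rho> \<equiv> rho \<nu>" and "k \<equiv> star_models \<nu> p" and "M \<equiv> num_blocks \<nu> p"
  assumes rho: "0 < \<rho>" "\<rho> * (1 + \<rho>) \<le> 1" and nu_rho: "2 \<le> real \<nu> * \<rho>" and nu_p: "2 * \<nu> \<le> p"
begin

text \<open>The increments before rounding; \<open>a 1\<close> is only a lower reference value, as
  the first block has length \<nu>.\<close>

definition a :: "nat \<Rightarrow> real" where "a m = real \<nu> * \<rho> * (1 + \<rho>) ^ (m - 1)"

lemma rho_le_1: "\<rho> \<le> 1"
  using rho by (smt (verit) mult_le_cancel_left1 mult_less_cancel_left2)

lemma a_ge: "real \<nu> * \<rho> \<le> a m"
  unfolding a_def using rho nu_rho by (simp add: mult_le_cancel_left1)

lemma a_Suc: "m \<ge> 1 \<Longrightarrow> a (Suc m) = (1 + \<rho>) * a m"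
  by (cases m) (auto simp: a_def)

lemma inc_bounds:
  "real (block_increment \<nu> m) \<le> a m" "a m - 1 \<le> real (block_increment \<nu> m)" "a m / 2 \<le> real (block_increment \<nu> m)"
proof -
  have 2: "a m \<ge> 2" using a_ge[of m] nu_rho by linarith
  have e: "block_increment \<nu> m = nat \<lfloor>a m\<rfloor>" by (simp add: block_increment_def a_def \<rho>_def)
  show "real (block_increment \<nu> m) \<le> a m" "a m - 1 \<le> real (block_increment \<nu> m)" using 2 unfolding e by linarith+
  thus "a m / 2 \<le> real (block_increment \<nu> m)" using 2 by linarith
qed

lemma inc_pos: "block_increment \<nu> m \<ge> 1"
  using inc_bounds(3)[of m] a_ge[of m] nu_rho by linarith

text \<open>\<open>GREATEST\<close> is meaningful since \<open>m = 2\<close> is admissible and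
  increments of at least 1 bound every admissible \<open>m\<close> by \<open>p + 1\<close>.\<close>

lemma num_blocks_bounds:
  "\<nu> + (\<Sum>j=2..M. block_increment \<nu> j) \<le> p" "p < \<nu> + (\<Sum>j=2..Suc M. block_increment \<nu> j)" "M \<ge> 2"
proof -
  let ?P = "\<lambda>m. \<nu> + (\<Sum>j=2..m. block_increment \<nu> j) \<le> p"
  have bound: "\<forall>m. ?P m \<longrightarrow> m \<le> p + 1"
  proof (intro allI impI)
    fix m assume "?P m"
    moreover have "(\<Sum>j=2..m. 1) \<le> (\<Sum>j=2..m. block_increment \<nu> j)" by (intro sum_mono inc_pos)
    ultimately show "m \<le> p + 1" by simp
  qed
  have "real (block_increment \<nu> 2) \<le> real \<nu> * (\<rho> * (1 + \<rho>))" using inc_bounds(1)[of 2] by (simp add: a_def mult_ac)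
  also have "\<dots> \<le> real \<nu>" using rho by (simp add: mult_left_le)
  finally have P2: "?P 2" using nu_p by simp
  show "?P M" unfolding M_def num_blocks_def by (rule GreatestI_nat[of ?P 2 "p + 1"]) (use P2 bound in auto)
  show "M \<ge> 2" unfolding M_def num_blocks_def by (rule Greatest_le_nat[of ?P 2 "p + 1"]) (use P2 bound in auto)
  show "p < \<nu> + (\<Sum>j=2..Suc M. block_increment \<nu> j)"
  proof (rule ccontr)
    assume "\<not> ?thesis"
    hence "?P (Suc M)" by simp
    hence "Suc M \<le> M" unfolding M_def num_blocks_def by (intro Greatest_le_nat[of ?P _ "p + 1"]) (use bound in auto)
    thus False by simp
  qed
qed

lemma k_0: "k 0 = 0" and k_1: "k 1 = \<nu>"
  by (auto simp: k_def)

lemma k_M: "k M = p"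
proof -
  obtain l where "M = Suc l" "l \<noteq> 0" using num_blocks_bounds(3) by (cases M) auto
  thus ?thesis by (simp add: k_def M_def)
qed

lemma k_mid: "1 \<le> m \<Longrightarrow> m < M \<Longrightarrow> k m = \<nu> + (\<Sum>j=2..m. block_increment \<nu> j)"
proof (induction m)
  case (Suc m)
  show ?case
  proof (cases "m = 0")
    case False
    hence "k (Suc m) = k m + block_increment \<nu> (Suc m)" using Suc.prems by (simp add: k_def M_def)
    thus ?thesis using Suc False by simp
  qed (use k_1 in simp)
qed simp

lemma block_mid:
  assumes "2 \<le> m" "m < M"
  shows "k m = k (m - 1) + block_increment \<nu> m"
proof -
  obtain l where "m = Suc l" "l \<ge> 1" using assms by (cases m) auto
  thus ?thesis using assms k_mid[of m] k_mid[of l] by simp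
qed

text \<open>By maximality of \<open>M\<close>, increment \<open>M\<close> still fits below
  \<open>p\<close> and increment \<open>M + 1\<close> does not; the last block takes up the whole
  remainder.\<close>

lemma block_last:
  "k (M - 1) + block_increment \<nu> M \<le> k M" "k M < k (M - 1) + block_increment \<nu> M + block_increment \<nu> (Suc M)"
proof -
  obtain l where l: "M = Suc l" "l \<ge> 1" using num_blocks_bounds(3) by (cases M) auto
  have "k l = \<nu> + (\<Sum>j=2..l. block_increment \<nu> j)" using l by (intro k_mid) auto
  moreover have e1: "(\<Sum>j=2..M. block_increment \<nu> j) = (\<Sum>j=2..l. block_increment \<nu> j) + block_increment \<nu> M"
    using l by simp
  moreover have e2: "(\<Sum>j=2..Suc M. block_increment \<nu> j) = (\<Sum>j=2..M. block_increment \<nu> j) + block_increment \<nu> (Suc M)"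
    using num_blocks_bounds(3) by simp
  moreover have ml: "M - 1 = l" using l by simp
  ultimately show "k (M - 1) + block_increment \<nu> M \<le> k M" "k M < k (M - 1) + block_increment \<nu> M + block_increment \<nu> (Suc M)"
    using num_blocks_bounds by (auto simp: k_M)
qed

lemma k_block_ge: "1 \<le> m \<Longrightarrow> m \<le> M \<Longrightarrow> k (m - 1) + (if m = 1 then \<nu> else block_increment \<nu> m) \<le> k m"
proof -
  assume m: "1 \<le> m" "m \<le> M"
  consider "m = 1" | "m = M" "m \<noteq> 1" | "2 \<le> m" "m < M" using m by linarith
  thus ?thesis
  proof cases
    case 1
    thus ?thesis using k_0 k_1 by simp
  next
    case 2
    thus ?thesis using block_last(1) by simp
  next
    case 3
    thus ?thesis using block_mid[of m] by simp
  qed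
qed

lemma k_mono: "m < M \<Longrightarrow> k m \<le> k (Suc m)"
  using k_block_ge[of "Suc m"] by simp

lemma block_lower: "1 \<le> m \<Longrightarrow> m \<le> M \<Longrightarrow> a m / 2 \<le> real (k m - k (m - 1))"
proof (cases "m = 1")
  case True
  have "real \<nu> * \<rho> \<le> real \<nu>" using rho_le_1 by (simp add: mult_left_le)
  moreover have "real \<nu> \<ge> 0" by simp
  ultimately have "real \<nu> * \<rho> / 2 \<le> real \<nu>" by linarith
  thus ?thesis using True by (simp add: a_def k_0 k_1[simplified])
next
  case False
  assume "1 \<le> m" "m \<le> M"
  hence "block_increment \<nu> m \<le> k m - k (m - 1)" using k_block_ge[of m] False by simp
  hence "real (block_increment \<nu> m) \<le> real (k m - k (m - 1))" by simp
  thus ?thesis using inc_bounds(3)[of m] by linarith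
qed

text \<open>Rounding costs the factor 1 + 2 / (\<nu> \<rho>), because a >= \<nu> \<rho> >= 2 gives a
  - 1 >= \<nu> \<rho> / 2. At \<open>m = 2\<close> the predecessor has length \<nu>, and \<rho> (1 +
  \<rho>) <= 1 decides.\<close>

lemma block_ratio:
  assumes "2 \<le> m" "m < M"
  shows "real (k m - k (m - 1)) \<le> (1 + \<rho>) * (1 + 2 / (real \<nu> * \<rho>)) * real (k (m - 1) - k (m - 2))"
proof -
  let ?c = "real \<nu> * \<rho>"
  have c: "?c > 0" using nu_rho by simp
  have dm: "real (k m - k (m - 1)) = real (block_increment \<nu> m)" using block_mid[OF assms] by simp
  show ?thesis
  proof (cases "m = 2")
    case True
    have "real (block_increment \<nu> 2) \<le> real \<nu> * (\<rho> * (1 + \<rho>))" using inc_bounds(1)[of 2] by (simp add: a_def mult_ac)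
    also have "\<dots> \<le> real \<nu> * 1" using rho by (intro mult_left_mono) auto
    also have "\<dots> = 1 * 1 * real \<nu>" by simp
    also have "\<dots> \<le> (1 + \<rho>) * (1 + 2 / ?c) * real \<nu>" using rho c by (intro mult_right_mono mult_mono) auto
    finally show ?thesis using True dm k_0 k_1 by simp
  next
    case False
    then obtain l where l: "m = Suc l" "2 \<le> l" "l < M" using assms by (cases m) auto
    have dl: "real (k l - k (l - 1)) = real (block_increment \<nu> l)" using block_mid[OF l(2,3)] by simp
    have "real (block_increment \<nu> m) \<le> (1 + \<rho>) * a l" using inc_bounds(1)[of m] a_Suc[of l] l by simp
    also have "a l \<le> (1 + 2 / ?c) * (a l - 1)"
    proof -
      have "?c * 1 \<le> 2 * a l - 2" using a_ge[of l] nu_rho by linarith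
      hence "1 \<le> 2 / ?c * (a l - 1)" using c by (simp add: field_simps)
      thus ?thesis by (simp add: algebra_simps)
    qed
    also have "\<dots> \<le> (1 + 2 / ?c) * real (block_increment \<nu> l)"
      using inc_bounds(2)[of l] c by (intro mult_left_mono) auto
    finally have "real (block_increment \<nu> m) \<le> (1 + \<rho>) * ((1 + 2 / ?c) * real (block_increment \<nu> l))"
      using rho by simp
    moreover have "m - 1 = l" "m - 2 = l - 1" using l by auto
    ultimately show ?thesis using dm dl by (simp add: mult.assoc)
  qed
qed

text \<open>The unrounded increments telescope: \<nu> \<rho> (1 + \<rho>)^m is the growth of \<nu>
  (1 + \<rho>)^m in one step. The factor 1/2 pays for rounding and, at \<open>m = 1\<close>, for 1 +
  \<rho> <= 2.\<close>

lemma k_lower: "1 \<le> m \<Longrightarrow> m < M \<Longrightarrow> real \<nu> * (1 + \<rho>) ^ m / 2 \<le> real (k m)"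
proof (induction m)
  case (Suc m)
  show ?case
  proof (cases "m = 0")
    case True
    have "real \<nu> * (1 + \<rho>) \<le> real \<nu> * 2" using rho_le_1 by (intro mult_left_mono) auto
    thus ?thesis using True k_1 by simp
  next
    case False
    hence "k (Suc m) = k m + block_increment \<nu> (Suc m)" using block_mid[of "Suc m"] Suc.prems by simp
    moreover have "real \<nu> * (1 + \<rho>) ^ m / 2 \<le> real (k m)" using Suc False by simp
    moreover have "real \<nu> * \<rho> * (1 + \<rho>) ^ m / 2 \<le> real (block_increment \<nu> (Suc m))"
      using inc_bounds(3)[of "Suc m"] by (simp add: a_def)
    moreover have "real \<nu> * (1 + \<rho>) ^ Suc m / 2 = real \<nu> * (1 + \<rho>) ^ m / 2 + real \<nu> * \<rho> * (1 + \<rho>) ^ m / 2"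
      by (simp add: field_simps)
    ultimately show ?thesis by linarith
  qed
qed simp

text \<open>The last block is at most two increments, together at most 3 \<open>a M\<close>, while
  the preceding blocks total at least \<open>a M / (2 * \<rho>)\<close>.\<close>

lemma block_last_ratio: "real (k M - k (M - 1)) \<le> 6 * \<rho> * real (k (M - 1))"
proof -
  have "real (k M - k (M - 1)) \<le> real (block_increment \<nu> M) + real (block_increment \<nu> (Suc M))"
    using block_last by linarith
  also have "\<dots> \<le> a M + a (Suc M)" by (intro add_mono inc_bounds)
  also have "a (Suc M) = (1 + \<rho>) * a M" using num_blocks_bounds(3) by (intro a_Suc) simp
  also have "a M + (1 + \<rho>) * a M \<le> 3 * a M"
    using mult_right_mono[OF rho_le_1, of "a M"] a_ge[of M] nu_rho by (simp add: algebra_simps)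
  also have "3 * a M = 6 * \<rho> * (real \<nu> * (1 + \<rho>) ^ (M - 1) / 2)" by (simp add: a_def)
  also have "\<dots> \<le> 6 * \<rho> * real (k (M - 1))"
    using num_blocks_bounds(3) rho by (intro mult_left_mono k_lower) auto
  finally show ?thesis .
qed

text \<open>One factor 1/\<rho> comes from the lower bound \<nu> \<rho> / 2 on block lengths, the
  other from a geometric series of ratio 1 / (1 + \<rho>).\<close>

lemma sum_inverse_block: "(\<Sum>m=1..M. 1 / real (k m - k (m - 1))) \<le> 4 / (real \<nu> * \<rho>\<^sup>2)"
proof -
  let ?q = "1 / (1 + \<rho>)"
  have c: "real \<nu> * \<rho> > 0" using nu_rho by simp
  have q: "0 \<le> ?q" "?q < 1" using rho by auto
  have "(\<Sum>m=1..M. 1 / real (k m - k (m - 1))) \<le> (\<Sum>m=1..M. 2 / (real \<nu> * \<rho>) * ?q ^ (m - 1))"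
  proof (intro sum_mono)
    fix m assume "m \<in> {1..M}"
    hence "a m / 2 \<le> real (k m - k (m - 1))" by (intro block_lower) auto
    moreover have "a m > 0" using a_ge[of m] c by linarith
    ultimately have "1 / real (k m - k (m - 1)) \<le> 1 / (a m / 2)" by (intro divide_left_mono) auto
    thus "1 / real (k m - k (m - 1)) \<le> 2 / (real \<nu> * \<rho>) * ?q ^ (m - 1)"
      using c by (simp add: a_def power_divide)
  qed
  also have "\<dots> = 2 / (real \<nu> * \<rho>) * (\<Sum>i<M. ?q ^ i)"
    unfolding sum_distrib_left by (intro sum.reindex_bij_witness[of _ Suc "\<lambda>m. m - 1"]) auto
  also have "\<dots> \<le> 2 / (real \<nu> * \<rho>) * (2 / \<rho>)"
  proof (intro mult_left_mono)
    have "(\<Sum>i<M. ?q ^ i) = (1 - ?q ^ M) / (1 - ?q)" using q by (subst sum_gp_strict) auto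
    also have "\<dots> \<le> 1 / (1 - ?q)" using q by (intro divide_right_mono) auto
    also have "\<dots> = (1 + \<rho>) / \<rho>" using rho by (simp add: field_simps)
    also have "\<dots> \<le> 2 / \<rho>" using rho rho_le_1 by (intro divide_right_mono) auto
    finally show "(\<Sum>i<M. ?q ^ i) \<le> 2 / \<rho>" .
  qed (use c in auto)
  also have "\<dots> = 4 / (real \<nu> * \<rho>\<^sup>2)" by (simp add: power2_eq_square)
  finally show ?thesis .
qed

end

section \<open>Risk of the averaging and Stein estimators\<close>

text \<open>Counted from 0, coordinate \<open>j\<close> lies in the models m >= j + 1, so its
  shrinkage factor is a tail sum of weights from \<open>Suc j\<close>.\<close>

lemma sum_triangle_swap:
  fixes f :: "nat \<Rightarrow> nat \<Rightarrow> 'a :: comm_monoid_add"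
  shows "(\<Sum>m=1..p. \<Sum>j<m. f m j) = (\<Sum>j<p. \<Sum>m=Suc j..p. f m j)"
proof (induction p)
  case (Suc p)
  have "(\<Sum>j<Suc p. \<Sum>m=Suc j..Suc p. f m j) = (\<Sum>j<Suc p. (\<Sum>m=Suc j..p. f m j) + f (Suc p) j)"
    by (intro sum.cong) auto
  thus ?case using Suc by (simp add: sum.distrib)
qed simp

text \<open>Weights are functions on all of \<open>nat\<close>, equal to \<open>undefined\<close>
  outside \<open>{1..p}\<close>. Singleton factors there turn the cube into a full product of
  compact sets, to which Tychonoff's theorem applies.\<close>

lemma compact_unit_simplex: "compact (unit_simplex p)"
proof -
  have "compact ((\<Pi>\<^sub>E i\<in>{1..p}. {0..1}) :: (nat \<Rightarrow> real) set)"
  proof -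
    have "compactin (product_topology (\<lambda>_. euclidean) UNIV) (\<Pi>\<^sub>E i\<in>UNIV. if i \<in> {1..p} then {0..1 :: real} else {undefined})"
      by (subst compactin_PiE) (auto simp: compactin_euclidean_iff)
    moreover have "(\<Pi>\<^sub>E i\<in>UNIV. if i \<in> {1..p} then {0..1 :: real} else {undefined}) = (\<Pi>\<^sub>E i\<in>{1..p}. {0..1})"
      by (auto simp: PiE_def Pi_def extensional_def split: if_splits)
    ultimately show ?thesis by (simp add: euclidean_product_topology)
  qed
  moreover have "closed {w :: nat \<Rightarrow> real. (\<Sum>m=1..p. w m) = 1}"
    by (intro closed_Collect_eq continuous_intros continuous_on_product_coordinates)
  ultimately have "compact (({1..p} \<rightarrow>\<^sub>E {0..1}) \<inter> {w :: nat \<Rightarrow> real. (\<Sum>m=1..p. w m) = 1})"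
    by (rule compact_Int_closed)
  thus ?thesis by (simp add: unit_simplex_def Int_def)
qed

lemma unit_simplex_tail:
  assumes w: "w \<in> unit_simplex p"
  defines "\<gamma> \<equiv> \<lambda>j. \<Sum>m=Suc j..p. w m"
  shows "i \<le> j \<Longrightarrow> \<gamma> j \<le> \<gamma> i" "0 \<le> \<gamma> j" "\<gamma> j \<le> 1"
proof -
  have nn: "w m \<ge> 0" if "m \<in> {1..p}" for m
    using w that by (auto simp: unit_simplex_def PiE_def Pi_def)
  have mono: "\<gamma> j \<le> \<gamma> i" if "i \<le> j" for i j
    unfolding \<gamma>_def using that by (intro sum_mono2) (auto intro: nn)
  show "i \<le> j \<Longrightarrow> \<gamma> j \<le> \<gamma> i" by (rule mono)
  show "0 \<le> \<gamma> j" unfolding \<gamma>_def by (intro sum_nonneg nn) auto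
  have "\<gamma> 0 = 1" using w by (simp add: \<gamma>_def unit_simplex_def)
  thus "\<gamma> j \<le> 1" using mono[of 0 j] by simp
qed

locale nested_regression = gaussian_noise M \<epsilon> n \<sigma>
  for M :: "'a measure" and \<epsilon> :: "nat \<Rightarrow> 'a \<Rightarrow> real" and n :: nat and \<sigma> :: real +
  fixes X :: "real mat" and p :: nat and \<mu> :: "real Matrix.vec" and u :: "nat \<Rightarrow> nat \<Rightarrow> real"
  assumes orth: "\<And>j l. j < p \<Longrightarrow> l < p \<Longrightarrow> (\<Sum>i<n. u j i * u l i) = (if j = l then 1 else 0)"
    and col_proj_eq: "\<And>k v. k \<le> p \<Longrightarrow> v \<in> carrier_vec n \<Longrightarrow>
      col_proj n X k v = Matrix.vec n (\<lambda>i. \<Sum>j<k. (\<Sum>i'<n. u j i' * v $ i') * u j i)"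
    and mu_dim: "\<mu> \<in> carrier_vec n"
    and mu_span: "\<exists>a. \<forall>i<n. \<mu> $ i = (\<Sum>j<p. a j * u j i)"
begin

definition y :: "'a \<Rightarrow> real Matrix.vec" where "y \<omega> = \<mu> + Matrix.vec n (\<lambda>i. \<epsilon> i \<omega>)"

definition \<theta> :: "nat \<Rightarrow> real" where "\<theta> j = (\<Sum>i<n. u j i * \<mu> $ i)"

lemma y_dim: "y \<omega> \<in> carrier_vec n" by (simp add: y_def mu_dim)

lemma coord_y: "(\<Sum>i<n. u j i * y \<omega> $ i) = \<theta> j + proj (u j) \<omega>"
  using mu_dim by (simp add: y_def \<theta>_def proj_def distrib_left sum.distrib)

lemma mu_expand: "i < n \<Longrightarrow> \<mu> $ i = (\<Sum>j<p. \<theta> j * u j i)"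
proof -
  obtain a where a: "\<And>i. i < n \<Longrightarrow> \<mu> $ i = (\<Sum>j<p. a j * u j i)" using mu_span by blast
  have "\<theta> l = a l" if "l < p" for l
  proof -
    have "\<theta> l = (\<Sum>i<n. \<Sum>j<p. a j * (u l i * u j i))"
      by (simp add: \<theta>_def a sum_distrib_left mult_ac)
    also have "\<dots> = (\<Sum>j<p. a j * (\<Sum>i<n. u l i * u j i))"
      by (subst sum.swap) (simp add: sum_distrib_left)
    also have "\<dots> = (\<Sum>j<p. if l = j then a j else 0)" by (intro sum.cong) (auto simp: orth that)
    finally show ?thesis using that by simp
  qed
  thus "i < n \<Longrightarrow> \<mu> $ i = (\<Sum>j<p. \<theta> j * u j i)" by (simp add: a)
qed

lemma enorm_expansion:
  assumes "v \<in> carrier_vec n" "\<And>i. i < n \<Longrightarrow> v $ i = (\<Sum>j\<in>J. b j * u j i)" "J \<subseteq> {..<p}"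
  shows "(enorm v)\<^sup>2 = (\<Sum>j\<in>J. (b j)\<^sup>2)"
proof -
  have "(enorm v)\<^sup>2 = (\<Sum>i<n. (\<Sum>j\<in>J. b j * u j i)\<^sup>2)"
    using assms(1,2) by (simp add: enorm_def L2_set_def sum_nonneg)
  also have "\<dots> = (\<Sum>j\<in>J. (b j)\<^sup>2)"
  proof (rule orthonormal_norm)
    show "finite J" using assms(3) finite_subset by blast
    show "(\<Sum>i<n. u j i * u l i) = (if j = l then 1 else 0)" if "j \<in> J" "l \<in> J" for j l
      using assms(3) that by (intro orth) auto
  qed
  finally show ?thesis .
qed

text \<open>In basis coordinates each factor is a tail sum of weights; the cross term is linear in
  the noise and has mean zero.\<close>

lemma averaging_risk_eq:
  "averaging_risk M n X y (\<lambda>m. m) p w \<mu> =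
    (\<Sum>j<p. (1 - (\<Sum>m=Suc j..p. w m))\<^sup>2 * (\<theta> j)\<^sup>2 + (\<Sum>m=Suc j..p. w m)\<^sup>2 * \<sigma>\<^sup>2)"
proof -
  define \<gamma> where "\<gamma> j = (\<Sum>m=Suc j..p. w m)" for j
  have sq: "(enorm (averaging_estimator n X (\<lambda>m. m) p w (y \<omega>) - \<mu>))\<^sup>2 =
    (\<Sum>j<p. (\<gamma> j - 1)\<^sup>2 * (\<theta> j)\<^sup>2 + 2 * \<gamma> j * (\<gamma> j - 1) * \<theta> j * proj (u j) \<omega> + (\<gamma> j)\<^sup>2 * (proj (u j) \<omega>)\<^sup>2)" for \<omega>
  proof -
    have cl: "(\<lambda>m. w m \<cdot>\<^sub>v col_proj n X m (y \<omega>)) \<in> {1..p} \<rightarrow> carrier_vec n"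
      by (auto simp: col_proj_eq y_dim)
    have "averaging_estimator n X (\<lambda>m. m) p w (y \<omega>) \<in> carrier_vec n"
      unfolding averaging_estimator_def by (rule finsum_vec_closed[OF cl])
    moreover have "averaging_estimator n X (\<lambda>m. m) p w (y \<omega>) $ i = (\<Sum>j<p. \<gamma> j * (\<theta> j + proj (u j) \<omega>) * u j i)" if i: "i < n" for i
    proof -
      have "averaging_estimator n X (\<lambda>m. m) p w (y \<omega>) $ i = (\<Sum>m=1..p. (w m \<cdot>\<^sub>v col_proj n X m (y \<omega>)) $ i)"
        unfolding averaging_estimator_def by (rule index_finsum_vec[OF _ i cl]) simp
      also have "\<dots> = (\<Sum>m=1..p. \<Sum>j<m. w m * ((\<theta> j + proj (u j) \<omega>) * u j i))"
        using i by (intro sum.cong refl) (simp add: col_proj_eq y_dim coord_y sum_distrib_left)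
      also have "\<dots> = (\<Sum>j<p. \<gamma> j * (\<theta> j + proj (u j) \<omega>) * u j i)"
        unfolding sum_triangle_swap \<gamma>_def by (simp add: sum_distrib_right mult.assoc)
      finally show ?thesis .
    qed
    ultimately have "(enorm (averaging_estimator n X (\<lambda>m. m) p w (y \<omega>) - \<mu>))\<^sup>2 =
      (\<Sum>j<p. (\<gamma> j * (\<theta> j + proj (u j) \<omega>) - \<theta> j)\<^sup>2)"
      using mu_dim by (intro enorm_expansion) (auto simp: mu_expand left_diff_distrib sum_subtractf)
    also have "\<dots> = (\<Sum>j<p. (\<gamma> j - 1)\<^sup>2 * (\<theta> j)\<^sup>2 + 2 * \<gamma> j * (\<gamma> j - 1) * \<theta> j * proj (u j) \<omega> + (\<gamma> j)\<^sup>2 * (proj (u j) \<omega>)\<^sup>2)"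
      by (intro sum.cong refl) (simp add: power2_eq_square algebra_simps)
    finally show ?thesis .
  qed
  have z2: "(\<integral>\<omega>. (proj (u j) \<omega>)\<^sup>2 \<partial>M) = \<sigma>\<^sup>2" if "j < p" for j
    using proj_expectation_even[of 1 "u j"] orth[OF that that] by (simp add: power2_eq_square)
  have "averaging_risk M n X y (\<lambda>m. m) p w \<mu> =
    (\<Sum>j<p. \<integral>\<omega>. (\<gamma> j - 1)\<^sup>2 * (\<theta> j)\<^sup>2 + 2 * \<gamma> j * (\<gamma> j - 1) * \<theta> j * proj (u j) \<omega> + (\<gamma> j)\<^sup>2 * (proj (u j) \<omega>)\<^sup>2 \<partial>M)"
    unfolding averaging_risk_def mean_sq_error_def sq
    by (intro Bochner_Integration.integral_sum Bochner_Integration.integrable_add integrable_mult_right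
        proj_integrable proj_integrable_power) auto
  also have "\<dots> = (\<Sum>j<p. (1 - \<gamma> j)\<^sup>2 * (\<theta> j)\<^sup>2 + (\<gamma> j)\<^sup>2 * \<sigma>\<^sup>2)"
    using proj_integrable proj_integrable_power
    by (intro sum.cong refl) (simp add: proj_expectation z2 prob_space power2_commute)
  finally show ?thesis by (simp add: \<gamma>_def)
qed

text \<open>\<open>optimal_weights\<close> is a Hilbert choice and minimises only because the
  continuous risk attains its minimum on the compact simplex. The last bound tests the full model,
  whose risk is pure variance; it later forces \<open>p\<close> to exceed twice \<nu>.\<close>

lemma optimal_risk_attained:
  assumes p: "p > 0"
  obtains \<gamma> where "\<And>i j. i \<le> j \<Longrightarrow> \<gamma> j \<le> \<gamma> i" "\<And>j. 0 \<le> \<gamma> j" "\<And>j. \<gamma> j \<le> 1"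
    "optimal_risk M n X y p \<mu> = (\<Sum>j<p. (1 - \<gamma> j)\<^sup>2 * (\<theta> j)\<^sup>2 + (\<gamma> j)\<^sup>2 * \<sigma>\<^sup>2)"
    "optimal_risk M n X y p \<mu> \<le> real p * \<sigma>\<^sup>2"
proof -
  define R where "R w = averaging_risk M n X y (\<lambda>m. m) p w \<mu>" for w
  define e where "e = restrict (\<lambda>m. if m = p then 1 else (0 :: real)) {1..p}"
  have e: "e \<in> unit_simplex p"
    using p by (auto simp: unit_simplex_def e_def sum.delta)
  have "continuous_on (unit_simplex p) R"
    unfolding R_def averaging_risk_eq
    by (intro continuous_intros continuous_on_subset[OF continuous_on_product_coordinates]) auto
  then obtain w0 where w0: "w0 \<in> unit_simplex p" "\<And>w. w \<in> unit_simplex p \<Longrightarrow> R w0 \<le> R w"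
    using continuous_attains_inf[OF compact_unit_simplex] e by blast
  define w where "w = optimal_weights M n X y p \<mu>"
  have "is_arg_min R (\<lambda>w. w \<in> unit_simplex p) w"
    unfolding w_def optimal_weights_def R_def[symmetric] arg_min_def
    by (rule someI[of _ w0]) (use w0 in \<open>auto simp: is_arg_min_def not_less\<close>)
  hence w: "w \<in> unit_simplex p" "\<And>w'. w' \<in> unit_simplex p \<Longrightarrow> R w \<le> R w'"
    by (auto simp: is_arg_min_def not_less)
  have opt: "optimal_risk M n X y p \<mu> = R w" by (simp add: optimal_risk_def R_def w_def)
  have "(\<Sum>m=Suc j..p. e m) = 1" if "j < p" for j
    using that by (simp add: e_def sum.delta)
  hence "R e = real p * \<sigma>\<^sup>2" unfolding R_def averaging_risk_eq by simp
  hence "optimal_risk M n X y p \<mu> \<le> real p * \<sigma>\<^sup>2" using w(2)[OF e] opt by simp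
  thus thesis
    using unit_simplex_tail[OF w(1)] opt
    by (intro that[of "\<lambda>j. \<Sum>m=Suc j..p. w m"]) (auto simp: R_def averaging_risk_eq)
qed

text \<open>The simplex is empty and the chosen weight arbitrary, yet the risk is an empty sum. This
  serves to exclude p = 0 once \<nu> = o(R) is used.\<close>

lemma optimal_risk_zero: "p = 0 \<Longrightarrow> optimal_risk M n X y p \<mu> = 0"
  unfolding optimal_risk_def averaging_risk_eq by simp

section \<open>Block decomposition and total risk of the Stein estimator\<close>

lemma stein_loss:
  fixes k :: "nat \<Rightarrow> nat" and K :: nat and \<phi> :: "nat \<Rightarrow> real"
  assumes k0: "k 0 = 0" and kmono: "\<And>m. m < K \<Longrightarrow> k m \<le> k (Suc m)" and kK: "k K = p"
  shows "(enorm (stein_estimator n X \<sigma> k K \<phi> (y \<omega>) - \<mu>))\<^sup>2 =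
    (\<Sum>m=1..K. \<Sum>j=k (m - 1)..<k m.
      (max 0 (1 - real (card {k (m - 1)..<k m}) * \<sigma>\<^sup>2 * (1 + \<phi> m) / (\<Sum>j=k (m - 1)..<k m. (\<theta> j + proj (u j) \<omega>)\<^sup>2))
        * (\<theta> j + proj (u j) \<omega>) - \<theta> j)\<^sup>2)"
proof -
  define c where "c j = \<theta> j + proj (u j) \<omega>" for j
  define s where "s m = stein_factor n X \<sigma> k \<phi> m (y \<omega>)" for m
  \<comment> \<open>The label of the block containing \<open>j\<close> turns the estimator into a
    single expansion over all coordinates, so that Parseval applies once.\<close>
  define bl where "bl j = (LEAST m. j < k m)" for j
  note km = block_mono_le[where k = k and M = K, OF kmono]
  have kp: "k m \<le> p" if "m \<le> K" for m using km[of m K] that kK by simp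
  have bl: "bl j = m" if "m \<in> {1..K}" "j \<in> {k (m - 1)..<k m}" for m j
    unfolding bl_def
  proof (rule Least_equality)
    fix m' assume "j < k m'"
    show "m \<le> m'"
    proof (rule ccontr)
      assume "\<not> m \<le> m'"
      hence "k m' \<le> k (m - 1)" using that(1) by (intro km) auto
      thus False using that(2) \<open>j < k m'\<close> by simp
    qed
  qed (use that in simp)
  have bv: "block_vec n X k m (y \<omega>) \<in> carrier_vec n"
    "i < n \<Longrightarrow> block_vec n X k m (y \<omega>) $ i = (\<Sum>j=k (m - 1)..<k m. c j * u j i)" if m: "m \<in> {1..K}" for m i
  proof -
    have le: "k (m - 1) \<le> k m" "k m \<le> p" "k (m - 1) \<le> p"
      using km[of "m - 1" m] kp[of m] kp[of "m - 1"] m by auto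
    show "block_vec n X k m (y \<omega>) \<in> carrier_vec n" using le by (simp add: block_vec_def col_proj_eq y_dim)
    assume "i < n"
    hence "block_vec n X k m (y \<omega>) $ i = (\<Sum>j<k m. c j * u j i) - (\<Sum>j<k (m - 1). c j * u j i)"
      using le by (simp add: block_vec_def col_proj_eq y_dim coord_y c_def)
    also have "(\<Sum>j<k m. c j * u j i) = (\<Sum>j<k (m - 1). c j * u j i) + (\<Sum>j=k (m - 1)..<k m. c j * u j i)"
      using le by (simp add: lessThan_atLeast0 sum.atLeastLessThan_concat)
    finally show "block_vec n X k m (y \<omega>) $ i = (\<Sum>j=k (m - 1)..<k m. c j * u j i)" by simp
  qed
  have s: "s m = max 0 (1 - real (card {k (m - 1)..<k m}) * \<sigma>\<^sup>2 * (1 + \<phi> m) / (\<Sum>j=k (m - 1)..<k m. (c j)\<^sup>2))"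
    if m: "m \<in> {1..K}" for m
  proof -
    have le: "k (m - 1) \<le> k m" "k m \<le> p" using km[of "m - 1" m] kp[of m] m by auto
    have "(enorm (block_vec n X k m (y \<omega>)))\<^sup>2 = (\<Sum>j=k (m - 1)..<k m. (c j)\<^sup>2)"
      using bv[OF m] le by (intro enorm_expansion) auto
    thus ?thesis using le by (simp add: s_def stein_factor_def block_size_def of_nat_diff)
  qed
  have cl: "(\<lambda>m. s m \<cdot>\<^sub>v block_vec n X k m (y \<omega>)) \<in> {1..K} \<rightarrow> carrier_vec n" using bv by auto
  have est: "stein_estimator n X \<sigma> k K \<phi> (y \<omega>) = finsum_vec TYPE(real) n (\<lambda>m. s m \<cdot>\<^sub>v block_vec n X k m (y \<omega>)) {1..K}"
    by (simp add: stein_estimator_def s_def)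
  have "stein_estimator n X \<sigma> k K \<phi> (y \<omega>) \<in> carrier_vec n" unfolding est by (rule finsum_vec_closed[OF cl])
  moreover have "stein_estimator n X \<sigma> k K \<phi> (y \<omega>) $ i = (\<Sum>j<p. s (bl j) * c j * u j i)" if i: "i < n" for i
  proof -
    have "stein_estimator n X \<sigma> k K \<phi> (y \<omega>) $ i = (\<Sum>m=1..K. (s m \<cdot>\<^sub>v block_vec n X k m (y \<omega>)) $ i)"
      unfolding est by (rule index_finsum_vec[OF _ i cl]) simp
    also have "\<dots> = (\<Sum>m=1..K. \<Sum>j=k (m - 1)..<k m. s (bl j) * c j * u j i)"
    proof (intro sum.cong refl)
      fix m assume m: "m \<in> {1..K}"
      have "(s m \<cdot>\<^sub>v block_vec n X k m (y \<omega>)) $ i = (\<Sum>j=k (m - 1)..<k m. s m * c j * u j i)"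
        using bv[OF m] i by (simp add: sum_distrib_left mult.assoc)
      also have "\<dots> = (\<Sum>j=k (m - 1)..<k m. s (bl j) * c j * u j i)"
        using bl[OF m] by (intro sum.cong refl) simp
      finally show "(s m \<cdot>\<^sub>v block_vec n X k m (y \<omega>)) $ i = (\<Sum>j=k (m - 1)..<k m. s (bl j) * c j * u j i)" .
    qed
    also have "\<dots> = (\<Sum>j<k K. s (bl j) * c j * u j i)" by (rule sum_blocks[where k = k, OF k0 kmono])
    finally show ?thesis by (simp add: kK)
  qed
  ultimately have "(enorm (stein_estimator n X \<sigma> k K \<phi> (y \<omega>) - \<mu>))\<^sup>2 = (\<Sum>j<p. (s (bl j) * c j - \<theta> j)\<^sup>2)"
    using mu_dim by (intro enorm_expansion) (auto simp: mu_expand left_diff_distrib sum_subtractf)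
  also have "\<dots> = (\<Sum>m=1..K. \<Sum>j=k (m - 1)..<k m. (s (bl j) * c j - \<theta> j)\<^sup>2)"
    unfolding kK[symmetric] by (rule sum_blocks[where k = k, OF k0 kmono, symmetric])
  also have "\<dots> = (\<Sum>m=1..K. \<Sum>j=k (m - 1)..<k m. (s m * c j - \<theta> j)\<^sup>2)"
    by (intro sum.cong refl) (simp add: bl)
  also have "\<dots> = (\<Sum>m=1..K. \<Sum>j=k (m - 1)..<k m.
      (max 0 (1 - real (card {k (m - 1)..<k m}) * \<sigma>\<^sup>2 * (1 + \<phi> m) / (\<Sum>j=k (m - 1)..<k m. (c j)\<^sup>2)) * c j - \<theta> j)\<^sup>2)"
    by (intro sum.cong refl) (simp only: s)
  finally show ?thesis by (simp only: c_def)
qed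

text \<open>The block bounds are summed with a common penalty \<Phi>, which dominates every
  \<open>\<phi> m\<close> because no block is shorter than \<nu> \<rho> / 2.\<close>

lemma stein_risk_le:
  assumes st: "0 < rho \<nu>" "rho \<nu> * (1 + rho \<nu>) \<le> 1" "2 \<le> real \<nu> * rho \<nu>" "2 * \<nu> \<le> p"
    and tau: "0 < \<tau>" "\<tau> < 1 / 2" and C0: "C \<ge> 0"
    and C: "\<And>d. d \<ge> 1 \<Longrightarrow> real d powr \<tau> * exp (- (real d * (real d powr - \<tau>)\<^sup>2 / 16)) \<le> C / real d"
  shows "mean_sq_error M (\<lambda>\<omega>. stein_estimator n X \<sigma> (star_models \<nu> p) (num_blocks \<nu> p)
      (power_penalty \<tau> (star_models \<nu> p)) (y \<omega>)) \<mu>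
    \<le> (1 + 10000000 * (real \<nu> * rho \<nu> / 2) powr - \<tau>) *
        (((1 + rho \<nu>) * (1 + 2 / (real \<nu> * rho \<nu>)) + 6 * rho \<nu>) * optimal_risk M n X y p \<mu> + real \<nu> * \<sigma>\<^sup>2)
      + (300000000 + 48 * C) * \<sigma>\<^sup>2 * (4 / (real \<nu> * (rho \<nu>)\<^sup>2))"
proof -
  interpret star_block_system \<nu> p "rho \<nu>" "star_models \<nu> p" "num_blocks \<nu> p"
    by unfold_locales (use st in auto)
  define k where "k = star_models \<nu> p"
  define K where "K = num_blocks \<nu> p"
  define \<phi> where "\<phi> = power_penalty \<tau> k"
  define B where "B m = {k (m - 1)..<k m}" for m
  define \<Phi> where "\<Phi> = (real \<nu> * rho \<nu> / 2) powr - \<tau>"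
  note lo = block_lower[folded k_def K_def]
  note km = k_mono[folded k_def K_def]
  have nr: "real \<nu> * rho \<nu> / 2 \<ge> 1" using st by simp
  have p: "p > 0"
  proof (rule ccontr)
    assume "\<not> p > 0"
    hence "\<nu> = 0" using st(4) by simp
    thus False using st(3) by simp
  qed
  obtain \<gamma> where \<gamma>: "\<And>i j. i \<le> j \<Longrightarrow> \<gamma> j \<le> \<gamma> i" "\<And>j. 0 \<le> \<gamma> j" "\<And>j. \<gamma> j \<le> 1"
    and opt: "optimal_risk M n X y p \<mu> = (\<Sum>j<p. (1 - \<gamma> j)\<^sup>2 * (\<theta> j)\<^sup>2 + (\<gamma> j)\<^sup>2 * \<sigma>\<^sup>2)"
    and "optimal_risk M n X y p \<mu> \<le> real p * \<sigma>\<^sup>2"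
    by (rule optimal_risk_attained[OF p]) blast
  define L where "L m \<omega> = (\<Sum>j\<in>B m. (max 0 (1 - real (card (B m)) * \<sigma>\<^sup>2 * (1 + \<phi> m) /
    (\<Sum>j\<in>B m. (\<theta> j + proj (u j) \<omega>)\<^sup>2)) * (\<theta> j + proj (u j) \<omega>) - \<theta> j)\<^sup>2)" for m \<omega>
  \<comment> \<open>\<open>k (m - 1)\<close> is the first coordinate of block \<open>m\<close>,
    counted from 0, where the nonincreasing \<gamma> is largest.\<close>
  define Or where "Or m = (\<Sum>j\<in>B m. (1 - \<gamma> (k (m - 1)))\<^sup>2 * (\<theta> j)\<^sup>2 + (\<gamma> (k (m - 1)))\<^sup>2 * \<sigma>\<^sup>2)" for m
  have block: "integrable M (L m)"
    "(\<integral>\<omega>. L m \<omega> \<partial>M) \<le> (1 + 10000000 * \<Phi>) * Or m + (300000000 + 48 * C) * \<sigma>\<^sup>2 * (1 / real (k m - k (m - 1)))"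
    if m: "m \<in> {1..K}" for m
  proof -
    define d where "d = card (B m)"
    have d: "d = k m - k (m - 1)" by (simp add: d_def B_def)
    have a: "real \<nu> * rho \<nu> / 2 \<le> real d" using lo[of m] a_ge[of m] m unfolding d by auto
    hence d1: "d \<ge> 1" using nr by linarith
    have le: "k m \<le> p" using block_mono_le[where k = k and M = K and i = m and j = K, OF km] m k_M by (simp add: k_def K_def)
    have \<phi>: "\<phi> m = real d powr - \<tau>"
      using d1 by (simp add: \<phi>_def power_penalty_def block_size_def d of_nat_diff powr_minus_divide)
    have phi: "0 < \<phi> m" "\<phi> m \<le> 1" "1 \<le> real d * (\<phi> m)\<^sup>2"
    proof -
      show "0 < \<phi> m" unfolding \<phi> using d1 by simp
      show "\<phi> m \<le> 1" unfolding \<phi> using d1 tau by (simp add: powr_minus_divide ge_one_powr_ge_zero)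
      have "real d * (real d powr - \<tau>)\<^sup>2 = real d powr 1 * real d powr (- (2 * \<tau>))"
        using d1 by (simp add: powr_power mult.commute)
      also have "\<dots> = real d powr (1 - 2 * \<tau>)" by (simp only: powr_add[symmetric]) simp
      also have "\<dots> \<ge> 1" using d1 tau by (intro ge_one_powr_ge_zero) auto
      finally show "1 \<le> real d * (\<phi> m)\<^sup>2" unfolding \<phi> .
    qed
    have \<Phi>: "\<phi> m \<le> \<Phi>"
      unfolding \<phi> \<Phi>_def using a nr tau by (intro powr_mono2') auto
    have orthB: "\<And>j l. j \<in> B m \<Longrightarrow> l \<in> B m \<Longrightarrow> (\<Sum>i<n. u j i * u l i) = (if j = l then 1 else 0)"
      using le by (intro orth) (auto simp: B_def)
    have fin: "finite (B m)" "B m \<noteq> {}" using d1 d by (auto simp: B_def)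
    note sb = stein_block_risk(1)[where \<theta> = \<theta> and u = u and J = "B m" and \<phi> = "\<phi> m", OF fin(1) orthB fin(2) phi[unfolded d_def]]
      stein_block_risk(2)[where \<theta> = \<theta> and u = u and J = "B m" and \<phi> = "\<phi> m" and g = "\<gamma> (k (m - 1))",
        OF fin(1) orthB fin(2) phi[unfolded d_def]]
    show "integrable M (L m)" unfolding L_def[abs_def] by (rule sb(1))
    have Or: "Or m \<ge> 0" unfolding Or_def by (intro sum_nonneg) auto
    have "(\<integral>\<omega>. L m \<omega> \<partial>M) \<le> (1 + 10000000 * \<phi> m) * Or m + 300000000 * \<sigma>\<^sup>2 / real d
        + 48 * \<sigma>\<^sup>2 / \<phi> m * exp (- (real d * (\<phi> m)\<^sup>2 / 16))"
      unfolding L_def Or_def d_def by (rule sb(2))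
    also have "48 * \<sigma>\<^sup>2 / \<phi> m * exp (- (real d * (\<phi> m)\<^sup>2 / 16)) =
        48 * \<sigma>\<^sup>2 * (real d powr \<tau> * exp (- (real d * (real d powr - \<tau>)\<^sup>2 / 16)))"
      unfolding \<phi> by (simp add: powr_minus_divide)
    also have "\<dots> \<le> 48 * \<sigma>\<^sup>2 * (C / real d)" using C[OF d1] by (intro mult_left_mono) auto
    also have "(1 + 10000000 * \<phi> m) * Or m \<le> (1 + 10000000 * \<Phi>) * Or m"
      using \<Phi> Or by (intro mult_right_mono) auto
    finally show "(\<integral>\<omega>. L m \<omega> \<partial>M) \<le> (1 + 10000000 * \<Phi>) * Or m + (300000000 + 48 * C) * \<sigma>\<^sup>2 * (1 / real (k m - k (m - 1)))"
      unfolding d[symmetric] by (simp add: algebra_simps add_divide_distrib)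
  qed
  have "mean_sq_error M (\<lambda>\<omega>. stein_estimator n X \<sigma> k K \<phi> (y \<omega>)) \<mu> = (\<integral>\<omega>. (\<Sum>m=1..K. L m \<omega>) \<partial>M)"
    unfolding mean_sq_error_def
    by (subst stein_loss) (use k_0 k_M km in \<open>simp_all add: k_def K_def L_def B_def\<close>)
  also have "\<dots> = (\<Sum>m=1..K. \<integral>\<omega>. L m \<omega> \<partial>M)" by (intro Bochner_Integration.integral_sum block)
  also have "\<dots> \<le> (\<Sum>m=1..K. (1 + 10000000 * \<Phi>) * Or m + (300000000 + 48 * C) * \<sigma>\<^sup>2 * (1 / real (k m - k (m - 1))))"
    by (intro sum_mono block)
  also have "\<dots> = (1 + 10000000 * \<Phi>) * (\<Sum>m=1..K. Or m) + (300000000 + 48 * C) * \<sigma>\<^sup>2 * (\<Sum>m=1..K. 1 / real (k m - k (m - 1)))"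
    by (simp only: sum.distrib sum_distrib_left)
  also have "\<dots> \<le> (1 + 10000000 * \<Phi>) * (((1 + rho \<nu>) * (1 + 2 / (real \<nu> * rho \<nu>)) + 6 * rho \<nu>) * optimal_risk M n X y p \<mu> + real \<nu> * \<sigma>\<^sup>2)
      + (300000000 + 48 * C) * \<sigma>\<^sup>2 * (4 / (real \<nu> * (rho \<nu>)\<^sup>2))"
  proof (intro add_mono mult_left_mono)
    define \<eta> where "\<eta> = (1 + rho \<nu>) * (1 + 2 / (real \<nu> * rho \<nu>)) - 1"
    have "1 * 1 \<le> (1 + rho \<nu>) * (1 + 2 / (real \<nu> * rho \<nu>))" using st by (intro mult_mono) auto
    hence eta: "\<eta> \<ge> 0" by (simp add: \<eta>_def)
    have "(\<Sum>m=1..K. Or m) \<le> (1 + \<eta> + 6 * rho \<nu>) * (\<Sum>j<k K. (1 - \<gamma> j)\<^sup>2 * (\<theta> j)\<^sup>2 + (\<gamma> j)\<^sup>2 * \<sigma>\<^sup>2) + real (k 1) * \<sigma>\<^sup>2"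
      unfolding Or_def B_def
    proof (rule blockwise_oracle_le[where k = k and M = K])
      show "K \<ge> 2" using num_blocks_bounds(3) by (simp add: K_def)
      show "k 0 = 0" using k_0 by (simp add: k_def)
      show "real (k m - k (m - 1)) \<le> (1 + \<eta>) * real (k (m - 1) - k (m - 2))" if "2 \<le> m" "m < K" for m
        using block_ratio[of m] that by (simp add: \<eta>_def k_def K_def)
      show "real (k K - k (K - 1)) \<le> 6 * rho \<nu> * real (k (K - 1))"
        using block_last_ratio by (simp add: k_def K_def)
    qed (use km eta st \<gamma> in auto)
    thus "(\<Sum>m=1..K. Or m) \<le> ((1 + rho \<nu>) * (1 + 2 / (real \<nu> * rho \<nu>)) + 6 * rho \<nu>) * optimal_risk M n X y p \<mu> + real \<nu> * \<sigma>\<^sup>2"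
      using k_M k_1 unfolding opt by (simp add: \<eta>_def k_def K_def)
    show "(\<Sum>m=1..K. 1 / real (k m - k (m - 1))) \<le> 4 / (real \<nu> * (rho \<nu>)\<^sup>2)"
      using sum_inverse_block by (simp add: k_def K_def)
  qed (use C0 in \<open>auto simp: \<Phi>_def\<close>)
  finally show ?thesis unfolding k_def K_def \<phi>_def \<Phi>_def .
qed

end

section \<open>Asymptotic optimality\<close>

text \<open>The limits are taken in a real variable and composed with \<nu>. The division by \<nu>
  in the last one prepares for the factor \<nu> / R in the final estimate.\<close>

lemma block_asymptotics:
  fixes \<nu> :: "nat \<Rightarrow> nat" and \<tau> :: real
  assumes nu: "filterlim \<nu> at_top sequentially" and tau: "0 < \<tau>"
  shows "\<forall>\<^sub>F n in sequentially. 0 < rho (\<nu> n) \<and> rho (\<nu> n) * (1 + rho (\<nu> n)) \<le> 1 \<and> 2 \<le> real (\<nu> n) * rho (\<nu> n)"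
    and "(\<lambda>n. (real (\<nu> n) * rho (\<nu> n) / 2) powr - \<tau>) \<longlonglongrightarrow> 0"
    and "(\<lambda>n. (1 + rho (\<nu> n)) * (1 + 2 / (real (\<nu> n) * rho (\<nu> n))) + 6 * rho (\<nu> n)) \<longlonglongrightarrow> 1"
    and "(\<lambda>n. 4 / (real (\<nu> n) * (rho (\<nu> n))\<^sup>2) / real (\<nu> n)) \<longlonglongrightarrow> 0"
proof -
  have x: "filterlim (\<lambda>n. real (\<nu> n)) at_top sequentially"
    by (rule filterlim_compose[OF filterlim_real_sequentially nu])
  have "\<forall>\<^sub>F x :: real in at_top. 0 < 1 / ln x" "\<forall>\<^sub>F x :: real in at_top. 1 / ln x * (1 + 1 / ln x) \<le> 1"
    "\<forall>\<^sub>F x :: real in at_top. 2 \<le> x * (1 / ln x)" by real_asymp+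
  hence "\<forall>\<^sub>F x :: real in at_top. 0 < 1 / ln x \<and> 1 / ln x * (1 + 1 / ln x) \<le> 1 \<and> 2 \<le> x * (1 / ln x)"
    by (intro eventually_conj)
  from eventually_compose_filterlim[OF this x]
  show "\<forall>\<^sub>F n in sequentially. 0 < rho (\<nu> n) \<and> rho (\<nu> n) * (1 + rho (\<nu> n)) \<le> 1 \<and> 2 \<le> real (\<nu> n) * rho (\<nu> n)"
    by (simp add: rho_def)
  have "((\<lambda>x. (x * (1 / ln x) / 2) powr - \<tau>) \<longlongrightarrow> 0) at_top" using tau by real_asymp
  from filterlim_compose[OF this x]
  show "(\<lambda>n. (real (\<nu> n) * rho (\<nu> n) / 2) powr - \<tau>) \<longlonglongrightarrow> 0" by (simp add: rho_def)
  have "((\<lambda>x :: real. (1 + 1 / ln x) * (1 + 2 / (x * (1 / ln x))) + 6 * (1 / ln x)) \<longlongrightarrow> 1) at_top" by real_asymp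
  from filterlim_compose[OF this x]
  show "(\<lambda>n. (1 + rho (\<nu> n)) * (1 + 2 / (real (\<nu> n) * rho (\<nu> n))) + 6 * rho (\<nu> n)) \<longlonglongrightarrow> 1"
    by (simp add: rho_def)
  have "((\<lambda>x :: real. 4 / (x * (1 / ln x)\<^sup>2) / x) \<longlongrightarrow> 0) at_top" by real_asymp
  from filterlim_compose[OF this x]
  show "(\<lambda>n. 4 / (real (\<nu> n) * (rho (\<nu> n))\<^sup>2) / real (\<nu> n)) \<longlonglongrightarrow> 0" by (simp add: rho_def)
qed

theorem corollary3:
  fixes \<Omega> :: "nat \<Rightarrow> 'a measure"
    and \<epsilon> :: "nat \<Rightarrow> nat \<Rightarrow> 'a \<Rightarrow> real"
    and X :: "nat \<Rightarrow> real mat"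
    and \<beta> \<mu> :: "nat \<Rightarrow> real Matrix.vec"
    and y :: "nat \<Rightarrow> 'a \<Rightarrow> real Matrix.vec"
    and p \<nu> :: "nat \<Rightarrow> nat"
    and \<sigma> \<tau> :: real
  assumes prob: "\<And>n. prob_space (\<Omega> n)"
    and sigma: "\<sigma> > 0"
    and noise_indep: "\<And>n. prob_space.indep_vars (\<Omega> n) (\<lambda>_. borel) (\<epsilon> n) {..<n}"
    and noise_normal: "\<And>n i. i < n \<Longrightarrow> distributed (\<Omega> n) lborel (\<epsilon> n i) (normal_density 0 \<sigma>)"
    and p_le: "\<And>n. p n \<le> n"
    and X_dim: "\<And>n. X n \<in> carrier_mat n (p n)"
    and X_rank: "\<And>n. vec_space.rank n (X n) = p n"
    and beta_dim: "\<And>n. \<beta> n \<in> carrier_vec (p n)"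
    and mu: "\<And>n. \<mu> n = X n *\<^sub>v \<beta> n"
    and y: "\<And>n \<omega>. y n \<omega> = \<mu> n + Matrix.vec n (\<lambda>i. \<epsilon> n i \<omega>)"
    and nu_pos: "\<And>n. \<nu> n > 0"
    and nu_lim: "filterlim \<nu> at_top sequentially"
    and tau: "0 < \<tau>" "\<tau> < 1 / 2"
    and nu_small: "(\<lambda>n. real (\<nu> n)) \<in> o(\<lambda>n. optimal_risk (\<Omega> n) n (X n) (y n) (p n) (\<mu> n))"
  shows "\<exists>\<delta> :: nat \<Rightarrow> real. \<delta> \<longlonglongrightarrow> 0 \<and>
    (\<forall>\<^sub>F n in sequentially.
      mean_sq_error (\<Omega> n)
        (\<lambda>\<omega>. let k = star_models (\<nu> n) (p n)
             in stein_estimator n (X n) \<sigma> k (num_blocks (\<nu> n) (p n)) (power_penalty \<tau> k) (y n \<omega>))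
        (\<mu> n)
      \<le> (1 + \<delta> n) * optimal_risk (\<Omega> n) n (X n) (y n) (p n) (\<mu> n))"
proof -
  define R where "R n = optimal_risk (\<Omega> n) n (X n) (y n) (p n) (\<mu> n)" for n
  define S where "S n = mean_sq_error (\<Omega> n)
    (\<lambda>\<omega>. stein_estimator n (X n) \<sigma> (star_models (\<nu> n) (p n)) (num_blocks (\<nu> n) (p n))
      (power_penalty \<tau> (star_models (\<nu> n) (p n))) (y n \<omega>)) (\<mu> n)" for n
  obtain C where C: "C \<ge> 0"
    "\<And>d. d \<ge> 1 \<Longrightarrow> real d powr \<tau> * exp (- (real d * (real d powr - \<tau>)\<^sup>2 / 16)) \<le> C / real d"
    using excess_tail_bounded[OF tau] by blast
  define A where "A n = 1 + 10000000 * (real (\<nu> n) * rho (\<nu> n) / 2) powr - \<tau>" for n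
  define E where "E n = (1 + rho (\<nu> n)) * (1 + 2 / (real (\<nu> n) * rho (\<nu> n))) + 6 * rho (\<nu> n)" for n
  define B where "B n = 4 / (real (\<nu> n) * (rho (\<nu> n))\<^sup>2)" for n
  define K where "K = (300000000 + 48 * C) * \<sigma>\<^sup>2"
  \<comment> \<open>The basis and the locale built on it depend on n; the three facts exported here
    no longer mention them.\<close>
  have R_zero: "p n = 0 \<Longrightarrow> R n = 0"
    and R_le: "p n > 0 \<Longrightarrow> R n \<le> real (p n) * \<sigma>\<^sup>2"
    and S_le: "\<lbrakk>0 < rho (\<nu> n); rho (\<nu> n) * (1 + rho (\<nu> n)) \<le> 1; 2 \<le> real (\<nu> n) * rho (\<nu> n); 2 * \<nu> n \<le> p n\<rbrakk>
      \<Longrightarrow> S n \<le> A n * (E n * R n + real (\<nu> n) * \<sigma>\<^sup>2) + K * B n" for n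
  proof -
    obtain u :: "nat \<Rightarrow> nat \<Rightarrow> real" where u:
      "\<And>j l. j < p n \<Longrightarrow> l < p n \<Longrightarrow> (\<Sum>i<n. u j i * u l i) = (if j = l then 1 else 0)"
      "\<And>k (v :: real Matrix.vec). k \<le> p n \<Longrightarrow> v \<in> carrier_vec n \<Longrightarrow>
        col_proj n (X n) k v = Matrix.vec n (\<lambda>i. \<Sum>j<k. (\<Sum>i'<n. u j i' * v $ i') * u j i)"
      "\<And>b. b \<in> carrier_vec (p n) \<Longrightarrow> \<exists>a. \<forall>i<n. (X n *\<^sub>v b) $ i = (\<Sum>j<p n. a j * u j i)"
      using nested_orthonormal_basis[OF X_dim X_rank] by blast
    interpret N: nested_regression "\<Omega> n" "\<epsilon> n" n \<sigma> "X n" "p n" "\<mu> n" u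
    proof (intro nested_regression.intro gaussian_noise.intro gaussian_noise_axioms.intro nested_regression_axioms.intro)
      show "\<mu> n \<in> carrier_vec n" using X_dim[of n] beta_dim[of n] by (simp add: mu)
      show "\<exists>a. \<forall>i<n. \<mu> n $ i = (\<Sum>j<p n. a j * u j i)" unfolding mu by (rule u(3)[OF beta_dim])
    qed (use prob noise_indep noise_normal sigma u(1,2) in auto)
    have y_eq: "y n = N.y" by (intro ext) (simp add: y N.y_def)
    show "R n = 0" if "p n = 0" unfolding R_def y_eq by (rule N.optimal_risk_zero[OF that])
    show "R n \<le> real (p n) * \<sigma>\<^sup>2" if "p n > 0"
      unfolding R_def y_eq by (rule N.optimal_risk_attained[OF that])
    show "S n \<le> A n * (E n * R n + real (\<nu> n) * \<sigma>\<^sup>2) + K * B n"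
      if "0 < rho (\<nu> n)" "rho (\<nu> n) * (1 + rho (\<nu> n)) \<le> 1" "2 \<le> real (\<nu> n) * rho (\<nu> n)" "2 * \<nu> n \<le> p n"
      unfolding S_def A_def E_def R_def K_def B_def y_eq by (rule N.stein_risk_le[OF that tau C])
  qed
  have R_nonneg: "R n \<ge> 0" for n
    unfolding R_def optimal_risk_def averaging_risk_def mean_sq_error_def by (rule Bochner_Integration.integral_nonneg) simp
  note asym = block_asymptotics[OF nu_lim tau(1)]
  have small: "(\<lambda>n. real (\<nu> n)) \<in> o(R)" using nu_small by (simp add: R_def[abs_def])
  \<comment> \<open>This constant in the definition of o makes 2 \<nu> <= R / \<sigma>^2 <= p
    eventually.\<close>
  have "1 / (2 * \<sigma>\<^sup>2) > 0" using sigma by simp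
  from landau_o.smallD[OF small this]
  have "\<forall>\<^sub>F n in sequentially. R n > 0 \<and> 2 * \<nu> n \<le> p n"
  proof eventually_elim
    case (elim n)
    hence le: "real (\<nu> n) \<le> R n / (2 * \<sigma>\<^sup>2)" using R_nonneg[of n] by simp
    have "real (\<nu> n) > 0" using nu_pos by simp
    with le have R: "R n / (2 * \<sigma>\<^sup>2) > 0" by linarith
    hence R_pos: "R n > 0" using sigma by (simp add: zero_less_divide_iff)
    hence "p n > 0" using R_zero[of n] by (cases "p n = 0") auto
    hence "R n \<le> real (p n) * \<sigma>\<^sup>2" by (rule R_le)
    hence "R n / (2 * \<sigma>\<^sup>2) \<le> real (p n) / 2" using sigma by (simp add: field_simps)
    with le have "2 * real (\<nu> n) \<le> real (p n)" by linarith
    thus ?case using R_pos by linarith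
  qed
  hence large: "\<forall>\<^sub>F n in sequentially. R n > 0 \<and> S n \<le> A n * (E n * R n + real (\<nu> n) * \<sigma>\<^sup>2) + K * B n"
    using asym(1) by eventually_elim (use S_le in blast)
  \<comment> \<open>Chosen so that (1 + \<delta>) R reproduces the risk bound exactly, with \<nu>
    written as (\<nu> / R) R.\<close>
  define \<delta> where "\<delta> n = A n * E n - 1 + (A n * \<sigma>\<^sup>2 + K * (B n / real (\<nu> n))) * (real (\<nu> n) / R n)" for n
  have ratio: "(\<lambda>n. real (\<nu> n) / R n) \<longlonglongrightarrow> 0" by (rule smalloD_tendsto[OF small])
  have A: "A \<longlonglongrightarrow> 1 + 10000000 * 0" unfolding A_def by (intro tendsto_intros asym(2))
  have "\<delta> \<longlonglongrightarrow> (1 + 10000000 * 0) * 1 - 1 + ((1 + 10000000 * 0) * \<sigma>\<^sup>2 + K * 0) * 0"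
    unfolding \<delta>_def[abs_def] by (intro tendsto_intros A ratio asym(3,4)[folded E_def B_def])
  hence "\<delta> \<longlonglongrightarrow> 0" by simp
  moreover have "\<forall>\<^sub>F n in sequentially. S n \<le> (1 + \<delta> n) * R n"
    using large
  proof eventually_elim
    case (elim n)
    define q where "q = real (\<nu> n) / R n"
    have q: "q * R n = real (\<nu> n)" using elim by (simp add: q_def)
    have "(1 + \<delta> n) * R n = A n * E n * R n + (A n * \<sigma>\<^sup>2 + K * (B n / real (\<nu> n))) * (q * R n)"
      unfolding \<delta>_def q_def[symmetric] by (simp add: algebra_simps)
    also have "\<dots> = A n * E n * R n + (A n * \<sigma>\<^sup>2 + K * (B n / real (\<nu> n))) * real (\<nu> n)"
      by (simp only: q)
    also have "\<dots> = A n * (E n * R n + real (\<nu> n) * \<sigma>\<^sup>2) + K * B n"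
      using nu_pos[of n] by (simp add: algebra_simps)
    finally show ?case using elim by simp
  qed
  ultimately show ?thesis unfolding S_def R_def Let_def by blast
qed

end
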